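(* Let $\eta$ be a normalized and differentiable Young function in $\Delta_2$. Let $a,b:[0,\infty)\to[0,\infty)$ be continuous functions, positive on $(0,\infty)$, with $a(0)=b(0)=0$, such that $b$ is non-decreasing and $\lim_{s\to\infty}b(s)=\infty$, and define $$\phi(t)=\int_0^t a(s)\,ds,\qquad \psi(t)=\int_0^t b(s)\,ds .$$ If $\phi$ is a Young function, then the following statements (a)–(f) are equivalent: (a) There exists a positive constant $C$ such that the inequality $$\int_0^{t}\frac{a(s)}{s}\,\eta'(t/s)\,ds\leq C\,b(Ct)$$ holds for every $t\geq 0$. (b) Given any $\theta\geq 0$, there exist nonnegative constants $C$ and $\sigma$ such that the inequality $$\int_{\mathbb{R}^n}\phi(M_\eta^{\rho,\sigma} f(x))w(x)\,dx\leq C\int_{\mathbb{R}^n} \psi(C|f(x)|)M^{\rho,\theta}w(x)\,dx$$ holds for every $w\geq 0$ and every function $f\in L^{\psi}(M^{\rho,\theta}w)$. (c) For every $\theta\geq 0$, there exist nonnegative constants $C$ and $\sigma$ such that the estimate $$\|M_\eta^{\rho,\sigma}f\|_{\phi,w}\leq C\|f\|_{\psi, M^{\rho,\theta}w}$$ holds for every $w\geq 0$ and every function $f\in L^{\psi}(M^{\rho,\theta}w)$. (d) There exist nonnegative constants $C$ and $\sigma$ such that the inequality $$\int_{\mathbb{R}^n}\phi(M_\eta^{\rho,\sigma} f(x))\,dx\leq C\int_{\mathbb{R}^n} \psi(C|f(x)|)\,dx$$ holds for every $f\in L^{\psi}$. (e) For every $\theta\geq 0$ there exist $C,\sigma\geq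 0$ such that the inequality $$\int_{\mathbb{R}^n}\phi\left(\frac{M^{\rho,\gamma}f(x)}{M_{\tilde \eta}^{\rho,\gamma-\sigma}u(x)}\right)w(x)\,dx\leq C\int_{\mathbb{R}^n} \psi\left(\frac{|f(x)|}{u(x)}\right)M^{\rho,\theta}w(x)\,dx$$ holds for every $\gamma\geq \sigma$ and all nonnegative functions $f$, $u$ and $w$. (f) There exist constants $C>0$ and $\sigma\geq 0$ such that $$\|M_\eta^{\rho,\sigma}f\|_{\phi}\leq C\|f\|_{\psi}$$ holds for every $f\in L^{\psi}$.
   Context: Throughout, $\rho:\mathbb{R}^n\to(0,\infty)$ is a fixed critical radius function: there are constants $C_0,N_0\ge 1$ such that $$C_0^{-1}\rho(x)\left(1+\frac{|x-y|}{\rho(x)}\right)^{-N_0}\le\rho(y)\le C_0\,\rho(x)\left(1+\frac{|x-y|}{\rho(x)}\right)^{\frac{N_0}{N_0+1}}\quad\text{for all }x,y\in\mathbb{R}^n.$$ Cubes: $Q=Q(x_0,r_0)$ denotes the cube with sides parallel to the coordinate axes, center $x_0$ and "radius" $r_0=\sqrt n\,\ell(Q)/2$, where $\ell(Q)$ is its side length. A Young function is a function $\Phi:[0,\infty)\to[0,\infty)$ that is increasing, convex, with $\Phi(0)=0$ and $\Phi(t)\to\infty$ as $t\to\infty$. It is normalized if $\Phi(1)=1$. $\Phi\in\Delta_2$ (doubling) means there is $C>0$ with $\Phi(2t)\le C\Phi(t)$ for all $t\ge0$. The complementary function is $\tilde\Phi(t)=\sup\{st-\Phi(s):s\ge0\}$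 (it may take the value $+\infty$). Under the assumptions on $b$, the function $\psi$ is a Young function. Maximal operators, for $\sigma\ge0$ (suprema over all cubes $Q=Q(x_0,r_0)$ containing $x$): $$M^{\rho,\sigma}f(x)=\sup_{Q(x_0,r_0)\ni x}\left(1+\frac{r_0}{\rho(x_0)}\right)^{-\sigma}\frac1{|Q|}\int_Q|f(y)|\,dy,\qquad M_\eta^{\rho,\sigma}f(x)=\sup_{Q(x_0,r_0)\ni x}\left(1+\frac{r_0}{\rho(x_0)}\right)^{-\sigma}\|f\|_{\eta,Q},$$ where $\|f\|_{\eta,Q}=\inf\{\lambda>0:\frac1{|Q|}\int_Q\eta(|f(x)|/\lambda)\,dx\le1\}$; $M_{\tilde\eta}^{\rho,\sigma}$ is defined in the same way with $\tilde\eta$ in place of $\eta$. For a nonnegative function $w$ and a function $\Phi$ (here $\Phi=\phi$ or $\psi$), $\varrho_{\Phi,w}(f)=\int_{\mathbb{R}^n}\Phi(|f(x)|)w(x)\,dx$; $L^\Phi(w)$ is the set of measurable $f$ with $\varrho_{\Phi,w}(f/\lambda)<\infty$ for some $\lambda>0$; $\|f\|_{\Phi,w}=\inf\{\lambda>0:\varrho_{\Phi,w}(f/\lambda)\le1\}$. When $w=1$ one writes $L^\Phi$ and $\|\cdot\|_\Phi$.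
   Formalization: In (e) the right side has ψ(C|f|/u) instead of ψ(|f|/u): as printed, (a) does not imply (e), e.g. for η(t)=t, a(s)=s·e^s, b(s)=e^s−1, where u=w=1 and f=k·1_B would force φ ≤ Cψ. *)

theory Defs
  imports "HOL-Analysis.Analysis"
begin

section \<open>Critical radius functions and cubes\<close>

definition critical_radius :: "(real ^ 'n \<Rightarrow> real) \<Rightarrow> bool" where
  "critical_radius \<rho> \<longleftrightarrow>
     (\<forall>x. 0 < \<rho> x) \<and>
     (\<exists>C\<^sub>0 N\<^sub>0. 1 \<le> C\<^sub>0 \<and> 1 \<le> N\<^sub>0 \<and>
        (\<forall>x y. inverse C\<^sub>0 * \<rho> x * (1 + norm (x - y) / \<rho> x) powr (- N\<^sub>0) \<le> \<rho> y \<and>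
               \<rho> y \<le> C\<^sub>0 * \<rho> x * (1 + norm (x - y) / \<rho> x) powr (N\<^sub>0 / (N\<^sub>0 + 1))))"

text \<open>The parameter \<open>r\<close> is the half-diagonal, so the half side length is \<open>r / sqrt n\<close>.\<close>

definition cube :: "real ^ 'n \<Rightarrow> real \<Rightarrow> (real ^ 'n) set" where
  "cube x\<^sub>0 r = cbox (x\<^sub>0 - (\<chi> i. r / sqrt (real CARD('n)))) (x\<^sub>0 + (\<chi> i. r / sqrt (real CARD('n))))"


section \<open>Young functions\<close>

text \<open>Functions on $[0,\infty)$ are represented by functions on all reals, whose values at negative
  arguments play no role.\<close>

definition young_function :: "(real \<Rightarrow> real) \<Rightarrow> bool" where
  "young_function \<Phi> \<longleftrightarrow>
     mono_on {0..} \<Phi> \<and> convex_on {0..} \<Phi> \<and> \<Phi> 0 = 0 \<and> filterlim \<Phi> at_top at_top"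

definition normalized :: "(real \<Rightarrow> real) \<Rightarrow> bool" where
  "normalized \<Phi> \<longleftrightarrow> \<Phi> 1 = 1"

definition doubling :: "(real \<Rightarrow> real) \<Rightarrow> bool" where
  "doubling \<Phi> \<longleftrightarrow> (\<exists>C>0. \<forall>t\<ge>0. \<Phi> (2 * t) \<le> C * \<Phi> t)"

text \<open>The supremum is nonnegative when \<open>\<Phi> 0 = 0\<close> (take \<open>s = 0\<close>), so truncating negative terms to
  \<open>0\<close> does not change it.\<close>

definition complementary :: "(real \<Rightarrow> real) \<Rightarrow> real \<Rightarrow> ennreal" where
  "complementary \<Phi> t = (SUP s\<in>{0..}. ennreal (s * t - \<Phi> s))"

text \<open>The value of a Young function at a possibly infinite argument, with $\Phi(\infty)=\infty$.\<close>

definition young_ext :: "(real \<Rightarrow> real) \<Rightarrow> ennreal \<Rightarrow> ennreal" where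
  "young_ext \<Phi> t = (if t = \<infinity> then \<infinity> else ennreal (\<Phi> (enn2real t)))"


section \<open>Maximal operators\<close>

definition average :: "(real ^ 'n) set \<Rightarrow> (real ^ 'n \<Rightarrow> ennreal) \<Rightarrow> ennreal" where
  "average Q g = (\<integral>\<^sup>+y\<in>Q. g y \<partial>lebesgue) / emeasure lebesgue Q"

definition lux_average :: "(real \<Rightarrow> ennreal) \<Rightarrow> (real ^ 'n) set \<Rightarrow> (real ^ 'n \<Rightarrow> real) \<Rightarrow> ennreal" where
  "lux_average A Q f =
     Inf {ennreal c | c. 0 < c \<and> average Q (\<lambda>y. A (\<bar>f y\<bar> / c)) \<le> 1}"

definition maximal :: "(real ^ 'n \<Rightarrow> real) \<Rightarrow> real \<Rightarrow> (real ^ 'n \<Rightarrow> real) \<Rightarrow> real ^ 'n \<Rightarrow> ennreal" where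
  "maximal \<rho> \<sigma> f x =
     (SUP (x\<^sub>0, r)\<in>{(x\<^sub>0, r). 0 < r \<and> x \<in> cube x\<^sub>0 r}.
        ennreal ((1 + r / \<rho> x\<^sub>0) powr (- \<sigma>)) * average (cube x\<^sub>0 r) (\<lambda>y. ennreal \<bar>f y\<bar>))"

definition orlicz_maximal ::
  "(real ^ 'n \<Rightarrow> real) \<Rightarrow> (real \<Rightarrow> ennreal) \<Rightarrow> real \<Rightarrow> (real ^ 'n \<Rightarrow> real) \<Rightarrow> real ^ 'n \<Rightarrow> ennreal" where
  "orlicz_maximal \<rho> A \<sigma> f x =
     (SUP (x\<^sub>0, r)\<in>{(x\<^sub>0, r). 0 < r \<and> x \<in> cube x\<^sub>0 r}.
        ennreal ((1 + r / \<rho> x\<^sub>0) powr (- \<sigma>)) * lux_average A (cube x\<^sub>0 r) f)"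


section \<open>Modulars and weighted Orlicz spaces\<close>

text \<open>Maximal functions, and weights that are themselves maximal functions, may take the value
  \<open>\<infinity>\<close>; products use \<open>0 * \<infinity> = 0\<close>.\<close>

definition modular ::
  "(real \<Rightarrow> real) \<Rightarrow> (real ^ 'n \<Rightarrow> ennreal) \<Rightarrow> (real ^ 'n \<Rightarrow> ennreal) \<Rightarrow> ennreal" where
  "modular \<Phi> w g = (\<integral>\<^sup>+x. young_ext \<Phi> (g x) * w x \<partial>lebesgue)"

definition lux_norm ::
  "(real \<Rightarrow> real) \<Rightarrow> (real ^ 'n \<Rightarrow> ennreal) \<Rightarrow> (real ^ 'n \<Rightarrow> ennreal) \<Rightarrow> ennreal" where
  "lux_norm \<Phi> w g =
     Inf {ennreal c | c. 0 < c \<and> modular \<Phi> w (\<lambda>x. g x / ennreal c) \<le> 1}"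

definition orlicz_space ::
  "(real \<Rightarrow> real) \<Rightarrow> (real ^ 'n \<Rightarrow> ennreal) \<Rightarrow> (real ^ 'n \<Rightarrow> real) set" where
  "orlicz_space \<Phi> w =
     {f \<in> borel_measurable lebesgue. \<exists>c>0. modular \<Phi> w (\<lambda>x. ennreal (\<bar>f x\<bar> / c)) < \<infinity>}"

definition nonneg_measurable :: "(real ^ 'n \<Rightarrow> real) set" where
  "nonneg_measurable = {w \<in> borel_measurable lebesgue. \<forall>x. 0 \<le> w x}"


section \<open>The six conditions\<close>

text \<open>The integral may diverge at \<open>0\<close>, hence the nonnegative integral.  The argument \<open>t / s\<close>
  is at least \<open>1\<close> on the domain of integration, so \<open>deriv\<close> is the ordinary derivative there.\<close>

definition dini_condition ::
  "(real \<Rightarrow> real) \<Rightarrow> (real \<Rightarrow> real) \<Rightarrow> (real \<Rightarrow> real) \<Rightarrow> bool" where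
  "dini_condition \<eta> a b \<longleftrightarrow>
     (\<exists>C>0. \<forall>t\<ge>0.
        (\<integral>\<^sup>+s\<in>{0<..t}. ennreal (a s / s * deriv \<eta> (t / s)) \<partial>lebesgue) \<le> ennreal (C * b (C * t)))"

definition weighted_modular_inequality ::
  "(real ^ 'n \<Rightarrow> real) \<Rightarrow> (real \<Rightarrow> real) \<Rightarrow> (real \<Rightarrow> real) \<Rightarrow> (real \<Rightarrow> real) \<Rightarrow> bool" where
  "weighted_modular_inequality \<rho> \<eta> \<phi> \<psi> \<longleftrightarrow>
     (\<forall>\<theta>\<ge>0. \<exists>C\<ge>0. \<exists>\<sigma>\<ge>0.
        \<forall>w\<in>nonneg_measurable. \<forall>f\<in>orlicz_space \<psi> (maximal \<rho> \<theta> w).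
          modular \<phi> (\<lambda>x. ennreal (w x)) (orlicz_maximal \<rho> (\<lambda>t. ennreal (\<eta> t)) \<sigma> f)
          \<le> ennreal C * modular \<psi> (maximal \<rho> \<theta> w) (\<lambda>x. ennreal (C * \<bar>f x\<bar>)))"

definition weighted_norm_inequality ::
  "(real ^ 'n \<Rightarrow> real) \<Rightarrow> (real \<Rightarrow> real) \<Rightarrow> (real \<Rightarrow> real) \<Rightarrow> (real \<Rightarrow> real) \<Rightarrow> bool" where
  "weighted_norm_inequality \<rho> \<eta> \<phi> \<psi> \<longleftrightarrow>
     (\<forall>\<theta>\<ge>0. \<exists>C\<ge>0. \<exists>\<sigma>\<ge>0.
        \<forall>w\<in>nonneg_measurable. \<forall>f\<in>orlicz_space \<psi> (maximal \<rho> \<theta> w).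
          lux_norm \<phi> (\<lambda>x. ennreal (w x)) (orlicz_maximal \<rho> (\<lambda>t. ennreal (\<eta> t)) \<sigma> f)
          \<le> ennreal C * lux_norm \<psi> (maximal \<rho> \<theta> w) (\<lambda>x. ennreal \<bar>f x\<bar>))"

definition modular_inequality ::
  "(real ^ 'n \<Rightarrow> real) \<Rightarrow> (real \<Rightarrow> real) \<Rightarrow> (real \<Rightarrow> real) \<Rightarrow> (real \<Rightarrow> real) \<Rightarrow> bool" where
  "modular_inequality \<rho> \<eta> \<phi> \<psi> \<longleftrightarrow>
     (\<exists>C\<ge>0. \<exists>\<sigma>\<ge>0. \<forall>f\<in>orlicz_space \<psi> (\<lambda>_. 1).
        modular \<phi> (\<lambda>_. 1) (orlicz_maximal \<rho> (\<lambda>t. ennreal (\<eta> t)) \<sigma> f)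
        \<le> ennreal C * modular \<psi> (\<lambda>_. 1) (\<lambda>x. ennreal (C * \<bar>f x\<bar>)))"

text \<open>Quotients are taken in \<^typ>\<open>ennreal\<close>: \<open>c / 0 = \<infinity>\<close> for \<open>c > 0\<close>, while
  \<open>0 / 0 = 0\<close> and \<open>\<infinity> / \<infinity> = 0\<close>.

  The constant \<open>C\<close> stands inside \<open>\<psi>\<close> as well, as in the other modular
  inequalities.  With $\psi(f/u)$ in place of $\psi(Cf/u)$ the equivalence fails: for
  $\eta(t)=t$ and $u=w=1$ the condition would force $\phi\le C\psi$, which is false for
  $a(s)=s e^s$, $b(s)=e^s-1$, although \<open>dini_condition\<close> holds for these with $C=1$.\<close>

definition quotient_modular_inequality ::
  "(real ^ 'n \<Rightarrow> real) \<Rightarrow> (real \<Rightarrow> real) \<Rightarrow> (real \<Rightarrow> real) \<Rightarrow> (real \<Rightarrow> real) \<Rightarrow> bool" where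
  "quotient_modular_inequality \<rho> \<eta> \<phi> \<psi> \<longleftrightarrow>
     (\<forall>\<theta>\<ge>0. \<exists>C\<ge>0. \<exists>\<sigma>\<ge>0. \<forall>\<gamma>\<ge>\<sigma>.
        \<forall>f\<in>nonneg_measurable. \<forall>u\<in>nonneg_measurable. \<forall>w\<in>nonneg_measurable.
          modular \<phi> (\<lambda>x. ennreal (w x))
            (\<lambda>x. maximal \<rho> \<gamma> f x / orlicz_maximal \<rho> (complementary \<eta>) (\<gamma> - \<sigma>) u x)
          \<le> ennreal C *
            modular \<psi> (maximal \<rho> \<theta> w) (\<lambda>x. ennreal C * (ennreal (f x) / ennreal (u x))))"

definition norm_inequality ::
  "(real ^ 'n \<Rightarrow> real) \<Rightarrow> (real \<Rightarrow> real) \<Rightarrow> (real \<Rightarrow> real) \<Rightarrow> (real \<Rightarrow> real) \<Rightarrow> bool" where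
  "norm_inequality \<rho> \<eta> \<phi> \<psi> \<longleftrightarrow>
     (\<exists>C>0. \<exists>\<sigma>\<ge>0. \<forall>f\<in>orlicz_space \<psi> (\<lambda>_. 1).
        lux_norm \<phi> (\<lambda>_. 1) (orlicz_maximal \<rho> (\<lambda>t. ennreal (\<eta> t)) \<sigma> f)
        \<le> ennreal C * lux_norm \<psi> (\<lambda>_. 1) (\<lambda>x. ennreal \<bar>f x\<bar>))"

end

theory Submission
  imports Defs
begin

text \<open>Everything passes through the integrated form of (a),
  $\int_0^t a(s) \eta(t/s) ds \le C \psi(Ct)$, which is equivalent to (a) because \<open>\<eta>(u) \<le> u \<eta>'(u) \<le> D \<eta>(u)\<close> for a doubling Young function and
  because \<open>\<psi>(t) \<le> t b(t) \<le> \<psi>(2t)\<close>.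

  Sufficiency: choose \<open>\<sigma> = \<theta>\<close>. If a cube \<open>Q(x\<^sub>0,r)\<close> witnesses \<open>M\<^sub>\<eta> f > t\<close>, convexity gives
  \<open>(1 + r/\<rho>(x\<^sub>0))\<^sup>\<theta> |Q| \<le> \<integral>\<^sub>Q \<eta>(2|f|/t) 1(2|f| > t)\<close>, while the \<open>w\<close>-mass of a fixed dilate of \<open>Q\<close> is at
  most a constant times \<open>(1 + r/\<rho>(x\<^sub>0))\<^sup>\<theta> |Q|\<close> times the infimum of \<open>M\<^sup>\<theta> w\<close> on \<open>Q\<close>. The Vitali covering lemma
  turns this into a weak-type bound with weights \<open>w\<close> and \<open>M\<^sup>\<theta> w\<close>, and integrating against \<open>a(t) dt\<close> gives the
  modular inequality. The norm inequalities follow by homogeneity, and (e) by Hoelder's inequality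
  \<open>M\<^sup>\<gamma> f \<le> 2 M\<^sub>\<eta>\<^sup>\<sigma>(f/u) M\<^sup>\<gamma>\<^sup>-\<^sup>\<sigma> u\<close>, where the last maximal operator is that of the complementary function.

  Necessity: (f) and (e) are tested on multiples of the indicator of thin parallel strips in a box on which
  \<open>\<rho>\<close> is bounded below, so that the penalty factor of all relevant cubes is bounded below. At distance \<open>h\<close> from a strip
  of width \<open>\<epsilon>\<close> the averages are comparable to \<open>\<epsilon>/h\<close>, so the level set of \<open>M\<^sub>\<eta>\<close> at height \<open>s\<close> has measure
  proportional to \<open>\<eta>(t/s)\<close>, and the layer-cake formula returns the integral above. For (f) many strips are
  needed, because the norm fixes the total measure of the set, independently of the ratio of the
  spacing to \<open>\<epsilon>\<close>.\<close>

text \<open>The factor \<open>S = (1 + r/\<rho>(x0))^\<theta>\<close> enters twice. A cube that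
  witnesses a large penalised Luxemburg average has an unpenalised one above \<open>t * S\<close>,
  and convexity, \<open>\<eta>(y/S) \<le> \<eta>(y)/S\<close>, turns this into a gain of
  \<open>S\<close> on the volume. A dilate of the cube keeps its centre, so estimating its mass of
  \<open>w\<close> by the maximal function loses only a constant times \<open>S\<close>. Gain and
  loss cancel, hence one exponent serves for the operator and for the weight.

  In the necessity part the penalty is the obstacle: it is under control only for cubes whose radius
  is below \<open>\<rho>\<close>, and \<open>\<rho>\<close> may tend to 0 at infinity. In the norm
  test the strips have total measure \<open>1/\<psi>(t)\<close>, so they spread over a length that
  depends on \<open>t\<close> and on the range of levels, but not on their number. The lower bound
  of \<open>\<rho>\<close> on that length is therefore fixed first, and the number of strips is then
  chosen so large that all cubes are smaller than this bound. The final constants never see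
  it.\<close>

section \<open>Cubes, averages and semicontinuity of maximal functions\<close>

lemma less_imp_less_infinity_ennreal: "(t :: ennreal) < s \<Longrightarrow> t < \<infinity>"
  by (cases t) auto

lemma mem_cube:
  fixes x :: "real ^ 'n"
  shows "x \<in> cube x0 r \<longleftrightarrow> (\<forall>i. \<bar>x $ i - x0 $ i\<bar> \<le> r / sqrt CARD('n))"
  unfolding cube_def mem_box_cart by (auto simp: abs_le_iff algebra_simps)

lemma emeasure_cbox_cart:
  fixes l u :: "real ^ 'n"
  assumes "\<And>i. l $ i \<le> u $ i"
  shows "emeasure lborel (cbox l u) = ennreal (\<Prod>i\<in>UNIV. u $ i - l $ i)"
proof -
  have "emeasure lborel (cbox l u) = ennreal (measure lborel (cbox l u))"
    by (rule emeasure_eq_ennreal_measure) (use emeasure_lborel_cbox_finite[of l u] in auto)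
  also have "measure lborel (cbox l u) = (\<Prod>i\<in>UNIV. u $ i - l $ i)"
    using assms by (subst content_cbox_cart) (auto simp: interval_ne_empty_cart)
  finally show ?thesis .
qed

lemma emeasure_cube:
  fixes x0 :: "real ^ 'n"
  assumes "0 \<le> r"
  shows "emeasure lborel (cube x0 r) = ennreal ((2 * (r / sqrt CARD('n))) ^ CARD('n))"
  unfolding cube_def using assms by (subst emeasure_cbox_cart) (auto simp: algebra_simps)

lemma cube_measurable [measurable]: "cube x0 r \<in> sets borel"
  unfolding cube_def by simp

lemma cube_subset_cball:
  fixes x0 :: "real ^ 'n"
  assumes "0 \<le> r"
  shows "cube x0 r \<subseteq> cball x0 r"
proof
  fix x assume x: "x \<in> cube x0 r"
  have "(norm (x - x0))\<^sup>2 = (\<Sum>i\<in>UNIV. (x $ i - x0 $ i)\<^sup>2)"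
    unfolding norm_vec_def L2_set_def by (subst real_sqrt_pow2) (simp_all add: sum_nonneg)
  also have "\<dots> \<le> (\<Sum>i\<in>(UNIV :: 'n set). (r / sqrt CARD('n))\<^sup>2)"
  proof (rule sum_mono)
    fix i
    have "\<bar>x $ i - x0 $ i\<bar> \<le> \<bar>r / sqrt CARD('n)\<bar>" using x assms by (simp add: mem_cube)
    then show "(x $ i - x0 $ i)\<^sup>2 \<le> (r / sqrt CARD('n))\<^sup>2" by (rule abs_le_square_iff[THEN iffD1])
  qed
  also have "\<dots> = r\<^sup>2"
    by (simp only: sum_constant power_divide) simp
  finally have "norm (x - x0) \<le> r" using assms by (rule power2_le_imp_le)
  then show "x \<in> cball x0 r"
    by (simp add: dist_norm norm_minus_commute)
qed

text \<open>The loss of \<open>sqrt n\<close> between balls and cubes is the origin of the dilation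
  factor \<open>5 * sqrt n\<close> in the covering argument.\<close>

lemma cball_subset_cube:
  fixes x0 :: "real ^ 'n"
  shows "cball x0 r \<subseteq> cube x0 (sqrt CARD('n) * r)"
proof
  fix x assume "x \<in> cball x0 r"
  then have "norm (x - x0) \<le> r" by (simp add: dist_norm norm_minus_commute)
  then have "\<bar>x $ i - x0 $ i\<bar> \<le> r" for i
    using component_le_norm_cart[of "x - x0" i] by (metis order_trans vector_minus_component)
  then show "x \<in> cube x0 (sqrt CARD('n) * r)" by (simp add: mem_cube)
qed

lemma cube_mono: "r \<le> r' \<Longrightarrow> cube x0 r \<subseteq> cube (x0 :: real ^ 'n) r'"
proof
  fix x assume r: "r \<le> r'" and x: "x \<in> cube x0 r"
  have "r / sqrt CARD('n) \<le> r' / sqrt CARD('n)" using r by (simp add: divide_right_mono)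
  then show "x \<in> cube x0 r'" using x unfolding mem_cube by (meson order_trans)
qed

text \<open>A closed cube lies in the interior of every larger cube with the same centre, so a
  condition that survives a small enlargement of the radius produces an open union. Superlevel sets
  of both maximal functions have this form, which gives Borel measurability without reducing the
  supremum to countably many cubes.\<close>

lemma open_Union_cubes:
  fixes P :: "real ^ 'n \<Rightarrow> real \<Rightarrow> bool"
  assumes "\<And>x0 r. 0 < r \<Longrightarrow> P x0 r \<Longrightarrow> eventually (P x0) (at_right r)"
  shows "open {x. \<exists>x0 r. 0 < r \<and> P x0 r \<and> x \<in> cube x0 r}"
  unfolding open_contains_ball
proof clarify
  fix x x0 and r :: real assume r: "0 < r" "P x0 r" "x \<in> cube x0 r"
  obtain e where e: "e > r" "\<And>y. r < y \<Longrightarrow> y < e \<Longrightarrow> P x0 y"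
    using assms[OF r(1,2)] unfolding eventually_at_right_field by blast
  define r' where "r' = (r + e) / 2"
  define d where "d = (r' - r) / sqrt CARD('n)"
  have "r < r'" "r' < e" using e(1) by (simp_all add: r'_def)
  then have r': "r < r'" "P x0 r'" using e(2) by blast+
  have "y \<in> cube x0 r'" if "y \<in> ball x d" for y
  proof -
    have "\<bar>y $ i - x0 $ i\<bar> \<le> r' / sqrt CARD('n)" for i
    proof -
      have "\<bar>y $ i - x $ i\<bar> \<le> norm (y - x)" by (metis component_le_norm_cart vector_minus_component)
      also have "\<dots> \<le> d" using that by (simp add: dist_norm norm_minus_commute)
      finally have "\<bar>y $ i - x $ i\<bar> \<le> d" .
      moreover have "\<bar>x $ i - x0 $ i\<bar> \<le> r / sqrt CARD('n)" using r by (simp add: mem_cube)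
      moreover have "d + r / sqrt CARD('n) = r' / sqrt CARD('n)" by (simp add: d_def diff_divide_distrib)
      ultimately show ?thesis by linarith
    qed
    then show ?thesis by (simp add: mem_cube)
  qed
  moreover have "d > 0" using r' by (simp add: d_def)
  ultimately show "\<exists>e>0. ball x e \<subseteq> {x. \<exists>x0 r. 0 < r \<and> P x0 r \<and> x \<in> cube x0 r}"
    using r r' by (intro exI[of _ d]) (auto intro!: exI[of _ x0] exI[of _ r'])
qed

text \<open>Enlarging the cube does not decrease the integral of \<open>g\<close>; only the
  prefactor made of penalty and volume can fall, and it is continuous in the radius.\<close>

lemma eventually_average_greater:
  fixes x0 :: "real ^ 'n"
  assumes "0 < r" "0 < \<rho>0"
    and t: "t < ennreal ((1 + r / \<rho>0) powr (- \<sigma>)) * average (cube x0 r) g"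
  shows "eventually (\<lambda>r'. t < ennreal ((1 + r' / \<rho>0) powr (- \<sigma>)) * average (cube x0 r') g) (at_right r)"
proof -
  define J where "J = (\<integral>\<^sup>+y\<in>cube x0 r. g y \<partial>lebesgue)"
  define k where "k s = (1 + s / \<rho>0) powr (- \<sigma>) * inverse ((2 * (s / sqrt CARD('n))) ^ CARD('n))" for s
  have eq: "ennreal ((1 + s / \<rho>0) powr (- \<sigma>)) * (I / emeasure lebesgue (cube x0 s)) = ennreal (k s) * I"
    if "0 < s" for I s
  proof -
    have p: "0 < (2 * (s / sqrt CARD('n))) ^ CARD('n)" using that by simp
    have "I / emeasure lebesgue (cube x0 s) = I * ennreal (inverse ((2 * (s / sqrt CARD('n))) ^ CARD('n)))"
      using that inverse_ennreal[OF p] by (simp add: divide_ennreal_def emeasure_cube)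
    moreover have "ennreal (k s) = ennreal ((1 + s / \<rho>0) powr (- \<sigma>)) * ennreal (inverse ((2 * (s / sqrt CARD('n))) ^ CARD('n)))"
      unfolding k_def using p by (intro ennreal_mult) auto
    ultimately show ?thesis by (simp only: mult_ac)
  qed
  have k0: "0 < k s" if "0 < s" for s
  proof -
    have "0 < s / \<rho>0" using that assms by simp
    then have "0 < 1 + s / \<rho>0" by simp
    then show ?thesis using that by (simp add: k_def)
  qed
  have tJ: "t < ennreal (k r) * J" using t eq[OF assms(1), of J] by (simp add: average_def J_def)
  have "isCont k r" unfolding k_def using assms
    by (intro continuous_intros) (auto simp: add_nonneg_eq_0_iff)
  then have lim: "(k \<longlongrightarrow> k r) (at_right r)"
    by (simp add: isCont_def filterlim_at_split)
  \<comment> \<open>For infinite \<open>J\<close> any positive prefactor gives infinity; otherwise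
    the limit is taken in the reals.\<close>
  have "eventually (\<lambda>s. t < ennreal (k s) * J) (at_right r)"
  proof (cases "J = \<infinity>")
    case True
    have "t < \<infinity>" using tJ by (rule less_imp_less_infinity_ennreal)
    have "t < ennreal (k s) * J" if "r < s" for s
    proof -
      have "ennreal (k s) \<noteq> 0" using k0[of s] that assms by simp
      then show ?thesis using True \<open>t < \<infinity>\<close> by (simp add: ennreal_mult_top)
    qed
    then show ?thesis using eventually_at_right_less[of r] by (auto elim: eventually_mono)
  next
    case False
    then obtain j where j: "J = ennreal j" "0 \<le> j" by (cases J) auto
    have "((\<lambda>s. ennreal (k s * j)) \<longlongrightarrow> ennreal (k r * j)) (at_right r)"
      by (intro tendsto_intros lim)
    moreover have "t < ennreal (k r * j)" using tJ j k0[OF assms(1)] by (simp add: ennreal_mult)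
    ultimately have "eventually (\<lambda>s. t < ennreal (k s * j)) (at_right r)"
      by (rule order_tendstoD(1))
    then show ?thesis using eventually_at_right_less[of r]
      by eventually_elim (use j k0 assms in \<open>auto simp: ennreal_mult less_imp_le\<close>)
  qed
  then show ?thesis using eventually_at_right_less[of r]
  proof eventually_elim
    case (elim s)
    have "t < ennreal (k s) * J" by fact
    also have "J \<le> (\<integral>\<^sup>+y\<in>cube x0 s. g y \<partial>lebesgue)"
      unfolding J_def using cube_mono[of r s x0] elim
      by (intro nn_integral_mono) (auto simp: indicator_def)
    finally show ?case
      using eq[of s "\<integral>\<^sup>+y\<in>cube x0 s. g y \<partial>lebesgue"] elim assms
      by (simp add: average_def mult_left_mono)
  qed
qed

lemma less_maximal_iff:
  "t < maximal \<rho> \<sigma> f x \<longleftrightarrow>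
    (\<exists>x0 r. 0 < r \<and> t < ennreal ((1 + r / \<rho> x0) powr (- \<sigma>)) * average (cube x0 r) (\<lambda>y. ennreal \<bar>f y\<bar>) \<and> x \<in> cube x0 r)"
  unfolding maximal_def less_SUP_iff by auto

lemma less_orlicz_maximal_iff:
  "t < orlicz_maximal \<rho> A \<sigma> f x \<longleftrightarrow>
    (\<exists>x0 r. 0 < r \<and> t < ennreal ((1 + r / \<rho> x0) powr (- \<sigma>)) * lux_average A (cube x0 r) f \<and> x \<in> cube x0 r)"
  unfolding orlicz_maximal_def less_SUP_iff by auto

lemma borel_measurable_if_open_superlevel:
  fixes F :: "'a::topological_space \<Rightarrow> ennreal"
  assumes "\<And>t. open {x. t < F x}"
  shows "F \<in> borel_measurable borel"
  by (rule borel_measurableI_greater) (use assms in \<open>auto intro!: borel_open\<close>)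

lemma borel_measurable_maximal:
  fixes f :: "real ^ 'n \<Rightarrow> real"
  assumes "\<And>x. 0 < \<rho> x"
  shows "maximal \<rho> \<sigma> f \<in> borel_measurable borel"
proof (rule borel_measurable_if_open_superlevel)
  show "open {x. t < maximal \<rho> \<sigma> f x}" for t
    unfolding less_maximal_iff
    by (rule open_Union_cubes) (rule eventually_average_greater[OF _ assms])
qed

lemma average_mono:
  assumes "\<And>y. y \<in> Q \<Longrightarrow> g y \<le> h y"
  shows "average Q g \<le> average Q h"
  unfolding average_def using assms
  by (intro divide_right_mono_ennreal nn_integral_mono) (auto simp: indicator_def)

text \<open>Because \<open>A\<close> is nondecreasing, the admissible levels are closed upwards, so
  a level whose average exceeds 1 lies below all of them.\<close>

lemma lux_average_ge:
  assumes "mono_on {0..} A" "0 < c" "1 < average Q (\<lambda>y. A (\<bar>f y\<bar> / c))"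
  shows "ennreal c \<le> lux_average A Q f"
  unfolding lux_average_def
proof (rule Inf_greatest, clarify)
  fix d :: real assume d: "0 < d" "average Q (\<lambda>y. A (\<bar>f y\<bar> / d)) \<le> 1"
  have "c < d"
  proof (rule ccontr)
    assume "\<not> c < d"
    then have "average Q (\<lambda>y. A (\<bar>f y\<bar> / c)) \<le> average Q (\<lambda>y. A (\<bar>f y\<bar> / d))"
      using d assms(2)
      by (intro average_mono mono_onD[OF assms(1)]) (auto simp: divide_left_mono)
    then show False using d assms(3) by auto
  qed
  then show "ennreal c \<le> ennreal d" using assms by (simp add: ennreal_leI)
qed

lemma average_gt_1_if_less_lux_average:
  assumes "ennreal c < lux_average A Q f" "0 < c"
  shows "1 < average Q (\<lambda>y. A (\<bar>f y\<bar> / c))"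
proof (rule ccontr)
  assume "\<not> ?thesis"
  then have "lux_average A Q f \<le> ennreal c"
    unfolding lux_average_def using assms(2) by (intro Inf_lower) auto
  then show False using assms(1) by auto
qed

text \<open>A level \<open>c\<close> is inserted strictly between \<open>t0 / k r\<close> and the
  Luxemburg average. At this level the ordinary average exceeds 1, which persists for slightly
  larger cubes, and the gap between \<open>t0 / k r\<close> and \<open>c\<close> absorbs the loss in
  the penalty.\<close>

lemma eventually_lux_average_greater:
  fixes x0 :: "real ^ 'n"
  assumes A: "mono_on {0..} A" and "0 < r" "0 < \<rho>0"
    and t: "t < ennreal ((1 + r / \<rho>0) powr (- \<sigma>)) * lux_average A (cube x0 r) f"
  shows "eventually (\<lambda>r'. t < ennreal ((1 + r' / \<rho>0) powr (- \<sigma>)) * lux_average A (cube x0 r') f) (at_right r)"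
proof -
  define k where "k s = (1 + s / \<rho>0) powr (- \<sigma>)" for s
  have k0: "0 < k s" if "0 < s" for s
  proof -
    have "0 < s / \<rho>0" using that assms by simp
    then have "0 < 1 + s / \<rho>0" by simp
    then show ?thesis by (simp add: k_def)
  qed
  have "isCont k r" unfolding k_def using assms
    by (intro continuous_intros) (auto simp: add_nonneg_eq_0_iff)
  then have lim: "(k \<longlongrightarrow> k r) (at_right r)"
    by (simp add: isCont_def filterlim_at_split)
  have kr: "0 < k r" using k0 assms by simp
  have tf: "t < \<infinity>" using t by (meson less_imp_less_infinity_ennreal)
  then obtain t0 where t0: "t = ennreal t0" "0 \<le> t0" by (cases t) auto
  have "ennreal (t0 / k r) < lux_average A (cube x0 r) f"
  proof (rule ccontr)
    assume "\<not> ?thesis"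
    then have "ennreal (k r) * lux_average A (cube x0 r) f \<le> ennreal (k r) * ennreal (t0 / k r)"
      by (intro mult_left_mono) auto
    also have "\<dots> = t" using kr t0 by (simp add: ennreal_mult[symmetric])
    finally show False using t by (simp add: k_def)
  qed
  then obtain c' where c': "ennreal (t0 / k r) < c'" "c' < lux_average A (cube x0 r) f"
    using dense by blast
  then have "c' < \<infinity>" by (meson less_imp_less_infinity_ennreal)
  then obtain c where c: "c' = ennreal c" "0 \<le> c" by (cases c') auto
  have c1: "t0 / k r < c" using c' c by (simp add: ennreal_less_iff t0 kr less_imp_le)
  then have cpos: "0 < c" using t0 kr by (smt (verit, best) divide_nonneg_pos)
  have "1 < average (cube x0 r) (\<lambda>y. A (\<bar>f y\<bar> / c))"
    using c c' cpos by (intro average_gt_1_if_less_lux_average) auto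
  then have "eventually (\<lambda>s. 1 < ennreal ((1 + s / \<rho>0) powr (- 0)) * average (cube x0 s) (\<lambda>y. A (\<bar>f y\<bar> / c))) (at_right r)"
    using assms by (intro eventually_average_greater) (auto simp: add_nonneg_eq_0_iff)
  moreover have "eventually (\<lambda>s. t0 / c < k s) (at_right r)"
    by (rule order_tendstoD(1)[OF lim]) (use c1 cpos kr in \<open>simp add: field_simps\<close>)
  ultimately show ?thesis using eventually_at_right_less[of r]
  proof eventually_elim
    case (elim s)
    have "0 < 1 + s / \<rho>0" using elim assms by (simp add: add_pos_pos)
    then have "1 < average (cube x0 s) (\<lambda>y. A (\<bar>f y\<bar> / c))" using elim by simp
    then have le: "ennreal c \<le> lux_average A (cube x0 s) f"
      by (rule lux_average_ge[OF A cpos])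
    have "t < ennreal (k s * c)" using elim t0 cpos by (simp add: ennreal_less_iff field_simps)
    also have "\<dots> = ennreal (k s) * ennreal c" using cpos by (simp add: ennreal_mult'')
    also have "\<dots> \<le> ennreal (k s) * lux_average A (cube x0 s) f" by (intro mult_left_mono le) simp
    finally show ?case by (simp add: k_def)
  qed
qed

lemma borel_measurable_orlicz_maximal:
  fixes f :: "real ^ 'n \<Rightarrow> real"
  assumes "\<And>x. 0 < \<rho> x" "mono_on {0..} A"
  shows "orlicz_maximal \<rho> A \<sigma> f \<in> borel_measurable borel"
proof (rule borel_measurable_if_open_superlevel)
  show "open {x. t < orlicz_maximal \<rho> A \<sigma> f x}" for t
    unfolding less_orlicz_maximal_iff
    by (rule open_Union_cubes) (rule eventually_lux_average_greater[OF assms(2) _ assms(1)])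
qed

section \<open>The weak-type inequality\<close>

lemma lebesgue_measurable_borel: "f \<in> borel_measurable borel \<Longrightarrow> f \<in> borel_measurable lebesgue"
  by (simp add: measurable_completion)

text \<open>Every point of the cube also lies in the dilate, so
  \<open>maximal \<rho> \<theta> w\<close> is bounded below by one constant on the whole cube. This
  constant carries a factor \<open>1/S\<close>, which cancels against the factor \<open>S\<close> in
  the hypothesis \<open>le\<close>.\<close>

lemma integral_dilated_cube_le:
  fixes w :: "real ^ 'n \<Rightarrow> real"
  assumes \<rho>: "0 < \<rho> x0" and "0 < r" "0 \<le> \<theta>" "1 \<le> D"
    and h: "h \<in> borel_measurable lebesgue"
    and le: "ennreal ((1 + r / \<rho> x0) powr \<theta>) * emeasure lebesgue (cube x0 r) \<le> (\<integral>\<^sup>+y\<in>cube x0 r. h y \<partial>lebesgue)"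
  shows "(\<integral>\<^sup>+y\<in>cube x0 (D * r). ennreal \<bar>w y\<bar> \<partial>lebesgue)
      \<le> ennreal (D ^ CARD('n) * D powr \<theta>) * (\<integral>\<^sup>+y\<in>cube x0 r. h y * maximal \<rho> \<theta> w y \<partial>lebesgue)"
proof -
  define W where "W = (\<integral>\<^sup>+y\<in>cube x0 (D * r). ennreal \<bar>w y\<bar> \<partial>lebesgue)"
  define q where "q = (2 * (r / sqrt CARD('n))) ^ CARD('n)"
  define S where "S = (1 + r / \<rho> x0) powr \<theta>"
  define A where "A = D ^ CARD('n) * D powr \<theta>"
  have q: "0 < q" "emeasure lebesgue (cube x0 r) = ennreal q"
    using assms by (simp_all add: q_def emeasure_cube)
  have qD: "emeasure lebesgue (cube x0 (D * r)) = ennreal (D ^ CARD('n) * q)"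
    using assms by (simp add: q_def emeasure_cube power_mult_distrib[symmetric] mult_ac)
  have rr: "0 < r / \<rho> x0" using assms by simp
  have S: "0 < S" using rr by (simp add: S_def)
  have A: "0 < A" using assms by (simp add: A_def)
  \<comment> \<open>The dilate keeps the centre, so its penalty differs from that of the original
    cube by at most \<open>D powr \<theta>\<close>.\<close>
  have "1 + D * r / \<rho> x0 \<le> D * (1 + r / \<rho> x0)" using assms by (simp add: algebra_simps)
  moreover have "0 < D * r / \<rho> x0" using assms by simp
  ultimately have "(1 + D * r / \<rho> x0) powr \<theta> \<le> (D * (1 + r / \<rho> x0)) powr \<theta>"
    using assms by (intro powr_mono2) auto
  also have "\<dots> = D powr \<theta> * S" using rr assms by (simp add: powr_mult S_def)
  finally have "inverse (D powr \<theta> * S) \<le> inverse ((1 + D * r / \<rho> x0) powr \<theta>)"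
    using \<open>0 < D * r / \<rho> x0\<close> by (intro le_imp_inverse_le) auto
  then have pw: "inverse (D powr \<theta> * S) \<le> (1 + D * r / \<rho> x0) powr (- \<theta>)"
    by (simp add: powr_minus)
  have point: "W * ennreal (inverse (A * q * S)) \<le> maximal \<rho> \<theta> w y" if y: "y \<in> cube x0 r" for y
  proof -
    have "cube x0 r \<subseteq> cube x0 (D * r)" using assms by (intro cube_mono) auto
    then have yD: "y \<in> cube x0 (D * r)" using y by blast
    have "A * q * S = (D powr \<theta> * S) * (D ^ CARD('n) * q)" by (simp add: A_def)
    then have "ennreal (inverse (A * q * S)) = ennreal (inverse (D powr \<theta> * S)) * ennreal (inverse (D ^ CARD('n) * q))"
      using q S assms by (simp add: ennreal_mult[symmetric] mult_ac)
    also have "ennreal (inverse (D ^ CARD('n) * q)) = inverse (emeasure lebesgue (cube x0 (D * r)))"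
      unfolding qD using q assms by (subst inverse_ennreal) auto
    finally have "W * ennreal (inverse (A * q * S)) =
        ennreal (inverse (D powr \<theta> * S)) * average (cube x0 (D * r)) (\<lambda>y. ennreal \<bar>w y\<bar>)"
      by (simp add: average_def W_def divide_ennreal_def mult_ac)
    also have "\<dots> \<le> ennreal ((1 + (D * r) / \<rho> x0) powr (- \<theta>)) * average (cube x0 (D * r)) (\<lambda>y. ennreal \<bar>w y\<bar>)"
      by (intro mult_right_mono ennreal_leI) (use pw in auto)
    also have "\<dots> \<le> maximal \<rho> \<theta> w y"
      unfolding maximal_def using yD assms
      by (intro SUP_upper2[of "(x0, D * r)"]) auto
    finally show ?thesis .
  qed
  \<comment> \<open>Splitting off the reciprocal exposes the product \<open>S * q\<close>, which
    \<open>le\<close> replaces by the integral of \<open>h\<close> over the cube.\<close>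
  have "W = W * ennreal (inverse (A * q * S)) * ennreal (A * q * S)"
  proof -
    have "ennreal (inverse (A * q * S)) * ennreal (A * q * S) = ennreal (inverse (A * q * S) * (A * q * S))"
      using A q S by (intro ennreal_mult[symmetric]) auto
    also have "inverse (A * q * S) * (A * q * S) = 1" using A q S by (intro left_inverse) auto
    finally show ?thesis by (simp add: mult.assoc)
  qed
  also have "\<dots> = ennreal A * (W * ennreal (inverse (A * q * S)) * (ennreal S * ennreal q))"
    using A q S by (simp add: ennreal_mult mult_ac)
  also have "\<dots> \<le> ennreal A * (W * ennreal (inverse (A * q * S)) * (\<integral>\<^sup>+y\<in>cube x0 r. h y \<partial>lebesgue))"
    using le q by (intro mult_left_mono) (auto simp: S_def)
  also have "W * ennreal (inverse (A * q * S)) * (\<integral>\<^sup>+y\<in>cube x0 r. h y \<partial>lebesgue)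
      = (\<integral>\<^sup>+y. (W * ennreal (inverse (A * q * S))) * (h y * indicator (cube x0 r) y) \<partial>lebesgue)"
  proof -
    have [measurable]: "indicator (cube x0 r) \<in> borel_measurable lebesgue" "h \<in> borel_measurable lebesgue"
      using h by (auto intro!: lebesgue_measurable_borel)
    show ?thesis by (subst nn_integral_cmult) measurable
  qed
  also have "\<dots> \<le> (\<integral>\<^sup>+y\<in>cube x0 r. h y * maximal \<rho> \<theta> w y \<partial>lebesgue)"
  proof (rule nn_integral_mono)
    fix y show "W * ennreal (inverse (A * q * S)) * (h y * indicator (cube x0 r) y) \<le> h y * maximal \<rho> \<theta> w y * indicator (cube x0 r) y"
      using mult_left_mono[OF point[of y], of "h y"] by (auto simp: indicator_def mult_ac)
  qed
  finally show ?thesis by (simp add: W_def A_def mult_left_mono)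
qed

text \<open>Cubes sit between balls: disjointness of the selected balls passes to the inscribed
  cubes, and the fivefold balls lie in the cubes dilated by \<open>D\<close>. The uniform bound
  \<open>B\<close> on the radii is what the Vitali lemma asks for.\<close>

lemma covering_estimate:
  fixes w :: "real ^ 'n \<Rightarrow> real"
  assumes \<rho>: "\<And>x. 0 < \<rho> x" and \<theta>: "0 \<le> \<theta>"
    and w: "w \<in> borel_measurable lebesgue" and h: "h \<in> borel_measurable lebesgue"
    and K: "\<And>x0 r. (x0, r) \<in> K \<Longrightarrow> 0 < r \<and> r \<le> B \<and>
      ennreal ((1 + r / \<rho> x0) powr \<theta>) * emeasure lebesgue (cube x0 r) \<le> (\<integral>\<^sup>+y\<in>cube x0 r. h y \<partial>lebesgue)"
  shows "(\<integral>\<^sup>+x\<in>(\<Union>(x0, r)\<in>K. cube x0 r). ennreal \<bar>w x\<bar> \<partial>lebesgue)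
      \<le> ennreal ((5 * sqrt CARD('n)) ^ CARD('n) * (5 * sqrt CARD('n)) powr \<theta>) *
        (\<integral>\<^sup>+x. h x * maximal \<rho> \<theta> w x \<partial>lebesgue)"
proof -
  define D where "D = 5 * sqrt CARD('n)"
  define A where "A = D ^ CARD('n) * D powr \<theta>"
  define Mw where "Mw = maximal \<rho> \<theta> w"
  have D: "1 \<le> D"
  proof -
    have "1 \<le> sqrt CARD('n)" by simp
    then show ?thesis unfolding D_def by linarith
  qed
  have Mw: "Mw \<in> borel_measurable lebesgue"
    unfolding Mw_def by (intro lebesgue_measurable_borel borel_measurable_maximal \<rho>)
  have sub: "cube (fst i) (snd i) \<subseteq> cball (fst i) (snd i)" if "i \<in> K" for i
    using K[of "fst i" "snd i"] that by (intro cube_subset_cball) auto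
  obtain C where C: "countable C" "C \<subseteq> K"
    and disj: "pairwise (\<lambda>i j. disjnt (cball (fst i) (snd i)) (cball (fst j) (snd j))) C"
    and cov: "(\<Union>i\<in>K. cball (fst i) (snd i)) \<subseteq> (\<Union>i\<in>C. cball (fst i) (5 * snd i))"
    by (rule Vitali_covering_lemma_cballs[of "\<Union>i\<in>K. cball (fst i) (snd i)" fst snd K B]) (use K in auto)
  have [measurable]: "indicator (cube x r) \<in> borel_measurable lebesgue" for x :: "real ^ 'n" and r
    by (intro lebesgue_measurable_borel) auto
  have [measurable]: "w \<in> borel_measurable lebesgue" "h \<in> borel_measurable lebesgue" "Mw \<in> borel_measurable lebesgue"
    by fact+
  \<comment> \<open>Sums over the countable subfamily are written as integrals over
    \<open>count_space C\<close>, so that they can be exchanged with the Lebesgue integral.\<close>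
  have ind: "indicator (\<Union>(x0, r)\<in>K. cube x0 r) x
      \<le> (\<integral>\<^sup>+i. (indicator (cube (fst i) (D * snd i)) x :: ennreal) \<partial>count_space C)" for x
  proof (cases "x \<in> (\<Union>(x0, r)\<in>K. cube x0 r)")
    case True
    then have "x \<in> (\<Union>i\<in>K. cball (fst i) (snd i))" using sub by fastforce
    then obtain j where j: "j \<in> C" "x \<in> cball (fst j) (5 * snd j)" using cov by blast
    then have "x \<in> cube (fst j) (D * snd j)"
      using cball_subset_cube[of "fst j" "5 * snd j"] by (auto simp: D_def mult_ac)
    then have "(indicator (cube (fst j) (D * snd j)) x :: ennreal) = 1" by simp
    moreover have "(indicator (cube (fst j) (D * snd j)) x :: ennreal)
       \<le> (\<integral>\<^sup>+i. indicator (cube (fst i) (D * snd i)) x \<partial>count_space C)"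
      using j(1) by (rule nn_integral_ge_point)
    ultimately show ?thesis using True by simp
  qed auto
  \<comment> \<open>The undilated cubes are disjoint, so at most one index contributes at each
    point.\<close>
  have ind2: "(\<integral>\<^sup>+i. (indicator (cube (fst i) (snd i)) x :: ennreal) \<partial>count_space C) \<le> 1" for x
  proof (cases "\<exists>j\<in>C. x \<in> cube (fst j) (snd j)")
    case True
    then obtain j where j: "j \<in> C" "x \<in> cube (fst j) (snd j)" by blast
    have "indicator (cube (fst i) (snd i)) x \<le> (indicator {j} i :: ennreal)" if "i \<in> C" for i
    proof (cases "i = j")
      case False
      then have "disjnt (cball (fst i) (snd i)) (cball (fst j) (snd j))"
        using disj that j(1) by (auto simp: pairwise_def)
      moreover have "cube (fst i) (snd i) \<subseteq> cball (fst i) (snd i)" "cube (fst j) (snd j) \<subseteq> cball (fst j) (snd j)"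
        using sub C that j by blast+
      ultimately have "x \<notin> cube (fst i) (snd i)" using j(2) by (auto simp: disjnt_def)
      then show ?thesis by simp
    qed (auto simp: indicator_def)
    then have "(\<integral>\<^sup>+i. (indicator (cube (fst i) (snd i)) x :: ennreal) \<partial>count_space C)
      \<le> (\<integral>\<^sup>+i. indicator {j} i \<partial>count_space C)"
      by (intro nn_integral_mono) auto
    also have "\<dots> = 1" using j by simp
    finally show ?thesis .
  next
    case False
    then have "(\<integral>\<^sup>+i. (indicator (cube (fst i) (snd i)) x :: ennreal) \<partial>count_space C) = (\<integral>\<^sup>+i. 0 \<partial>count_space C)"
      by (intro nn_integral_cong) auto
    then show ?thesis by simp
  qed
  have "(\<integral>\<^sup>+x\<in>(\<Union>(x0, r)\<in>K. cube x0 r). ennreal \<bar>w x\<bar> \<partial>lebesgue)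
      \<le> (\<integral>\<^sup>+x. \<integral>\<^sup>+i. ennreal \<bar>w x\<bar> * indicator (cube (fst i) (D * snd i)) x \<partial>count_space C \<partial>lebesgue)"
    by (intro nn_integral_mono, subst nn_integral_cmult) (auto intro!: mult_left_mono ind)
  also have "\<dots> = (\<integral>\<^sup>+i. \<integral>\<^sup>+x. ennreal \<bar>w x\<bar> * indicator (cube (fst i) (D * snd i)) x \<partial>lebesgue \<partial>count_space C)"
    by (intro nn_integral_count_space_nn_integral C) measurable
  also have "\<dots> \<le> (\<integral>\<^sup>+i. ennreal A * (\<integral>\<^sup>+x\<in>cube (fst i) (snd i). h x * Mw x \<partial>lebesgue) \<partial>count_space C)"
  proof (intro nn_integral_mono)
    fix i assume "i \<in> space (count_space C)"
    then have "(fst i, snd i) \<in> K" using C by auto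
    note Ki = K[OF this]
    show "(\<integral>\<^sup>+x\<in>cube (fst i) (D * snd i). ennreal \<bar>w x\<bar> \<partial>lebesgue) \<le> ennreal A * (\<integral>\<^sup>+x\<in>cube (fst i) (snd i). h x * Mw x \<partial>lebesgue)"
      unfolding A_def Mw_def by (rule integral_dilated_cube_le) (use Ki \<rho> \<theta> D h in auto)
  qed
  also have "\<dots> = ennreal A * (\<integral>\<^sup>+i. (\<integral>\<^sup>+x\<in>cube (fst i) (snd i). h x * Mw x \<partial>lebesgue) \<partial>count_space C)"
    by (rule nn_integral_cmult) auto
  also have "(\<integral>\<^sup>+i. (\<integral>\<^sup>+x\<in>cube (fst i) (snd i). h x * Mw x \<partial>lebesgue) \<partial>count_space C)
    = (\<integral>\<^sup>+x. \<integral>\<^sup>+i. h x * Mw x * indicator (cube (fst i) (snd i)) x \<partial>count_space C \<partial>lebesgue)"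
    by (intro nn_integral_count_space_nn_integral[symmetric] C) measurable
  also have "\<dots> \<le> (\<integral>\<^sup>+x. h x * Mw x \<partial>lebesgue)"
  proof (intro nn_integral_mono, subst nn_integral_cmult)
    fix x show "h x * Mw x * (\<integral>\<^sup>+i. indicator (cube (fst i) (snd i)) x \<partial>count_space C) \<le> h x * Mw x"
      using mult_left_mono[OF ind2[of x], of "h x * Mw x"] by simp
  qed auto
  finally show ?thesis by (simp add: A_def D_def Mw_def mult_left_mono)
qed

section \<open>Elementary properties of Young functions and the weak-type bound\<close>

lemma young_nonneg: "young_function \<Phi> \<Longrightarrow> 0 \<le> t \<Longrightarrow> 0 \<le> \<Phi> t"
  unfolding young_function_def mono_on_def by (metis atLeast_iff order_refl)

lemma young_mono: "young_function \<Phi> \<Longrightarrow> 0 \<le> s \<Longrightarrow> s \<le> t \<Longrightarrow> \<Phi> s \<le> \<Phi> t"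
  unfolding young_function_def mono_on_def by auto

lemma young_convex:
  assumes "young_function \<Phi>" "0 \<le> x" "0 \<le> y" "0 \<le> u" "u \<le> 1"
  shows "\<Phi> ((1 - u) * x + u * y) \<le> (1 - u) * \<Phi> x + u * \<Phi> y"
  using assms convex_onD[of "{0..}" \<Phi> u x y] by (auto simp: young_function_def)

lemma young_scale:
  assumes "young_function \<Phi>" "0 \<le> y" "0 \<le> u" "u \<le> 1"
  shows "\<Phi> (u * y) \<le> u * \<Phi> y"
  using young_convex[OF assms(1) order_refl assms(2-4)] assms(1) by (simp add: young_function_def)

lemma mono_on_young_ennreal:
  assumes "young_function \<eta>" shows "mono_on {0..} (\<lambda>t. ennreal (\<eta> t))"
  using young_mono[OF assms] by (auto intro!: mono_onI ennreal_leI)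

lemma borel_measurable_truncate:
  fixes g :: "real \<Rightarrow> real"
  assumes "continuous_on {0..} g"
  shows "(\<lambda>x. g (max 0 x)) \<in> borel_measurable borel"
proof -
  have "continuous_on UNIV (\<lambda>x. g (max 0 x))"
    by (rule continuous_on_compose2[OF assms]) (auto intro!: continuous_intros)
  then show ?thesis by (rule borel_measurable_continuous_onI)
qed

lemma less_if_one_less_divide:
  assumes "0 < q" "1 < I / ennreal q"
  shows "ennreal q < I"
proof (rule ccontr)
  assume "\<not> ennreal q < I"
  then have "I / ennreal q \<le> ennreal q / ennreal q" by (intro divide_right_mono_ennreal) simp
  also have "\<dots> = 1" using assms(1) by (intro ennreal_divide_self) auto
  finally show False using assms(2) by simp
qed

text \<open>The argument \<open>\<bar>f y\<bar> / (t * S)\<close> is at most the midpoint of 1 and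
  \<open>F / S\<close>. As \<open>\<eta> 1 = 1\<close>, the first point contributes half the volume
  of the cube, which is absorbed by the left side; convexity extracts \<open>1/S\<close> from the
  second. The factor 2 in \<open>2 * \<bar>f y\<bar>\<close> is the price of taking a
  midpoint.\<close>

lemma orlicz_maximal_cube_good:
  fixes f :: "real ^ 'n \<Rightarrow> real"
  assumes \<rho>: "0 < \<rho>0" and \<theta>: "0 \<le> \<theta>" and t: "0 < t" and r: "0 < r"
    and \<eta>: "young_function \<eta>" "normalized \<eta>" "continuous_on {0..} \<eta>"
    and f: "f \<in> borel_measurable lebesgue"
    and gt: "ennreal t < ennreal ((1 + r / \<rho>0) powr (- \<theta>)) * lux_average (\<lambda>t. ennreal (\<eta> t)) (cube x0 r) f"
  shows "ennreal ((1 + r / \<rho>0) powr \<theta>) * emeasure lebesgue (cube x0 r)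
     \<le> (\<integral>\<^sup>+y\<in>cube x0 r. ennreal (\<eta> (2 * \<bar>f y\<bar> / t)) * indicator {y. t < 2 * \<bar>f y\<bar>} y \<partial>lebesgue)"
proof -
  define S where "S = (1 + r / \<rho>0) powr \<theta>"
  define Q where "Q = cube x0 r"
  define H where "H = (\<integral>\<^sup>+y\<in>Q. ennreal (\<eta> (2 * \<bar>f y\<bar> / t)) * indicator {y. t < 2 * \<bar>f y\<bar>} y \<partial>lebesgue)"
  define q where "q = (2 * (r / sqrt CARD('n))) ^ CARD('n)"
  have q: "0 < q" "emeasure lebesgue Q = ennreal q"
    using assms by (simp_all add: q_def emeasure_cube Q_def)
  have rr: "0 < r / \<rho>0" using assms by simp
  have S: "1 \<le> S" using rr \<theta> by (simp add: S_def ge_one_powr_ge_zero)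
  have [measurable]: "Q \<in> sets lebesgue" "f \<in> borel_measurable lebesgue"
    unfolding Q_def using f by auto
  have m1 [measurable]: "(\<lambda>y. ennreal (\<eta> (2 * \<bar>f y\<bar> / t))) \<in> borel_measurable lebesgue"
  proof -
    have [measurable]: "(\<lambda>x. \<eta> (max 0 x)) \<in> borel_measurable borel"
      by (rule borel_measurable_truncate[OF \<eta>(3)])
    have "(\<lambda>y. ennreal (\<eta> (max 0 (2 * \<bar>f y\<bar> / t)))) \<in> borel_measurable lebesgue"
      by measurable
    then show ?thesis using t by (simp add: max_absorb2)
  qed
  have "ennreal (t * S) < lux_average (\<lambda>t. ennreal (\<eta> t)) Q f"
  proof (rule ccontr)
    assume "\<not> ?thesis"
    then have "ennreal (inverse S) * lux_average (\<lambda>t. ennreal (\<eta> t)) Q f \<le> ennreal (inverse S) * ennreal (t * S)"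
      by (intro mult_left_mono) auto
    also have "\<dots> = ennreal t" using S t by (simp add: ennreal_mult[symmetric])
    finally show False using gt by (simp add: S_def Q_def powr_minus)
  qed
  then have "1 < average Q (\<lambda>y. ennreal (\<eta> (\<bar>f y\<bar> / (t * S))))"
    using t S by (intro average_gt_1_if_less_lux_average) auto
  then have "ennreal q < (\<integral>\<^sup>+y\<in>Q. ennreal (\<eta> (\<bar>f y\<bar> / (t * S))) \<partial>lebesgue)"
    unfolding average_def q(2) by (rule less_if_one_less_divide[OF q(1)])
  also have "\<dots> \<le> (\<integral>\<^sup>+y. ennreal (inverse (2 * S)) * (ennreal (\<eta> (2 * \<bar>f y\<bar> / t)) * indicator {y. t < 2 * \<bar>f y\<bar>} y * indicator Q y)
        + ennreal (1/2) * indicator Q y \<partial>lebesgue)"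
  proof (rule nn_integral_mono)
    fix y
    \<comment> \<open>Where \<open>2 * \<bar>f y\<bar> \<le> t\<close> the argument is at most 1/2,
      so \<open>F = 0\<close> is enough; such points drop out of the integral on the right.\<close>
    define F where "F = (if t < 2 * \<bar>f y\<bar> then 2 * \<bar>f y\<bar> / t else 0)"
    have F0: "0 \<le> F" using t by (simp add: F_def)
    have iS: "0 \<le> inverse S" "inverse S \<le> 1" using S by (auto simp: field_simps)
    have "\<bar>f y\<bar> / (t * S) \<le> (1 - 1/2) * 1 + (1/2) * (inverse S * F)"
    proof (cases "t < 2 * \<bar>f y\<bar>")
      case True
      then show ?thesis using t S by (simp add: F_def field_simps)
    next
      case False
      have "\<bar>f y\<bar> / (t * S) \<le> \<bar>f y\<bar> / t" using t S by (intro divide_left_mono) auto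
      also have "\<dots> \<le> 1/2" using False t by (simp add: field_simps)
      finally show ?thesis using False by (simp add: F_def)
    qed
    then have "\<eta> (\<bar>f y\<bar> / (t * S)) \<le> \<eta> ((1 - 1/2) * 1 + (1/2) * (inverse S * F))"
      using t S by (intro young_mono[of \<eta>, OF \<eta>(1)]) auto
    also have "\<dots> \<le> (1 - 1/2) * \<eta> 1 + (1/2) * \<eta> (inverse S * F)"
      using F0 iS by (intro young_convex[of \<eta>, OF \<eta>(1)]) auto
    also have "\<dots> \<le> 1/2 + (1/2) * (inverse S * \<eta> F)"
      using young_scale[OF \<eta>(1) F0 iS] \<eta>(2) by (simp add: normalized_def)
    finally have *: "\<eta> (\<bar>f y\<bar> / (t * S)) \<le> inverse (2 * S) * \<eta> F + 1/2" by (simp add: field_simps)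
    have "\<eta> 0 = 0" using \<eta>(1) by (simp add: young_function_def)
    then have eF: "ennreal (\<eta> F) = ennreal (\<eta> (2 * \<bar>f y\<bar> / t)) * indicator {y. t < 2 * \<bar>f y\<bar>} y"
      by (simp add: F_def indicator_def)
    have "ennreal (\<eta> (\<bar>f y\<bar> / (t * S))) \<le> ennreal (inverse (2 * S)) * ennreal (\<eta> F) + ennreal (1/2)"
    proof -
      have "ennreal (inverse (2 * S) * \<eta> F + 1/2) = ennreal (inverse (2 * S)) * ennreal (\<eta> F) + ennreal (1/2)"
      proof -
        have "0 \<le> inverse (2 * S) * \<eta> F" using S young_nonneg[OF \<eta>(1) F0] by simp
        then have "ennreal (inverse (2 * S) * \<eta> F + 1/2) = ennreal (inverse (2 * S) * \<eta> F) + ennreal (1/2)"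
          by (rule ennreal_plus) simp
        also have "ennreal (inverse (2 * S) * \<eta> F) = ennreal (inverse (2 * S)) * ennreal (\<eta> F)"
          using S young_nonneg[OF \<eta>(1) F0] by (intro ennreal_mult) auto
        finally show ?thesis .
      qed
      then show ?thesis using ennreal_leI[OF *] by (simp only:)
    qed
    then show "ennreal (\<eta> (\<bar>f y\<bar> / (t * S))) * indicator Q y \<le>
      ennreal (inverse (2 * S)) * (ennreal (\<eta> (2 * \<bar>f y\<bar> / t)) * indicator {y. t < 2 * \<bar>f y\<bar>} y * indicator Q y) + ennreal (1/2) * indicator Q y"
      unfolding eF by (auto simp: indicator_def)
  qed
  also have "\<dots> = (\<integral>\<^sup>+y. ennreal (inverse (2 * S)) * (ennreal (\<eta> (2 * \<bar>f y\<bar> / t)) * indicator {y. t < 2 * \<bar>f y\<bar>} y * indicator Q y) \<partial>lebesgue)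
      + (\<integral>\<^sup>+y. ennreal (1/2) * indicator Q y \<partial>lebesgue)"
    by (intro nn_integral_add) measurable
  also have "(\<integral>\<^sup>+y. ennreal (inverse (2 * S)) * (ennreal (\<eta> (2 * \<bar>f y\<bar> / t)) * indicator {y. t < 2 * \<bar>f y\<bar>} y * indicator Q y) \<partial>lebesgue)
     = ennreal (inverse (2 * S)) * H"
    unfolding H_def by (intro nn_integral_cmult) measurable
  also have "(\<integral>\<^sup>+y. ennreal (1/2) * indicator Q y \<partial>lebesgue) = ennreal (q / 2)"
  proof -
    have "(\<integral>\<^sup>+y. ennreal (1/2) * indicator Q y \<partial>lebesgue) = ennreal (1/2) * ennreal q"
      using q by (subst nn_integral_cmult_indicator) auto
    also have "\<dots> = ennreal (1/2 * q)" using q by (intro ennreal_mult[symmetric]) auto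
    finally show ?thesis by simp
  qed
  finally have lt: "ennreal q < ennreal (inverse (2 * S)) * H + ennreal (q / 2)" .
  have "ennreal (S * q) \<le> H"
  proof (rule ccontr)
    assume n: "\<not> ?thesis"
    then have "ennreal (inverse (2 * S)) * H + ennreal (q / 2) \<le> ennreal (inverse (2 * S)) * ennreal (S * q) + ennreal (q / 2)"
      by (intro add_mono mult_left_mono) auto
    also have "ennreal (inverse (2 * S)) * ennreal (S * q) = ennreal (inverse (2 * S) * (S * q))"
      using q S by (intro ennreal_mult[symmetric]) auto
    also have "\<dots> + ennreal (q / 2) = ennreal (inverse (2 * S) * (S * q) + q / 2)"
      using q S by (intro ennreal_plus[symmetric]) auto
    also have "inverse (2 * S) * (S * q) + q / 2 = q" using S by (simp add: field_simps)
    finally show False using lt by auto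
  qed
  then show ?thesis using q S unfolding S_def[symmetric] Q_def[symmetric] H_def[symmetric]
    by (simp add: ennreal_mult)
qed

lemma orlicz_maximal_weak_type:
  fixes f w :: "real ^ 'n \<Rightarrow> real"
  assumes \<rho>: "\<And>x. 0 < \<rho> x" and \<theta>: "0 \<le> \<theta>" and t: "0 < t"
    and \<eta>: "young_function \<eta>" "normalized \<eta>" "continuous_on {0..} \<eta>"
    and f: "f \<in> borel_measurable lebesgue" and w: "w \<in> borel_measurable lebesgue"
  shows "(\<integral>\<^sup>+x\<in>{x. ennreal t < orlicz_maximal \<rho> (\<lambda>t. ennreal (\<eta> t)) \<theta> f x}. ennreal \<bar>w x\<bar> \<partial>lebesgue)
    \<le> ennreal ((5 * sqrt CARD('n)) ^ CARD('n) * (5 * sqrt CARD('n)) powr \<theta>) *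
      (\<integral>\<^sup>+x. ennreal (\<eta> (2 * \<bar>f x\<bar> / t)) * indicator {y. t < 2 * \<bar>f y\<bar>} x * maximal \<rho> \<theta> w x \<partial>lebesgue)"
proof -
  define P where "P x0 r \<longleftrightarrow> ennreal t < ennreal ((1 + r / \<rho> x0) powr (- \<theta>)) * lux_average (\<lambda>t. ennreal (\<eta> t)) (cube x0 r) f"
    for x0 r
  \<comment> \<open>Radii are cut at \<open>N\<close> to meet the boundedness required by the
    covering lemma. The sets increase to the full level set, which is recovered by continuity from
    below of the measure with density \<open>\<bar>w x\<bar>\<close>.\<close>
  define U where "U N = {x. \<exists>x0 r. 0 < r \<and> (P x0 r \<and> r < real N) \<and> x \<in> cube x0 r}" for N :: nat
  define h where "h y = ennreal (\<eta> (2 * \<bar>f y\<bar> / t)) * indicator {y. t < 2 * \<bar>f y\<bar>} y" for y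
  have U_eq: "{x. ennreal t < orlicz_maximal \<rho> (\<lambda>t. ennreal (\<eta> t)) \<theta> f x} = (\<Union>N. U N)"
    unfolding less_orlicz_maximal_iff U_def P_def[symmetric] by (auto; metis reals_Archimedean2)
  have openU: "open (U N)" for N
    unfolding U_def
  proof (rule open_Union_cubes)
    fix x0 and r :: real assume r: "0 < r" "P x0 r \<and> r < real N"
    have "eventually (P x0) (at_right r)"
      using r unfolding P_def
      by (intro eventually_lux_average_greater mono_on_young_ennreal \<eta> \<rho>) auto
    moreover have "eventually (\<lambda>s. s < real N) (at_right r)"
      using r eventually_at_right_real[of r "real N"] by (auto elim!: eventually_mono)
    ultimately show "eventually (\<lambda>s. P x0 s \<and> s < real N) (at_right r)" by eventually_elim auto
  qed
  have [measurable]: "U N \<in> sets lebesgue" for N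
    using openU[of N] by (auto intro!: borel_open)
  have [measurable]: "f \<in> borel_measurable lebesgue" "w \<in> borel_measurable lebesgue" by fact+
  have h: "h \<in> borel_measurable lebesgue"
  proof -
    have [measurable]: "(\<lambda>x. \<eta> (max 0 x)) \<in> borel_measurable borel"
      by (rule borel_measurable_truncate[OF \<eta>(3)])
    have "(\<lambda>y. ennreal (\<eta> (max 0 (2 * \<bar>f y\<bar> / t))) * indicator {y. t < 2 * \<bar>f y\<bar>} y) \<in> borel_measurable lebesgue"
      by measurable
    then show ?thesis using t by (simp add: max_absorb2 h_def[abs_def])
  qed
  have bound: "(\<integral>\<^sup>+x\<in>U N. ennreal \<bar>w x\<bar> \<partial>lebesgue)
    \<le> ennreal ((5 * sqrt CARD('n)) ^ CARD('n) * (5 * sqrt CARD('n)) powr \<theta>) *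
      (\<integral>\<^sup>+x. h x * maximal \<rho> \<theta> w x \<partial>lebesgue)" for N
  proof -
    have U: "U N = (\<Union>(x0, r)\<in>{(x0, r). 0 < r \<and> P x0 r \<and> r < real N}. cube x0 r)"
      unfolding U_def by auto
    have "0 < r \<and> r \<le> real N \<and> ennreal ((1 + r / \<rho> x0) powr \<theta>) * emeasure lebesgue (cube x0 r) \<le> (\<integral>\<^sup>+y\<in>cube x0 r. h y \<partial>lebesgue)"
      if "(x0, r) \<in> {(x0, r). 0 < r \<and> P x0 r \<and> r < real N}" for x0 r
    proof -
      have r: "0 < r" "P x0 r" "r < real N" using that by auto
      show ?thesis
        unfolding h_def
        by (intro conjI r less_imp_le[OF r(3)] orlicz_maximal_cube_good[OF \<rho> \<theta> t r(1) \<eta> f r(2)[unfolded P_def]])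
    qed
    then show ?thesis unfolding U by (rule covering_estimate[OF \<rho> \<theta> w h])
  qed
  have "(\<integral>\<^sup>+x\<in>(\<Union>N. U N). ennreal \<bar>w x\<bar> \<partial>lebesgue) = emeasure (density lebesgue (\<lambda>x. ennreal \<bar>w x\<bar>)) (\<Union>N. U N)"
    by (subst emeasure_density) auto
  also have "\<dots> = (SUP N. emeasure (density lebesgue (\<lambda>x. ennreal \<bar>w x\<bar>)) (U N))"
  proof (intro SUP_emeasure_incseq[symmetric])
    show "incseq U" unfolding incseq_def U_def by (auto, force)
  qed auto
  also have "\<dots> = (SUP N. \<integral>\<^sup>+x\<in>U N. ennreal \<bar>w x\<bar> \<partial>lebesgue)"
    by (subst emeasure_density) auto
  also have "\<dots> \<le> ennreal ((5 * sqrt CARD('n)) ^ CARD('n) * (5 * sqrt CARD('n)) powr \<theta>) *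
      (\<integral>\<^sup>+x. h x * maximal \<rho> \<theta> w x \<partial>lebesgue)"
    by (intro SUP_least bound)
  finally show ?thesis unfolding U_eq h_def .
qed

section \<open>Layer-cake formula and the integrated condition\<close>

text \<open>Weights and test functions are only Lebesgue measurable, so Fubini is applied to the
  completed measure; a cover by Borel sets of finite measure remains one after completion.\<close>

lemma sigma_finite_lebesgue: "sigma_finite_measure (lebesgue :: 'a::euclidean_space measure)"
proof -
  obtain A :: "'a set set" where "countable A" "A \<subseteq> sets lborel" "\<Union>A = space lborel" "\<forall>a\<in>A. emeasure lborel a \<noteq> \<infinity>"
    using lborel.sigma_finite_countable by blast
  then show ?thesis
    by unfold_locales (auto intro!: exI[of _ A])
qed

lemma young_ext_ennreal: "0 \<le> r \<Longrightarrow> young_ext \<Phi> (ennreal r) = ennreal (\<Phi> r)"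
  by (simp add: young_ext_def)

text \<open>Serves for the pair (\<open>a\<close>, \<open>\<phi>\<close>) and for the pair
  (\<open>b\<close>, \<open>\<psi>\<close>) alike.\<close>

locale antiderivative =
  fixes a \<phi> :: "real \<Rightarrow> real"
  assumes cont: "continuous_on {0..} a" and at_0: "a 0 = 0" and pos: "0 < s \<Longrightarrow> 0 < a s"
    and eq_integral: "0 \<le> t \<Longrightarrow> \<phi> t = integral {0..t} a"
begin

lemma nonneg: "0 \<le> s \<Longrightarrow> 0 \<le> a s"
  using pos[of s] at_0 by (cases "s = 0") auto

lemma has_integral: "0 \<le> s \<Longrightarrow> s \<le> t \<Longrightarrow> (a has_integral integral {s..t} a) {s..t}"
  by (intro integrable_integral integrable_continuous_interval continuous_on_subset[OF cont]) auto

lemma combine: "0 \<le> s \<Longrightarrow> s \<le> t \<Longrightarrow> \<phi> t = \<phi> s + integral {s..t} a"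
  using Henstock_Kurzweil_Integration.integral_combine[of 0 s t a] integrable_on_def has_integral[of 0 t]
  by (auto simp: eq_integral)

lemma Phi_nonneg: "0 \<le> t \<Longrightarrow> 0 \<le> \<phi> t"
  using has_integral_nonneg[OF has_integral[of 0 t]] nonneg by (auto simp: eq_integral)

lemma Phi_mono:
  assumes "0 \<le> s" "s \<le> t" shows "\<phi> s \<le> \<phi> t"
  using has_integral_nonneg[OF has_integral[OF assms]] nonneg assms by (auto simp: combine[OF assms])

lemma ge_mult:
  assumes "mono_on {0..} a" "0 \<le> t"
  shows "t * a t \<le> \<phi> (2 * t)"
proof -
  have "((\<lambda>_. a t) has_integral (2 * t - t) *\<^sub>R a t) {t..2*t}"
    using has_integral_const_real[of "a t" t "2 * t"] assms by simp
  then have "(2 * t - t) *\<^sub>R a t \<le> integral {t..2 * t} a"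
    by (rule has_integral_le[OF _ has_integral]) (use assms in \<open>auto simp: mono_on_def\<close>)
  then show ?thesis using combine[of t "2 * t"] Phi_nonneg[of t] assms by simp
qed

lemma le_mult:
  assumes "mono_on {0..} a" "0 \<le> t"
  shows "\<phi> t \<le> t * a t"
proof -
  have "((\<lambda>_. a t) has_integral (t - 0) *\<^sub>R a t) {0..t}"
    using has_integral_const_real[of "a t" 0 t] assms by simp
  with has_integral[OF order_refl assms(2)] have "integral {0..t} a \<le> (t - 0) *\<^sub>R a t"
    by (rule has_integral_le) (use assms in \<open>auto simp: mono_on_def\<close>)
  then show ?thesis using assms by (simp add: eq_integral)
qed

lemma unbounded_if_derivative_unbounded:
  assumes "mono_on {0..} a" "filterlim a at_top at_top"
  shows "filterlim \<phi> at_top at_top"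
proof -
  have half: "filterlim (\<lambda>t::real. t / 2) at_top at_top"
    by (rule filterlim_at_top_mult_tendsto_pos[where f = "\<lambda>_. 1 / 2" and c = "1 / 2", simplified])
      (auto intro: filterlim_ident)
  have "eventually (\<lambda>t. a (t / 2) \<le> \<phi> t) at_top"
    using eventually_ge_at_top[of 2]
  proof eventually_elim
    case (elim t)
    have "1 * a (t / 2) \<le> (t / 2) * a (t / 2)"
      using elim nonneg[of "t / 2"] by (intro mult_right_mono) auto
    also have "\<dots> \<le> \<phi> (2 * (t / 2))" using elim by (intro ge_mult assms(1)) auto
    finally show ?case by simp
  qed
  then show ?thesis
    by (rule filterlim_at_top_mono[OF filterlim_compose[OF assms(2) half]])
qed

end

text \<open>Unboundedness matches the convention that \<open>young_ext\<close> is infinite at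
  \<open>\<infinity>\<close>: the layer-cake integral over all heights must then diverge as
  well.\<close>

locale integrator = antiderivative +
  assumes unbounded: "filterlim \<phi> at_top at_top"
begin

lemma measurable_cut [measurable]: "(\<lambda>t. indicator {0..} t * a t) \<in> borel_measurable borel"
  using borel_measurable_continuous_on_indicator[OF _ cont] by simp

text \<open>Density of the Stieltjes measure of \<open>\<phi>\<close>. The cut to positive heights
  matters because \<open>ennreal t\<close> is 0 for negative \<open>t\<close>, where
  \<open>a\<close> is arbitrary.\<close>

definition a_pos :: "real \<Rightarrow> ennreal" where "a_pos t = ennreal (a t) * indicator {0<..} t"

lemma measurable_a_pos [measurable]: "a_pos \<in> borel_measurable borel"
proof -
  have "a_pos = (\<lambda>t. ennreal (indicator {0..} t * a t) * indicator {0<..} t)"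
    by (auto simp: a_pos_def indicator_def)
  then show ?thesis by simp
qed

lemma nn_integral_a_pos:
  assumes "0 \<le> t" shows "(\<integral>\<^sup>+s\<in>{..t}. a_pos s \<partial>lborel) = ennreal (\<phi> t)"
proof -
  have "AE s in lborel. s \<noteq> (0::real)" by (rule AE_lborel_singleton)
  then have "AE s in lborel. a_pos s * indicator {..t} s = ennreal (indicator {0..t} s * a s)"
    by eventually_elim (auto simp: a_pos_def indicator_def)
  then have "(\<integral>\<^sup>+s\<in>{..t}. a_pos s \<partial>lborel) = (\<integral>\<^sup>+s. ennreal (indicator {0..t} s * a s) \<partial>lborel)"
    by (rule nn_integral_cong_AE)
  also have "\<dots> = ennreal (integral {0..t} a)"
    using has_integral[OF order_refl assms] nonneg
    by (intro nn_integral_has_integral_lebesgue) auto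
  finally show ?thesis using assms by (simp add: eq_integral)
qed

text \<open>For a finite value the positive heights strictly below it differ from those up to it by
  one point, a null set; for an infinite value the integral dominates every
  \<open>\<phi> s\<close>.\<close>

lemma layer_cake:
  "young_ext \<phi> g = (\<integral>\<^sup>+t. a_pos t * indicator {t. ennreal t < g} t \<partial>lborel)"
proof (cases g)
  case (real r)
  have "(\<integral>\<^sup>+t. a_pos t * indicator {t. ennreal t < g} t \<partial>lborel) = (\<integral>\<^sup>+s\<in>{..r}. a_pos s \<partial>lborel)"
  proof (rule nn_integral_cong_AE)
    have "AE s in lborel. s \<noteq> r" by (rule AE_lborel_singleton)
    then show "AE s in lborel. a_pos s * indicator {t. ennreal t < g} s = a_pos s * indicator {..r} s"
    proof eventually_elim
      case (elim s)
      then show ?case using real by (cases "0 < s") (auto simp: a_pos_def indicator_def ennreal_less_iff)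
    qed
  qed
  then show ?thesis using real by (simp add: nn_integral_a_pos young_ext_def)
next
  case top
  have "(\<integral>\<^sup>+t. a_pos t * indicator {t. ennreal t < g} t \<partial>lborel) = \<infinity>"
  proof (rule ccontr)
    assume "\<not> ?thesis"
    then obtain c where c: "(\<integral>\<^sup>+t. a_pos t * indicator {t. ennreal t < g} t \<partial>lborel) = ennreal c" "0 \<le> c"
      by (cases "(\<integral>\<^sup>+t. a_pos t * indicator {t. ennreal t < g} t \<partial>lborel)") auto
    obtain s where s: "0 \<le> s" "c < \<phi> s"
    proof -
      have "eventually (\<lambda>s. c < \<phi> s) at_top" using unbounded by (auto simp: filterlim_at_top_dense)
      then have "eventually (\<lambda>s. 0 \<le> s \<and> c < \<phi> s) at_top"
        using eventually_ge_at_top[of 0] by eventually_elim auto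
      then show ?thesis using that by (auto simp: eventually_at_top_linorder)
    qed
    have "ennreal (\<phi> s) = (\<integral>\<^sup>+t\<in>{..s}. a_pos t \<partial>lborel)" using s by (simp add: nn_integral_a_pos)
    also have "\<dots> \<le> (\<integral>\<^sup>+t. a_pos t * indicator {t. ennreal t < g} t \<partial>lborel)"
      by (intro nn_integral_mono) (auto simp: top indicator_def)
    finally show False using c s by simp
  qed
  then show ?thesis using top by (simp add: young_ext_def)
qed

lemma young_ext_mono:
  assumes "g \<le> h" shows "young_ext \<phi> g \<le> young_ext \<phi> h"
  unfolding layer_cake using assms by (intro nn_integral_mono) (auto simp: indicator_def)

end

section \<open>Equivalence of (a) with its integrated form\<close>

text \<open>Condition (a) multiplied by \<open>t\<close>, with \<open>u * deriv \<eta> u\<close>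
  replaced by \<open>\<eta> u\<close> at \<open>u = t / s\<close>, and \<open>t * b t\<close> by
  \<open>\<psi>\<close>. In this derivative-free form the condition appears when level-set measures
  are integrated against \<open>a\<close>.\<close>

definition dini_primitive_condition ::
  "(real \<Rightarrow> real) \<Rightarrow> (real \<Rightarrow> real) \<Rightarrow> (real \<Rightarrow> real) \<Rightarrow> bool" where
  "dini_primitive_condition \<eta> a \<psi> \<longleftrightarrow>
    (\<exists>C>0. \<forall>t>0. (\<integral>\<^sup>+s\<in>{0<..t}. ennreal (a s * \<eta> (t / s)) \<partial>lborel) \<le> ennreal (C * \<psi> (C * t)))"

text \<open>The tangent at \<open>u\<close> lies below the convex function; the two bounds come from
  evaluating it at 0 and at \<open>2 * u\<close>.\<close>

lemma young_deriv:
  assumes \<eta>: "young_function \<eta>" "\<eta> differentiable_on {0..}" and "0 < (u::real)"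
  shows "\<eta> u \<le> u * deriv \<eta> u" "u * deriv \<eta> u \<le> \<eta> (2 * u) - \<eta> u"
proof -
  have "\<eta> differentiable (at u within {0..})" using \<eta>(2) assms(3) by (auto simp: differentiable_on_def)
  \<comment> \<open>At an interior point the one-sided notion of differentiability on
    \<open>{0..}\<close> is the ordinary one, to which \<open>deriv\<close> refers.\<close>
  moreover have "at u within {0..} = at u" using assms(3) by (intro at_within_interior) (auto simp: interior_real_atLeast)
  ultimately have d: "(\<eta> has_field_derivative deriv \<eta> u) (at u)"
    using DERIV_deriv_iff_real_differentiable by metis
  have *: "deriv \<eta> u * (y - u) \<le> \<eta> y - \<eta> u" if "0 \<le> y" for y
    by (rule convex_on_imp_above_tangent[of "{0..}"])
      (use \<eta> d assms(3) that in \<open>auto simp: young_function_def interior_real_atLeast intro: DERIV_subset\<close>)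
  show "\<eta> u \<le> u * deriv \<eta> u" using *[of 0] \<eta> by (simp add: young_function_def mult.commute)
  show "u * deriv \<eta> u \<le> \<eta> (2 * u) - \<eta> u" using *[of "2 * u"] assms(3) by (simp add: mult.commute)
qed

lemma doubling_bound:
  assumes "doubling \<eta>" obtains C where "0 < C" "\<And>t. 0 \<le> t \<Longrightarrow> \<eta> (2 * t) \<le> C * \<eta> t"
  using assms unfolding doubling_def by blast

locale dini_setting = phi: integrator a \<phi> + psi: integrator b \<psi>
  for a b \<phi> \<psi> :: "real \<Rightarrow> real" +
  fixes \<eta> :: "real \<Rightarrow> real"
  assumes \<eta>: "young_function \<eta>" "normalized \<eta>" "\<eta> differentiable_on {0..}" "doubling \<eta>"
    and phi_young: "young_function \<phi>"
    and b_mono: "mono_on {0..} b"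
begin

lemma eta_cont: "continuous_on {0..} \<eta>"
  by (rule differentiable_imp_continuous_on[OF \<eta>(3)])

text \<open>Continuity of \<open>a\<close> and \<open>\<eta>\<close> is known on
  \<open>{0..}\<close> only, so both are cut off at 0 to become Borel functions; on positive heights
  this changes nothing.\<close>

lemma measurable_dini_integrand:
  assumes "I \<in> sets borel" "I \<subseteq> {0<..}" "0 \<le> t"
  shows "(\<lambda>s. ennreal (a s * \<eta> (t / s)) * indicator I s) \<in> borel_measurable borel"
proof -
  have [measurable]: "(\<lambda>x. \<eta> (max 0 x)) \<in> borel_measurable borel" "I \<in> sets borel"
    by (rule borel_measurable_truncate[OF eta_cont]) fact
  have "(\<lambda>s. ennreal ((indicator {0..} s * a s) * \<eta> (max 0 (t / s))) * indicator I s) \<in> borel_measurable borel"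
    by measurable
  also have "(\<lambda>s. ennreal ((indicator {0..} s * a s) * \<eta> (max 0 (t / s))) * indicator I s) =
    (\<lambda>s. ennreal (a s * \<eta> (t / s)) * indicator I s)"
  proof
    fix s
    show "ennreal ((indicator {0..} s * a s) * \<eta> (max 0 (t / s))) * indicator I s
      = ennreal (a s * \<eta> (t / s)) * indicator I s"
    proof (cases "s \<in> I")
      case True
      then have "0 < s" using assms(2) by auto
      then show ?thesis using assms(3) by (simp add: max_absorb2)
    qed simp
  qed
  finally show ?thesis .
qed

lemma dini_imp_primitive:
  assumes "dini_condition \<eta> a b"
  shows "dini_primitive_condition \<eta> a \<psi>"
proof -
  obtain C where C: "0 < C" "\<And>t. 0 \<le> t \<Longrightarrow>
        (\<integral>\<^sup>+s\<in>{0<..t}. ennreal (a s / s * deriv \<eta> (t / s)) \<partial>lebesgue) \<le> ennreal (C * b (C * t))"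
    using assms unfolding dini_condition_def by blast
  have main: "(\<integral>\<^sup>+s\<in>{0<..t}. ennreal (a s * \<eta> (t / s)) \<partial>lborel) \<le> ennreal (\<psi> (2 * (C * t)))" if t: "0 < t" for t
  proof (cases "(\<integral>\<^sup>+s\<in>{0<..t}. ennreal (a s * \<eta> (t / s)) \<partial>lborel) = 0")
    case False
    have le: "(\<integral>\<^sup>+s\<in>{0<..t}. ennreal (a s * \<eta> (t / s)) \<partial>lborel) * ennreal (inverse t)
      \<le> (\<integral>\<^sup>+s\<in>{0<..t}. ennreal (a s / s * deriv \<eta> (t / s)) \<partial>lborel)"
    proof -
      have [measurable]: "(\<lambda>s. ennreal (a s * \<eta> (t / s)) * indicator {0<..t} s) \<in> borel_measurable borel"
        using t by (intro measurable_dini_integrand) auto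
      have "(\<integral>\<^sup>+s\<in>{0<..t}. ennreal (a s * \<eta> (t / s)) \<partial>lborel) * ennreal (inverse t) =
        (\<integral>\<^sup>+s. (ennreal (a s * \<eta> (t / s)) * indicator {0<..t} s) * ennreal (inverse t) \<partial>lborel)"
        by (subst nn_integral_multc) auto
      also have "\<dots> \<le> (\<integral>\<^sup>+s\<in>{0<..t}. ennreal (a s / s * deriv \<eta> (t / s)) \<partial>lborel)"
      proof (rule nn_integral_mono)
        fix s
        show "(ennreal (a s * \<eta> (t / s)) * indicator {0<..t} s) * ennreal (inverse t) \<le>
          ennreal (a s / s * deriv \<eta> (t / s)) * indicator {0<..t} s"
        proof (cases "s \<in> {0<..t}")
          case True
          have "\<eta> (t / s) \<le> (t / s) * deriv \<eta> (t / s)"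
            using True t by (intro young_deriv \<eta>) auto
          then have "a s * \<eta> (t / s) * inverse t \<le> a s * ((t / s) * deriv \<eta> (t / s)) * inverse t"
            using phi.nonneg[of s] True t by (intro mult_right_mono mult_left_mono) auto
          also have "\<dots> = a s / s * deriv \<eta> (t / s)" using t by (simp add: field_simps)
          finally have "ennreal (a s * \<eta> (t / s) * inverse t) \<le> ennreal (a s / s * deriv \<eta> (t / s))"
            by (rule ennreal_leI)
          then show ?thesis using True t phi.nonneg[of s] young_nonneg[OF \<eta>(1), of "t / s"]
            by (simp add: ennreal_mult)
        qed simp
      qed
      finally show ?thesis .
    qed
    also have "\<dots> \<le> ennreal (C * b (C * t))"
      using C(2)[of t] t by (simp add: nn_integral_completion)
    finally have "(\<integral>\<^sup>+s\<in>{0<..t}. ennreal (a s * \<eta> (t / s)) \<partial>lborel) * ennreal (inverse t) * ennreal t \<le> ennreal (C * b (C * t)) * ennreal t"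
      by (rule mult_right_mono) simp
    also have "(\<integral>\<^sup>+s\<in>{0<..t}. ennreal (a s * \<eta> (t / s)) \<partial>lborel) * ennreal (inverse t) * ennreal t =
      (\<integral>\<^sup>+s\<in>{0<..t}. ennreal (a s * \<eta> (t / s)) \<partial>lborel)"
      using t by (simp add: mult.assoc ennreal_mult[symmetric])
    also have "ennreal (C * b (C * t)) * ennreal t = ennreal ((C * t) * b (C * t))"
      using t C psi.nonneg[of "C * t"] by (simp add: ennreal_mult[symmetric] mult_ac)
    also have "\<dots> \<le> ennreal (\<psi> (2 * (C * t)))"
      using psi.ge_mult[OF b_mono, of "C * t"] C t by (intro ennreal_leI) auto
    finally show ?thesis .
  qed simp
  show ?thesis unfolding dini_primitive_condition_def
  \<comment> \<open>One constant has to stand both outside and inside \<open>\<psi>\<close>;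
    outside, it suffices that it is at least 1.\<close>
  proof (intro exI[of _ "max 1 (2 * C)"] conjI allI impI)
    fix t :: real assume t: "0 < t"
    have "\<psi> (2 * (C * t)) \<le> \<psi> (max 1 (2 * C) * t)"
      using C t by (intro psi.Phi_mono) auto
    also have "\<dots> \<le> max 1 (2 * C) * \<psi> (max 1 (2 * C) * t)"
      using psi.Phi_nonneg[of "max 1 (2 * C) * t"] t by (simp add: mult_le_cancel_right1)
    finally show "(\<integral>\<^sup>+s\<in>{0<..t}. ennreal (a s * \<eta> (t / s)) \<partial>lborel) \<le> ennreal (max 1 (2 * C) * \<psi> (max 1 (2 * C) * t))"
      using main[OF t] by (meson ennreal_leI order_trans)
  qed auto
qed

lemma primitive_imp_dini:
  assumes "dini_primitive_condition \<eta> a \<psi>"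
  shows "dini_condition \<eta> a b"
proof -
  obtain C where C: "0 < C" "\<And>t. 0 < t \<Longrightarrow>
        (\<integral>\<^sup>+s\<in>{0<..t}. ennreal (a s * \<eta> (t / s)) \<partial>lborel) \<le> ennreal (C * \<psi> (C * t))"
    using assms unfolding dini_primitive_condition_def by blast
  obtain D where D: "0 < D" "\<And>t. 0 \<le> t \<Longrightarrow> \<eta> (2 * t) \<le> D * \<eta> t"
    using doubling_bound[OF \<eta>(4)] by blast
  have main: "(\<integral>\<^sup>+s\<in>{0<..t}. ennreal (a s / s * deriv \<eta> (t / s)) \<partial>lebesgue) \<le> ennreal (D * C * C * b (C * t))"
    if t: "0 < t" for t
  proof -
    have [measurable]: "(\<lambda>s. ennreal (a s * \<eta> (t / s)) * indicator {0<..t} s) \<in> borel_measurable borel"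
      using t by (intro measurable_dini_integrand) auto
    have "(\<integral>\<^sup>+s\<in>{0<..t}. ennreal (a s / s * deriv \<eta> (t / s)) \<partial>lebesgue) =
      (\<integral>\<^sup>+s\<in>{0<..t}. ennreal (a s / s * deriv \<eta> (t / s)) \<partial>lborel)"
      by (simp add: nn_integral_completion)
    also have "\<dots> \<le> (\<integral>\<^sup>+s. ennreal (D / t) * (ennreal (a s * \<eta> (t / s)) * indicator {0<..t} s) \<partial>lborel)"
    proof (rule nn_integral_mono)
      fix s
      show "ennreal (a s / s * deriv \<eta> (t / s)) * indicator {0<..t} s
        \<le> ennreal (D / t) * (ennreal (a s * \<eta> (t / s)) * indicator {0<..t} s)"
      proof (cases "s \<in> {0<..t}")
        case True
        then have p: "0 < t / s" using t by simp
        have "(t / s) * deriv \<eta> (t / s) \<le> \<eta> (2 * (t / s)) - \<eta> (t / s)"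
          by (rule young_deriv(2)[OF \<eta>(1,3) p])
        also have "\<dots> \<le> D * \<eta> (t / s)"
          using D(2)[of "t / s"] young_nonneg[OF \<eta>(1), of "t / s"] p by auto
        finally have "a s * ((t / s) * deriv \<eta> (t / s)) / t \<le> a s * (D * \<eta> (t / s)) / t"
          using phi.nonneg[of s] True t by (intro divide_right_mono mult_left_mono) auto
        moreover have "a s * ((t / s) * deriv \<eta> (t / s)) / t = a s / s * deriv \<eta> (t / s)"
          using t by simp
        moreover have "a s * (D * \<eta> (t / s)) / t = (D / t) * (a s * \<eta> (t / s))" by simp
        ultimately have "ennreal (a s / s * deriv \<eta> (t / s)) \<le> ennreal ((D / t) * (a s * \<eta> (t / s)))"
          by (metis ennreal_leI)
        also have "\<dots> = ennreal (D / t) * ennreal (a s * \<eta> (t / s))"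
          using t D True phi.nonneg[of s] young_nonneg[OF \<eta>(1), of "t / s"] by (intro ennreal_mult) auto
        finally show ?thesis using True by simp
      qed simp
    qed
    also have "\<dots> = ennreal (D / t) * (\<integral>\<^sup>+s\<in>{0<..t}. ennreal (a s * \<eta> (t / s)) \<partial>lborel)"
      by (intro nn_integral_cmult) auto
    also have "\<dots> \<le> ennreal (D / t) * ennreal (C * \<psi> (C * t))"
      by (intro mult_left_mono C t) auto
    also have "\<dots> = ennreal ((D / t) * (C * \<psi> (C * t)))"
      using D C t psi.Phi_nonneg[of "C * t"] by (intro ennreal_mult[symmetric]) auto
    also have "\<dots> \<le> ennreal (D * C * C * b (C * t))"
    proof (rule ennreal_leI)
      \<comment> \<open>The factor \<open>t\<close> gained here cancels the \<open>1 / t\<close>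
        left over from passing to the derivative.\<close>
      have "\<psi> (C * t) \<le> (C * t) * b (C * t)"
        using psi.le_mult[OF b_mono, of "C * t"] C t by auto
      then have "(D / t) * (C * \<psi> (C * t)) \<le> (D / t) * (C * ((C * t) * b (C * t)))"
        using D C t by (intro mult_left_mono) auto
      also have "\<dots> = D * C * C * b (C * t)" using t by simp
      finally show "(D / t) * (C * \<psi> (C * t)) \<le> D * C * C * b (C * t)" .
    qed
    finally show ?thesis .
  qed
  \<comment> \<open>The outer constant \<open>D * C * C\<close> and the inner one \<open>C\<close>
    are merged; enlarging the inner one is harmless because \<open>b\<close> is
    nondecreasing.\<close>
  define E where "E = max C (D * C * C)"
  show ?thesis unfolding dini_condition_def
  proof (intro exI[of _ E] conjI allI impI)
    show "0 < E" using C by (simp add: E_def)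
    fix t :: real assume t: "0 \<le> t"
    show "(\<integral>\<^sup>+s\<in>{0<..t}. ennreal (a s / s * deriv \<eta> (t / s)) \<partial>lebesgue) \<le> ennreal (E * b (E * t))"
    proof (cases "t = 0")
      case False
      have "0 \<le> C * t" "C * t \<le> E * t" using C t by (auto simp: E_def intro!: mult_right_mono)
      then have "b (C * t) \<le> b (E * t)"
        using b_mono unfolding mono_on_def by auto
      moreover have "D * C * C \<le> E" "0 \<le> E" "0 \<le> b (C * t)"
        using C D psi.nonneg[OF \<open>0 \<le> C * t\<close>] by (auto simp: E_def)
      ultimately have "D * C * C * b (C * t) \<le> E * b (E * t)" by (intro mult_mono)
      then have "ennreal (D * C * C * b (C * t)) \<le> ennreal (E * b (E * t))" by (rule ennreal_leI)
      moreover have "0 < t" using False t by simp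
      ultimately show ?thesis using main by (blast intro: order_trans)
    qed simp
  qed
qed

section \<open>The weighted modular inequality\<close>

text \<open>After the weak-type bound and Fubini, the integral over heights for fixed
  \<open>x\<close> is the one in hypothesis \<open>C\<close>, taken at the point
  \<open>2 * \<bar>f x\<bar>\<close>. This is where the 2 inside \<open>\<psi>\<close> comes from;
  the other constant is that of the covering.\<close>

lemma strong_type:
  fixes f w :: "real ^ 'n \<Rightarrow> real"
  assumes \<rho>: "\<And>x. 0 < \<rho> x" and \<theta>: "0 \<le> \<theta>"
    and f: "f \<in> borel_measurable lebesgue" and w: "w \<in> nonneg_measurable"
    and C: "0 < C" "\<And>t. 0 < t \<Longrightarrow> (\<integral>\<^sup>+s\<in>{0<..t}. ennreal (a s * \<eta> (t / s)) \<partial>lborel) \<le> ennreal (C * \<psi> (C * t))"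
  shows "modular \<phi> (\<lambda>x. ennreal (w x)) (orlicz_maximal \<rho> (\<lambda>t. ennreal (\<eta> t)) \<theta> f)
    \<le> ennreal ((5 * sqrt CARD('n)) ^ CARD('n) * (5 * sqrt CARD('n)) powr \<theta> * C) *
      modular \<psi> (maximal \<rho> \<theta> w) (\<lambda>x. ennreal (2 * C * \<bar>f x\<bar>))"
proof -
  define A where "A = (5 * sqrt CARD('n)) ^ CARD('n) * (5 * sqrt CARD('n)) powr \<theta>"
  define M where "M = orlicz_maximal \<rho> (\<lambda>t. ennreal (\<eta> t)) \<theta> f"
  define Mw where "Mw = maximal \<rho> \<theta> w"
  define H where "H t x = ennreal (\<eta> (2 * \<bar>f x\<bar> / t)) * indicator {y. t < 2 * \<bar>f y\<bar>} x * Mw x" for t x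
  interpret L: sigma_finite_measure "lebesgue :: (real ^ 'n) measure" by (rule sigma_finite_lebesgue)
  interpret P: pair_sigma_finite "lborel :: real measure" "lebesgue :: (real ^ 'n) measure" ..
  have [measurable]: "M \<in> borel_measurable lebesgue" "Mw \<in> borel_measurable lebesgue" "f \<in> borel_measurable lebesgue"
    "w \<in> borel_measurable lebesgue"
    using f w unfolding M_def Mw_def nonneg_measurable_def
    by (auto intro!: lebesgue_measurable_borel borel_measurable_orlicz_maximal borel_measurable_maximal \<rho>
        mono_on_young_ennreal \<eta>)
  have [measurable]: "phi.a_pos \<in> borel_measurable borel" by (rule phi.measurable_a_pos)
  have w0: "\<bar>w x\<bar> = w x" for x using w by (auto simp: nonneg_measurable_def)
  have m\<eta> [measurable]: "(\<lambda>x. \<eta> (max 0 x)) \<in> borel_measurable borel"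
    by (rule borel_measurable_truncate[OF eta_cont])
  \<comment> \<open>Joint measurability is proved for \<open>\<eta>\<close> cut off at 0; since
    \<open>phi.a_pos\<close> vanishes for nonpositive \<open>t\<close>, the product is
    unchanged.\<close>
  have mH: "(\<lambda>(t, x). phi.a_pos t * H t x) \<in> borel_measurable (lborel \<Otimes>\<^sub>M lebesgue)"
  proof -
    have "(\<lambda>(t, x). phi.a_pos t * (ennreal (\<eta> (max 0 (2 * \<bar>f x\<bar> / t))) * indicator {z. fst z < 2 * \<bar>f (snd z)\<bar>} (t, x) * Mw x))
      \<in> borel_measurable (lborel \<Otimes>\<^sub>M lebesgue)"
      by measurable
    also have "(\<lambda>(t, x). phi.a_pos t * (ennreal (\<eta> (max 0 (2 * \<bar>f x\<bar> / t))) * indicator {z. fst z < 2 * \<bar>f (snd z)\<bar>} (t, x) * Mw x))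
      = (\<lambda>(t, x). phi.a_pos t * H t x)"
      unfolding H_def phi.a_pos_def by (auto simp: fun_eq_iff indicator_def max_absorb2)
    finally show ?thesis .
  qed
  have "modular \<phi> (\<lambda>x. ennreal (w x)) M = (\<integral>\<^sup>+x. \<integral>\<^sup>+t. phi.a_pos t * indicator {z. ennreal (fst z) < M (snd z)} (t, x) * ennreal (w x) \<partial>lborel \<partial>lebesgue)"
    unfolding modular_def phi.layer_cake
    by (intro nn_integral_cong, subst nn_integral_multc[symmetric])
      (auto intro!: nn_integral_cong simp: indicator_def)
  also have "\<dots> = (\<integral>\<^sup>+t. \<integral>\<^sup>+x. phi.a_pos t * indicator {z. ennreal (fst z) < M (snd z)} (t, x) * ennreal (w x) \<partial>lebesgue \<partial>lborel)"
    by (intro P.Fubini') measurable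
  also have "\<dots> = (\<integral>\<^sup>+t. phi.a_pos t * (\<integral>\<^sup>+x\<in>{x. ennreal t < M x}. ennreal \<bar>w x\<bar> \<partial>lebesgue) \<partial>lborel)"
    by (intro nn_integral_cong, subst nn_integral_cmult[symmetric])
      (auto intro!: nn_integral_cong simp: indicator_def w0)
  also have "\<dots> \<le> (\<integral>\<^sup>+t. ennreal A * (phi.a_pos t * (\<integral>\<^sup>+x. H t x \<partial>lebesgue)) \<partial>lborel)"
  proof (rule nn_integral_mono)
    fix t
    show "phi.a_pos t * (\<integral>\<^sup>+x\<in>{x. ennreal t < M x}. ennreal \<bar>w x\<bar> \<partial>lebesgue) \<le> ennreal A * (phi.a_pos t * (\<integral>\<^sup>+x. H t x \<partial>lebesgue))"
    proof (cases "0 < t")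
      case True
      have "(\<integral>\<^sup>+x\<in>{x. ennreal t < M x}. ennreal \<bar>w x\<bar> \<partial>lebesgue) \<le> ennreal A * (\<integral>\<^sup>+x. H t x \<partial>lebesgue)"
        using orlicz_maximal_weak_type[OF \<rho> \<theta> True \<eta>(1,2) eta_cont f, of w] w
        by (simp add: M_def H_def A_def Mw_def nonneg_measurable_def)
      then have "phi.a_pos t * (\<integral>\<^sup>+x\<in>{x. ennreal t < M x}. ennreal \<bar>w x\<bar> \<partial>lebesgue) \<le> phi.a_pos t * (ennreal A * (\<integral>\<^sup>+x. H t x \<partial>lebesgue))"
        by (rule mult_left_mono) simp
      then show ?thesis by (simp only: mult_ac)
    qed (simp add: phi.a_pos_def)
  qed
  also have "\<dots> = (\<integral>\<^sup>+t. ennreal A * (\<integral>\<^sup>+x. phi.a_pos t * H t x \<partial>lebesgue) \<partial>lborel)"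
  proof (rule nn_integral_cong)
    fix t
    have "(\<lambda>x. H t x) \<in> borel_measurable lebesgue" if "0 < t"
    proof -
      have "(\<lambda>x. ennreal (\<eta> (max 0 (2 * \<bar>f x\<bar> / t))) * indicator {y. t < 2 * \<bar>f y\<bar>} x * Mw x) \<in> borel_measurable lebesgue"
        by measurable
      then show ?thesis unfolding H_def using that by (simp add: max_absorb2)
    qed
    then show "ennreal A * (phi.a_pos t * (\<integral>\<^sup>+x. H t x \<partial>lebesgue)) = ennreal A * (\<integral>\<^sup>+x. phi.a_pos t * H t x \<partial>lebesgue)"
      by (cases "0 < t") (auto simp: nn_integral_cmult phi.a_pos_def)
  qed
  also have "\<dots> = ennreal A * (\<integral>\<^sup>+t. \<integral>\<^sup>+x. phi.a_pos t * H t x \<partial>lebesgue \<partial>lborel)"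
    using mH by (intro nn_integral_cmult L.borel_measurable_nn_integral)
  also have "(\<integral>\<^sup>+t. \<integral>\<^sup>+x. phi.a_pos t * H t x \<partial>lebesgue \<partial>lborel) = (\<integral>\<^sup>+x. \<integral>\<^sup>+t. phi.a_pos t * H t x \<partial>lborel \<partial>lebesgue)"
    using mH by (intro P.Fubini'[symmetric])
  also have "\<dots> \<le> (\<integral>\<^sup>+x. ennreal C * (young_ext \<psi> (ennreal (2 * C * \<bar>f x\<bar>)) * Mw x) \<partial>lebesgue)"
  proof (rule nn_integral_mono)
    fix x
    \<comment> \<open>Only heights below \<open>F\<close> survive the indicator, so the inner
      integral is a truncated one as in \<open>C(2)\<close>.\<close>
    define F where "F = 2 * \<bar>f x\<bar>"
    have F0: "0 \<le> F" by (simp add: F_def)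
    have "(\<integral>\<^sup>+t. phi.a_pos t * H t x \<partial>lborel) \<le> (\<integral>\<^sup>+t. (ennreal (a t * \<eta> (F / t)) * indicator {0<..F} t) * Mw x \<partial>lborel)"
      unfolding H_def F_def[symmetric]
    proof (rule nn_integral_mono)
      fix t
      show "phi.a_pos t * (ennreal (\<eta> (F / t)) * indicator {y. t < 2 * \<bar>f y\<bar>} x * Mw x)
        \<le> (ennreal (a t * \<eta> (F / t)) * indicator {0<..F} t) * Mw x"
      proof (cases "0 < t \<and> t < F")
        case True
        then have "ennreal (a t * \<eta> (F / t)) = ennreal (a t) * ennreal (\<eta> (F / t))"
          using phi.nonneg[of t] by (intro ennreal_mult') auto
        then show ?thesis using True by (simp add: phi.a_pos_def F_def mult.assoc)
      next
        case False
        then have "phi.a_pos t = 0 \<or> (indicator {y. t < 2 * \<bar>f y\<bar>} x :: ennreal) = 0"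
          by (auto simp: phi.a_pos_def F_def)
        then show ?thesis by auto
      qed
    qed
    also have "\<dots> = (\<integral>\<^sup>+t\<in>{0<..F}. ennreal (a t * \<eta> (F / t)) \<partial>lborel) * Mw x"
    proof (rule nn_integral_multc)
      show "(\<lambda>t. ennreal (a t * \<eta> (F / t)) * indicator {0<..F} t) \<in> borel_measurable lborel"
        unfolding measurable_lborel2 using F0 by (intro measurable_dini_integrand) auto
    qed
    also have "\<dots> \<le> ennreal (C * \<psi> (C * F)) * Mw x"
    proof (cases "F = 0")
      case False
      then show ?thesis using C(2)[of F] F0 by (intro mult_right_mono) auto
    qed simp
    also have "\<dots> = ennreal C * (young_ext \<psi> (ennreal (2 * C * \<bar>f x\<bar>)) * Mw x)"
    proof -
      have "young_ext \<psi> (ennreal (2 * C * \<bar>f x\<bar>)) = ennreal (\<psi> (C * F))"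
        using C by (subst young_ext_ennreal) (auto simp: F_def mult_ac)
      moreover have "ennreal (C * \<psi> (C * F)) = ennreal C * ennreal (\<psi> (C * F))"
        using C by (intro ennreal_mult') auto
      ultimately show ?thesis by (simp only: mult_ac)
    qed
    finally show "(\<integral>\<^sup>+t. phi.a_pos t * H t x \<partial>lborel) \<le> ennreal C * (young_ext \<psi> (ennreal (2 * C * \<bar>f x\<bar>)) * Mw x)" .
  qed
  also have "\<dots> = ennreal C * modular \<psi> Mw (\<lambda>x. ennreal (2 * C * \<bar>f x\<bar>))"
    unfolding modular_def
  proof (rule nn_integral_cmult)
    have "(\<lambda>x. young_ext \<psi> (ennreal (2 * C * \<bar>f x\<bar>))) = (\<lambda>x. ennreal (\<psi> (2 * C * \<bar>f x\<bar>)))"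
      using C by (auto intro!: young_ext_ennreal)
    moreover have "(\<lambda>x. ennreal (\<psi> (2 * C * \<bar>f x\<bar>))) \<in> borel_measurable lebesgue"
    proof -
      have "mono (\<lambda>x. \<psi> (max 0 x))" by (rule monoI) (rule psi.Phi_mono, auto)
      then have [measurable]: "(\<lambda>x. \<psi> (max 0 x)) \<in> borel_measurable borel" by (rule borel_measurable_mono)
      have "(\<lambda>x. ennreal (\<psi> (max 0 (2 * C * \<bar>f x\<bar>)))) \<in> borel_measurable lebesgue" by measurable
      then show ?thesis using C by (simp add: max_absorb2)
    qed
    ultimately have [measurable]: "(\<lambda>x. young_ext \<psi> (ennreal (2 * C * \<bar>f x\<bar>))) \<in> borel_measurable lebesgue"
      by (simp only:)
    show "(\<lambda>x. young_ext \<psi> (ennreal (2 * C * \<bar>f x\<bar>)) * Mw x) \<in> borel_measurable lebesgue"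
      by measurable
  qed
  finally show ?thesis using C
    by (simp add: A_def M_def Mw_def ennreal_mult mult.assoc mult_left_mono)
qed

end

section \<open>Scaling: from modular to norm inequalities\<close>

text \<open>Multiplication by a positive finite number is an order automorphism of the extended
  half-line, so it respects infima, the empty one included.\<close>

lemma le_mult_Inf_ennreal:
  fixes X :: ennreal
  assumes "0 < k" "\<And>d. d \<in> S \<Longrightarrow> X \<le> ennreal k * d"
  shows "X \<le> ennreal k * Inf S"
proof -
  have k: "ennreal k * (ennreal (inverse k) * Y) = Y" "ennreal (inverse k) * (ennreal k * Y) = Y" for Y
    using assms(1) by (simp_all add: mult.assoc[symmetric] ennreal_mult[symmetric])
  have "ennreal (inverse k) * X \<le> Inf S"
  proof (rule Inf_greatest)
    fix d assume "d \<in> S"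
    from mult_left_mono[OF assms(2)[OF this], of "ennreal (inverse k)"] k
    show "ennreal (inverse k) * X \<le> d" by simp
  qed
  from mult_left_mono[OF this, of "ennreal k"] k show ?thesis by simp
qed

lemma lux_average_scale:
  assumes "0 < k"
  shows "lux_average A Q (\<lambda>x. k * f x) = ennreal k * lux_average A Q f"
proof -
  have le: "lux_average A Q (\<lambda>x. k * f x) \<le> ennreal k * lux_average A Q f" if k: "0 < k" for k f
    unfolding lux_average_def[of A Q f]
  proof (rule le_mult_Inf_ennreal[OF k], clarify)
    fix c :: real assume c: "0 < c" "average Q (\<lambda>y. A (\<bar>f y\<bar> / c)) \<le> 1"
    have "(\<lambda>y. A (\<bar>k * f y\<bar> / (k * c))) = (\<lambda>y. A (\<bar>f y\<bar> / c))"
      using k by (simp add: abs_mult)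
    then have "lux_average A Q (\<lambda>x. k * f x) \<le> ennreal (k * c)"
      unfolding lux_average_def using c k by (intro Inf_lower) auto
    then show "lux_average A Q (\<lambda>x. k * f x) \<le> ennreal k * ennreal c"
      using c k by (simp add: ennreal_mult)
  qed
  have "ennreal k * lux_average A Q f = ennreal k * lux_average A Q (\<lambda>x. inverse k * (k * f x))"
    using assms by (simp add: mult.assoc[symmetric])
  also have "\<dots> \<le> ennreal k * (ennreal (inverse k) * lux_average A Q (\<lambda>x. k * f x))"
    using assms by (intro mult_left_mono le) auto
  also have "\<dots> = lux_average A Q (\<lambda>x. k * f x)"
    using assms by (simp add: mult.assoc[symmetric] ennreal_mult[symmetric])
  finally show ?thesis using le[OF assms] by (intro antisym)
qed

lemma orlicz_maximal_scale:
  assumes "0 < k"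
  shows "orlicz_maximal \<rho> A \<sigma> (\<lambda>x. k * f x) x = ennreal k * orlicz_maximal \<rho> A \<sigma> f x"
  unfolding orlicz_maximal_def lux_average_scale[OF assms] SUP_mult_left_ennreal
  by (intro SUP_cong) (auto simp: mult_ac)

lemma average_const_1:
  fixes x0 :: "real ^ 'n"
  assumes "0 < r" shows "average (cube x0 r) (\<lambda>_. 1) = 1"
  using assms by (simp add: average_def emeasure_cube ennreal_divide_self)

text \<open>Averages of 1 are 1 and exponent 0 removes the penalty. The choice
  \<open>\<theta> = 0\<close>, \<open>w = 1\<close> thus turns the weighted statements into the
  unweighted ones.\<close>

lemma maximal_one:
  fixes \<rho> :: "real ^ 'n \<Rightarrow> real"
  assumes "\<And>x. 0 < \<rho> x" shows "maximal \<rho> 0 (\<lambda>_. 1) = (\<lambda>_. 1)"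
proof
  fix x
  have "(1 + r / \<rho> x0) powr (- 0) = 1" if "0 < r" for r x0
  proof -
    have "0 < r / \<rho> x0" using that assms by simp
    then show ?thesis by simp
  qed
  then have "maximal \<rho> 0 (\<lambda>_. 1) x = (SUP (x0, r)\<in>{(x0, r). 0 < r \<and> x \<in> cube x0 r}. (1::ennreal))"
    unfolding maximal_def by (intro SUP_cong) (auto simp: average_const_1)
  also have "\<dots> = 1"
  proof -
    have "(x, 1) \<in> {(x0, r). 0 < r \<and> x \<in> cube x0 r}" by (simp add: mem_cube)
    then have "{(x0, r). 0 < r \<and> x \<in> cube x0 r} \<noteq> {}" by blast
    then show ?thesis by simp
  qed
  finally show "maximal \<rho> 0 (\<lambda>_. 1) x = 1" .
qed

context integrator
begin

lemma measurable_young_ext [measurable]: "young_ext \<phi> \<in> borel_measurable borel"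
proof -
  have "mono (\<lambda>x. \<phi> (max 0 x))" by (rule monoI) (rule Phi_mono, auto)
  then have [measurable]: "(\<lambda>x. \<phi> (max 0 x)) \<in> borel_measurable borel" by (rule borel_measurable_mono)
  have "(\<lambda>t. if t = \<infinity> then \<infinity> else ennreal (\<phi> (max 0 (enn2real t)))) \<in> borel_measurable borel"
    by (intro measurable_If) measurable
  moreover have "young_ext \<phi> = (\<lambda>t. if t = \<infinity> then \<infinity> else ennreal (\<phi> (max 0 (enn2real t))))"
    by (simp add: fun_eq_iff young_ext_def max_absorb2)
  ultimately show ?thesis by (simp only:)
qed

lemma young_ext_scale:
  assumes "young_function \<phi>" "0 < u" "u \<le> 1"
  shows "young_ext \<phi> (ennreal u * g) \<le> ennreal u * young_ext \<phi> g"
proof (cases g)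
  case (real r)
  then have "young_ext \<phi> (ennreal u * g) = ennreal (\<phi> (u * r))"
    using assms by (simp add: ennreal_mult[symmetric] young_ext_ennreal)
  also have "\<dots> \<le> ennreal (u * \<phi> r)"
    using young_scale[OF assms(1), of r u] assms real by (intro ennreal_leI) auto
  also have "\<dots> = ennreal u * young_ext \<phi> g" using assms real by (simp add: ennreal_mult' young_ext_ennreal)
  finally show ?thesis .
next
  case top
  then show ?thesis using assms by (simp add: young_ext_def ennreal_mult_top)
qed

end

section \<open>Norm inequalities and specialisation to constant weight\<close>

lemma modular_mono:
  assumes "integrator a \<Phi>" "\<And>x. g x \<le> h x"
  shows "modular \<Phi> w g \<le> modular \<Phi> w h"
  unfolding modular_def using integrator.young_ext_mono[OF assms(1) assms(2)]
  by (intro nn_integral_mono mult_right_mono) auto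

context dini_setting
begin

lemma modular_bound_mono:
  assumes "0 \<le> A" "A \<le> C" "B \<le> C"
  shows "ennreal A * modular \<psi> v (\<lambda>x. ennreal (B * \<bar>f x\<bar>)) \<le> ennreal C * modular \<psi> v (\<lambda>x. ennreal (C * \<bar>f x\<bar>))"
proof (rule mult_mono)
  show "modular \<psi> v (\<lambda>x. ennreal (B * \<bar>f x\<bar>)) \<le> modular \<psi> v (\<lambda>x. ennreal (C * \<bar>f x\<bar>))"
    by (rule modular_mono[OF psi.integrator_axioms]) (rule ennreal_leI, rule mult_right_mono, use assms in auto)
qed (use assms ennreal_leI in auto)

text \<open>Homogeneity of \<open>T\<close> allows the modular inequality to be applied to a
  rescaled function, for which it yields the bound \<open>C\<close>. Convexity of
  \<open>\<phi>\<close> then lowers \<open>C\<close> to 1 at the price of a second factor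
  \<open>C\<close> in the norm.\<close>

lemma modular_imp_norm:
  fixes T :: "(real ^ 'n \<Rightarrow> real) \<Rightarrow> real ^ 'n \<Rightarrow> ennreal"
  assumes hom: "\<And>k f x. 0 < k \<Longrightarrow> T (\<lambda>x. k * f x) x = ennreal k * T f x"
    and meas: "\<And>f. T f \<in> borel_measurable lebesgue" "w \<in> borel_measurable lebesgue"
    and C: "1 \<le> C"
    and ineq: "\<And>g. g \<in> orlicz_space \<psi> v \<Longrightarrow>
      modular \<phi> w (T g) \<le> ennreal C * modular \<psi> v (\<lambda>x. ennreal (C * \<bar>g x\<bar>))"
    and f: "f \<in> orlicz_space \<psi> v"
  shows "lux_norm \<phi> w (T f) \<le> ennreal (C * C) * lux_norm \<psi> v (\<lambda>x. ennreal \<bar>f x\<bar>)"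
  unfolding lux_norm_def[of \<psi>]
proof (rule le_mult_Inf_ennreal, use C in simp, clarify)
  fix d :: real
  assume d: "0 < d" "modular \<psi> v (\<lambda>x. ennreal \<bar>f x\<bar> / ennreal d) \<le> 1"
  \<comment> \<open>The part \<open>1 / d\<close> normalises the modular of \<open>f\<close>, and
    \<open>1 / C\<close> cancels the constant inside \<open>\<psi>\<close>.\<close>
  define k where "k = inverse (C * d)"
  have k: "0 < k" using C d by (simp add: k_def)
  define g where "g x = k * f x" for x
  obtain c where c: "0 < c" "modular \<psi> v (\<lambda>x. ennreal (\<bar>f x\<bar> / c)) < \<infinity>" and fm: "f \<in> borel_measurable lebesgue"
    using f unfolding orlicz_space_def by auto
  have "g \<in> orlicz_space \<psi> v"
  proof -
    have "(\<lambda>x. ennreal (\<bar>g x\<bar> / (k * c))) = (\<lambda>x. ennreal (\<bar>f x\<bar> / c))"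
      using k by (simp add: g_def abs_mult)
    moreover have "g \<in> borel_measurable lebesgue" unfolding g_def using fm by simp
    ultimately show ?thesis unfolding orlicz_space_def using c k
      by (auto intro!: exI[of _ "k * c"])
  qed
  note ineq[OF this]
  also have "modular \<psi> v (\<lambda>x. ennreal (C * \<bar>g x\<bar>)) = modular \<psi> v (\<lambda>x. ennreal \<bar>f x\<bar> / ennreal d)"
    using C d by (simp add: g_def k_def abs_mult divide_ennreal field_simps)
  also have "ennreal C * \<dots> \<le> ennreal C * 1" by (intro mult_left_mono d) auto
  finally have le: "modular \<phi> w (T g) \<le> ennreal C" by simp
  have iC: "0 < inverse C" "inverse C \<le> 1" using C by (auto simp: field_simps)
  have "modular \<phi> w (\<lambda>x. T f x / ennreal (C * C * d)) = modular \<phi> w (\<lambda>x. ennreal (inverse C) * T g x)"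
  proof -
    have "T f x / ennreal (C * C * d) = ennreal (inverse C) * T g x" for x
    proof -
      have "T f x / ennreal (C * C * d) = T f x * ennreal (inverse (C * C * d))"
        using C d by (simp add: divide_ennreal_def inverse_ennreal)
      also have "ennreal (inverse (C * C * d)) = ennreal (inverse C * k)"
        by (simp add: k_def mult_ac)
      also have "\<dots> = ennreal (inverse C) * ennreal k" using iC k by (intro ennreal_mult) auto
      finally show ?thesis using hom[OF k, of f x] by (simp add: g_def[abs_def] mult_ac)
    qed
    then show ?thesis by simp
  qed
  also have "\<dots> \<le> (\<integral>\<^sup>+x. ennreal (inverse C) * (young_ext \<phi> (T g x) * w x) \<partial>lebesgue)"
    unfolding modular_def
    by (intro nn_integral_mono)
      (use phi.young_ext_scale[OF phi_young iC] in \<open>auto simp: mult.assoc[symmetric] intro!: mult_right_mono\<close>)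
  also have "\<dots> = ennreal (inverse C) * modular \<phi> w (T g)"
  proof -
    have [measurable]: "T g \<in> borel_measurable lebesgue" "w \<in> borel_measurable lebesgue"
      "young_ext \<phi> \<in> borel_measurable borel"
      by (rule meas phi.measurable_young_ext)+
    show ?thesis unfolding modular_def by (intro nn_integral_cmult) measurable
  qed
  also have "\<dots> \<le> ennreal (inverse C) * ennreal C" by (intro mult_left_mono le) auto
  also have "\<dots> = 1" using C by (simp add: ennreal_mult[symmetric])
  finally have "lux_norm \<phi> w (T f) \<le> ennreal (C * C * d)"
    unfolding lux_norm_def using C d by (intro Inf_lower) auto
  then show "lux_norm \<phi> w (T f) \<le> ennreal (C * C) * ennreal d"
    using C d by (simp add: ennreal_mult)
qed

text \<open>Formulated for all measurable functions, not just members of the Orlicz space, because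
  (e) applies it to a multiple of \<open>f / u\<close>. A single \<open>C \<ge> 1\<close> collects
  the constants outside and inside \<open>\<psi>\<close>.\<close>

lemma dini_imp_strong:
  fixes \<rho> :: "real ^ 'n \<Rightarrow> real"
  assumes dini: "dini_condition \<eta> a b" and \<rho>: "\<And>x. 0 < \<rho> x" and \<theta>: "0 \<le> \<theta>"
  shows "\<exists>C\<ge>1. \<forall>w\<in>nonneg_measurable. \<forall>f\<in>borel_measurable lebesgue.
    modular \<phi> (\<lambda>x. ennreal (w x)) (orlicz_maximal \<rho> (\<lambda>t. ennreal (\<eta> t)) \<theta> f)
    \<le> ennreal C * modular \<psi> (maximal \<rho> \<theta> w) (\<lambda>x. ennreal (C * \<bar>f x\<bar>))"
proof -
  obtain C0 where C0: "0 < C0" "\<And>t. 0 < t \<Longrightarrow> (\<integral>\<^sup>+s\<in>{0<..t}. ennreal (a s * \<eta> (t / s)) \<partial>lborel) \<le> ennreal (C0 * \<psi> (C0 * t))"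
    using dini_imp_primitive[OF dini] unfolding dini_primitive_condition_def by blast
  define A where "A = (5 * sqrt CARD('n)) ^ CARD('n) * (5 * sqrt CARD('n)) powr \<theta> * C0"
  define C where "C = Max {1, A, 2 * C0}"
  have C: "1 \<le> C" "A \<le> C" "2 * C0 \<le> C" by (auto simp: C_def)
  show ?thesis
  proof (rule exI[of _ C], rule conjI, rule C(1), intro ballI)
    fix w f :: "real ^ 'n \<Rightarrow> real" assume wf: "w \<in> nonneg_measurable" "f \<in> borel_measurable lebesgue"
    have "modular \<phi> (\<lambda>x. ennreal (w x)) (orlicz_maximal \<rho> (\<lambda>t. ennreal (\<eta> t)) \<theta> f)
      \<le> ennreal A * modular \<psi> (maximal \<rho> \<theta> w) (\<lambda>x. ennreal (2 * C0 * \<bar>f x\<bar>))"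
      unfolding A_def by (rule strong_type[OF \<rho> \<theta> wf(2,1) C0])
    also have "\<dots> \<le> ennreal C * modular \<psi> (maximal \<rho> \<theta> w) (\<lambda>x. ennreal (C * \<bar>f x\<bar>))"
      using C C0(1) by (intro modular_bound_mono) (auto simp: A_def)
    finally show "modular \<phi> (\<lambda>x. ennreal (w x)) (orlicz_maximal \<rho> (\<lambda>t. ennreal (\<eta> t)) \<theta> f)
      \<le> ennreal C * modular \<psi> (maximal \<rho> \<theta> w) (\<lambda>x. ennreal (C * \<bar>f x\<bar>))" .
  qed
qed

lemma dini_imp_weighted_modular:
  fixes \<rho> :: "real ^ 'n \<Rightarrow> real"
  assumes dini: "dini_condition \<eta> a b" and \<rho>: "\<And>x. 0 < \<rho> x"
  shows "weighted_modular_inequality \<rho> \<eta> \<phi> \<psi>"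
  unfolding weighted_modular_inequality_def
proof (intro allI impI)
  fix \<theta> :: real assume \<theta>: "0 \<le> \<theta>"
  obtain C where C: "1 \<le> C" "\<forall>w\<in>nonneg_measurable. \<forall>f\<in>borel_measurable lebesgue.
    modular \<phi> (\<lambda>x. ennreal (w x)) (orlicz_maximal \<rho> (\<lambda>t. ennreal (\<eta> t)) \<theta> f)
    \<le> ennreal C * modular \<psi> (maximal \<rho> \<theta> w) (\<lambda>x. ennreal (C * \<bar>f x\<bar>))"
    using dini_imp_strong[of \<rho>, OF dini \<rho> \<theta>] by blast
  show "\<exists>C\<ge>0. \<exists>\<sigma>\<ge>0. \<forall>w\<in>nonneg_measurable. \<forall>f\<in>orlicz_space \<psi> (maximal \<rho> \<theta> w).
          modular \<phi> (\<lambda>x. ennreal (w x)) (orlicz_maximal \<rho> (\<lambda>t. ennreal (\<eta> t)) \<sigma> f)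
          \<le> ennreal C * modular \<psi> (maximal \<rho> \<theta> w) (\<lambda>x. ennreal (C * \<bar>f x\<bar>))"
  proof (rule exI[of _ C], rule conjI, use C in simp, rule exI[of _ \<theta>], rule conjI, rule \<theta>, intro ballI)
    fix w f :: "real ^ 'n \<Rightarrow> real" assume "w \<in> nonneg_measurable" "f \<in> orlicz_space \<psi> (maximal \<rho> \<theta> w)"
    then show "modular \<phi> (\<lambda>x. ennreal (w x)) (orlicz_maximal \<rho> (\<lambda>t. ennreal (\<eta> t)) \<theta> f)
          \<le> ennreal C * modular \<psi> (maximal \<rho> \<theta> w) (\<lambda>x. ennreal (C * \<bar>f x\<bar>))"
      using C(2) by (simp add: orlicz_space_def)
  qed
qed

lemma nonneg_measurable_ennreal: "w \<in> nonneg_measurable \<Longrightarrow> (\<lambda>x. ennreal (w x)) \<in> borel_measurable lebesgue"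
  by (auto simp: nonneg_measurable_def)

lemma measurable_orlicz_maximal_eta:
  fixes \<rho> :: "real ^ 'n \<Rightarrow> real"
  assumes "\<And>x. 0 < \<rho> x"
  shows "orlicz_maximal \<rho> (\<lambda>t. ennreal (\<eta> t)) \<sigma> f \<in> borel_measurable lebesgue"
  using assms by (intro lebesgue_measurable_borel borel_measurable_orlicz_maximal mono_on_young_ennreal \<eta>)

lemma weighted_modular_imp_weighted_norm:
  fixes \<rho> :: "real ^ 'n \<Rightarrow> real"
  assumes wm: "weighted_modular_inequality \<rho> \<eta> \<phi> \<psi>" and \<rho>: "\<And>x. 0 < \<rho> x"
  shows "weighted_norm_inequality \<rho> \<eta> \<phi> \<psi>"
  unfolding weighted_norm_inequality_def
proof (intro allI impI)
  fix \<theta> :: real assume "0 \<le> \<theta>"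
  then obtain C \<sigma> where C: "0 \<le> C" "0 \<le> \<sigma>" "\<forall>w\<in>nonneg_measurable. \<forall>f\<in>orlicz_space \<psi> (maximal \<rho> \<theta> w).
          modular \<phi> (\<lambda>x. ennreal (w x)) (orlicz_maximal \<rho> (\<lambda>t. ennreal (\<eta> t)) \<sigma> f)
          \<le> ennreal C * modular \<psi> (maximal \<rho> \<theta> w) (\<lambda>x. ennreal (C * \<bar>f x\<bar>))"
    using wm unfolding weighted_modular_inequality_def by blast
  define D where "D = max 1 C"
  have D: "1 \<le> D" "C \<le> D" by (auto simp: D_def)
  show "\<exists>C\<ge>0. \<exists>\<sigma>\<ge>0. \<forall>w\<in>nonneg_measurable. \<forall>f\<in>orlicz_space \<psi> (maximal \<rho> \<theta> w).
          lux_norm \<phi> (\<lambda>x. ennreal (w x)) (orlicz_maximal \<rho> (\<lambda>t. ennreal (\<eta> t)) \<sigma> f)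
          \<le> ennreal C * lux_norm \<psi> (maximal \<rho> \<theta> w) (\<lambda>x. ennreal \<bar>f x\<bar>)"
  proof (rule exI[of _ "D * D"], rule conjI, use D in simp, rule exI[of _ \<sigma>], rule conjI, rule C(2), intro ballI)
    fix w f assume w: "w \<in> nonneg_measurable" and f: "f \<in> orlicz_space \<psi> (maximal \<rho> \<theta> w)"
    show "lux_norm \<phi> (\<lambda>x. ennreal (w x)) (orlicz_maximal \<rho> (\<lambda>t. ennreal (\<eta> t)) \<sigma> f)
          \<le> ennreal (D * D) * lux_norm \<psi> (maximal \<rho> \<theta> w) (\<lambda>x. ennreal \<bar>f x\<bar>)"
    proof (rule modular_imp_norm[OF orlicz_maximal_scale measurable_orlicz_maximal_eta[OF \<rho>] nonneg_measurable_ennreal[OF w] D(1) _ f])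
      fix g assume "g \<in> orlicz_space \<psi> (maximal \<rho> \<theta> w)"
      from C(3)[rule_format, OF w this]
      have "modular \<phi> (\<lambda>x. ennreal (w x)) (orlicz_maximal \<rho> (\<lambda>t. ennreal (\<eta> t)) \<sigma> g)
          \<le> ennreal C * modular \<psi> (maximal \<rho> \<theta> w) (\<lambda>x. ennreal (C * \<bar>g x\<bar>))" .
      also have "\<dots> \<le> ennreal D * modular \<psi> (maximal \<rho> \<theta> w) (\<lambda>x. ennreal (D * \<bar>g x\<bar>))"
        using C(1) D(2) by (intro modular_bound_mono)
      finally show "modular \<phi> (\<lambda>x. ennreal (w x)) (orlicz_maximal \<rho> (\<lambda>t. ennreal (\<eta> t)) \<sigma> g)
          \<le> ennreal D * modular \<psi> (maximal \<rho> \<theta> w) (\<lambda>x. ennreal (D * \<bar>g x\<bar>))" .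
    qed
  qed
qed

lemma modular_imp_norm_unweighted:
  fixes \<rho> :: "real ^ 'n \<Rightarrow> real"
  assumes m: "modular_inequality \<rho> \<eta> \<phi> \<psi>" and \<rho>: "\<And>x. 0 < \<rho> x"
  shows "norm_inequality \<rho> \<eta> \<phi> \<psi>"
proof -
  obtain C \<sigma> where C: "0 \<le> C" "0 \<le> \<sigma>" "\<forall>f\<in>orlicz_space \<psi> (\<lambda>_. 1).
          modular \<phi> (\<lambda>_. 1) (orlicz_maximal \<rho> (\<lambda>t. ennreal (\<eta> t)) \<sigma> f)
          \<le> ennreal C * modular \<psi> (\<lambda>_. 1) (\<lambda>x. ennreal (C * \<bar>f x\<bar>))"
    using m unfolding modular_inequality_def by blast
  define D where "D = max 1 C"
  have D: "1 \<le> D" "C \<le> D" by (auto simp: D_def)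
  show ?thesis unfolding norm_inequality_def
  proof (rule exI[of _ "D * D"], rule conjI, use D in simp, rule exI[of _ \<sigma>], rule conjI, rule C(2), intro ballI)
    fix f :: "real ^ 'n \<Rightarrow> real" assume f: "f \<in> orlicz_space \<psi> (\<lambda>_. 1)"
    show "lux_norm \<phi> (\<lambda>_. 1) (orlicz_maximal \<rho> (\<lambda>t. ennreal (\<eta> t)) \<sigma> f)
          \<le> ennreal (D * D) * lux_norm \<psi> (\<lambda>_. 1) (\<lambda>x. ennreal \<bar>f x\<bar>)"
    proof (rule modular_imp_norm[OF orlicz_maximal_scale measurable_orlicz_maximal_eta[OF \<rho>] _ D(1) _ f])
      fix g :: "real ^ 'n \<Rightarrow> real" assume "g \<in> orlicz_space \<psi> (\<lambda>_. 1)"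
      from C(3)[rule_format, OF this]
      have "modular \<phi> (\<lambda>_. 1) (orlicz_maximal \<rho> (\<lambda>t. ennreal (\<eta> t)) \<sigma> g)
          \<le> ennreal C * modular \<psi> (\<lambda>_. 1) (\<lambda>x. ennreal (C * \<bar>g x\<bar>))" .
      also have "\<dots> \<le> ennreal D * modular \<psi> (\<lambda>_. 1) (\<lambda>x. ennreal (D * \<bar>g x\<bar>))"
        using C(1) D(2) by (intro modular_bound_mono)
      finally show "modular \<phi> (\<lambda>_. 1) (orlicz_maximal \<rho> (\<lambda>t. ennreal (\<eta> t)) \<sigma> g)
          \<le> ennreal D * modular \<psi> (\<lambda>_. 1) (\<lambda>x. ennreal (D * \<bar>g x\<bar>))" .
    qed auto
  qed
qed

lemma weighted_modular_imp_modular: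
  fixes \<rho> :: "real ^ 'n \<Rightarrow> real"
  assumes "weighted_modular_inequality \<rho> \<eta> \<phi> \<psi>" and \<rho>: "\<And>x. 0 < \<rho> x"
  shows "modular_inequality \<rho> \<eta> \<phi> \<psi>"
proof -
  have one: "(\<lambda>_. 1) \<in> nonneg_measurable" by (simp add: nonneg_measurable_def)
  obtain C \<sigma> where C: "0 \<le> C" "0 \<le> \<sigma>" "\<forall>w\<in>nonneg_measurable. \<forall>f\<in>orlicz_space \<psi> (maximal \<rho> 0 w).
          modular \<phi> (\<lambda>x. ennreal (w x)) (orlicz_maximal \<rho> (\<lambda>t. ennreal (\<eta> t)) \<sigma> f)
          \<le> ennreal C * modular \<psi> (maximal \<rho> 0 w) (\<lambda>x. ennreal (C * \<bar>f x\<bar>))"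
    using assms(1)[unfolded weighted_modular_inequality_def, rule_format, OF order_refl] by blast
  show ?thesis unfolding modular_inequality_def
  proof (rule exI[of _ C], rule conjI, rule C(1), rule exI[of _ \<sigma>], rule conjI, rule C(2), intro ballI)
    fix f :: "real ^ 'n \<Rightarrow> real" assume f: "f \<in> orlicz_space \<psi> (\<lambda>_. 1)"
    show "modular \<phi> (\<lambda>_. 1) (orlicz_maximal \<rho> (\<lambda>t. ennreal (\<eta> t)) \<sigma> f)
      \<le> ennreal C * modular \<psi> (\<lambda>_. 1) (\<lambda>x. ennreal (C * \<bar>f x\<bar>))"
      using C(3)[rule_format, OF one, of f] f by (simp add: maximal_one[OF \<rho>])
  qed
qed

lemma weighted_norm_imp_norm:
  fixes \<rho> :: "real ^ 'n \<Rightarrow> real"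
  assumes "weighted_norm_inequality \<rho> \<eta> \<phi> \<psi>" and \<rho>: "\<And>x. 0 < \<rho> x"
  shows "norm_inequality \<rho> \<eta> \<phi> \<psi>"
proof -
  have one: "(\<lambda>_. 1) \<in> nonneg_measurable" by (simp add: nonneg_measurable_def)
  obtain C \<sigma> where C: "0 \<le> C" "0 \<le> \<sigma>" "\<forall>w\<in>nonneg_measurable. \<forall>f\<in>orlicz_space \<psi> (maximal \<rho> 0 w).
          lux_norm \<phi> (\<lambda>x. ennreal (w x)) (orlicz_maximal \<rho> (\<lambda>t. ennreal (\<eta> t)) \<sigma> f)
          \<le> ennreal C * lux_norm \<psi> (maximal \<rho> 0 w) (\<lambda>x. ennreal \<bar>f x\<bar>)"
    using assms(1)[unfolded weighted_norm_inequality_def, rule_format, OF order_refl] by blast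
  show ?thesis unfolding norm_inequality_def
  \<comment> \<open>The constant in (c) may be 0, while (f) asks for a positive one.\<close>
  proof (rule exI[of _ "C + 1"], rule conjI, use C in simp, rule exI[of _ \<sigma>], rule conjI, rule C(2), intro ballI)
    fix f :: "real ^ 'n \<Rightarrow> real" assume f: "f \<in> orlicz_space \<psi> (\<lambda>_. 1)"
    have "lux_norm \<phi> (\<lambda>_. 1) (orlicz_maximal \<rho> (\<lambda>t. ennreal (\<eta> t)) \<sigma> f)
        \<le> ennreal C * lux_norm \<psi> (\<lambda>_. 1) (\<lambda>x. ennreal \<bar>f x\<bar>)"
      using C(3)[rule_format, OF one, of f] f by (simp add: maximal_one[OF \<rho>])
    also have "\<dots> \<le> ennreal (C + 1) * lux_norm \<psi> (\<lambda>_. 1) (\<lambda>x. ennreal \<bar>f x\<bar>)"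
      by (intro mult_right_mono ennreal_leI) auto
    finally show "lux_norm \<phi> (\<lambda>_. 1) (orlicz_maximal \<rho> (\<lambda>t. ennreal (\<eta> t)) \<sigma> f)
        \<le> ennreal (C + 1) * lux_norm \<psi> (\<lambda>_. 1) (\<lambda>x. ennreal \<bar>f x\<bar>)" .
  qed
qed

end

section \<open>Generalized Hoelder inequality\<close>

lemma average_add:
  fixes Q :: "(real ^ 'n) set"
  assumes "Q \<in> sets lebesgue" "F \<in> borel_measurable lebesgue" "G \<in> borel_measurable lebesgue"
  shows "average Q (\<lambda>y. F y + G y) = average Q F + average Q G"
proof -
  have [measurable]: "Q \<in> sets lebesgue" "F \<in> borel_measurable lebesgue" "G \<in> borel_measurable lebesgue" by fact+
  have "(\<integral>\<^sup>+y\<in>Q. F y + G y \<partial>lebesgue) = (\<integral>\<^sup>+y. F y * indicator Q y + G y * indicator Q y \<partial>lebesgue)"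
    by (simp add: distrib_right)
  also have "\<dots> = (\<integral>\<^sup>+y\<in>Q. F y \<partial>lebesgue) + (\<integral>\<^sup>+y\<in>Q. G y \<partial>lebesgue)"
    by (rule nn_integral_add) measurable
  finally show ?thesis by (simp add: average_def divide_ennreal_def distrib_right)
qed

lemma average_cmult:
  fixes Q :: "(real ^ 'n) set"
  assumes "Q \<in> sets lebesgue" "F \<in> borel_measurable lebesgue"
  shows "average Q (\<lambda>y. c * F y) = c * average Q F"
proof -
  have [measurable]: "Q \<in> sets lebesgue" "F \<in> borel_measurable lebesgue" by fact+
  have "(\<integral>\<^sup>+y\<in>Q. c * F y \<partial>lebesgue) = (\<integral>\<^sup>+y. c * (F y * indicator Q y) \<partial>lebesgue)"
    by (simp add: mult.assoc)
  also have "\<dots> = c * (\<integral>\<^sup>+y\<in>Q. F y \<partial>lebesgue)"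
    by (rule nn_integral_cmult) measurable
  finally show ?thesis by (simp add: average_def divide_ennreal_def mult.assoc)
qed

lemma average_eq_0_iff:
  fixes x0 :: "real ^ 'n"
  assumes "0 < r" "F \<in> borel_measurable lebesgue"
  shows "average (cube x0 r) F = 0 \<longleftrightarrow> (AE y in lebesgue. y \<in> cube x0 r \<longrightarrow> F y = 0)"
proof -
  have [measurable]: "cube x0 r \<in> sets lebesgue" "F \<in> borel_measurable lebesgue" using assms(2) by auto
  have "0 < (2 * (r / sqrt CARD('n))) ^ CARD('n)" using assms(1) by simp
  then have "average (cube x0 r) F = 0 \<longleftrightarrow> (\<integral>\<^sup>+y\<in>cube x0 r. F y \<partial>lebesgue) = 0"
    using assms(1) by (simp add: average_def emeasure_cube)
  also have "\<dots> \<longleftrightarrow> (AE y in lebesgue. F y * indicator (cube x0 r) y = 0)"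
    by (rule nn_integral_0_iff_AE) measurable
  also have "\<dots> \<longleftrightarrow> (AE y in lebesgue. y \<in> cube x0 r \<longrightarrow> F y = 0)"
    by (intro AE_cong) (auto simp: indicator_def)
  finally show ?thesis .
qed

lemma young_inequality:
  assumes "0 \<le> s"
  shows "ennreal (s * t) \<le> ennreal (\<eta> s) + complementary \<eta> t"
proof -
  have "ennreal (s * t) \<le> ennreal (\<eta> s) + ennreal (s * t - \<eta> s)"
  proof (cases "\<eta> s \<le> s * t \<and> 0 \<le> \<eta> s")
    case True
    then show ?thesis by (simp add: ennreal_plus[symmetric] del: ennreal_plus)
  next
    case False
    then consider "s * t < \<eta> s" | "\<eta> s < 0" by linarith
    then show ?thesis
    proof cases
      case 1
      then have "ennreal (s * t) \<le> ennreal (\<eta> s)" by (intro ennreal_leI) simp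
      then show ?thesis by (rule order_trans) simp
    next
      case 2
      then have "ennreal (s * t) \<le> ennreal (s * t - \<eta> s)" by (intro ennreal_leI) simp
      then show ?thesis by (rule order_trans) simp
    qed
  qed
  also have "ennreal (s * t - \<eta> s) \<le> complementary \<eta> t"
    unfolding complementary_def using assms by (intro SUP_upper) simp
  finally show ?thesis by (simp add: add_left_mono)
qed

text \<open>For \<open>s \<le> p\<close> the term \<open>s * (z / p)\<close> is at most
  \<open>z\<close>. For \<open>s > p\<close> convexity gives
  \<open>\<eta> s / s \<ge> \<eta> p / p \<ge> z / p\<close>, so the difference is not
  positive.\<close>

lemma complementary_slope_le:
  assumes \<eta>: "young_function \<eta>" and p: "0 < p" and z: "0 \<le> z" "z \<le> \<eta> p"
  shows "complementary \<eta> (z / p) \<le> ennreal z"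
  unfolding complementary_def
proof (rule SUP_least)
  fix s :: real assume "s \<in> {0..}"
  then have s: "0 \<le> s" by simp
  have "s * (z / p) - \<eta> s \<le> z"
  proof (cases "s \<le> p")
    case True
    have "s * (z / p) \<le> p * (z / p)" using True z p by (intro mult_right_mono) auto
    then show ?thesis using young_nonneg[OF \<eta> s] p by simp
  next
    case False
    have "\<eta> ((p / s) * s) \<le> (p / s) * \<eta> s"
      using False p s by (intro young_scale[OF \<eta>]) auto
    then have "z \<le> (p / s) * \<eta> s" using z False p by simp
    then have "s * (z / p) \<le> s * (((p / s) * \<eta> s) / p)"
      using p s by (intro mult_left_mono divide_right_mono) auto
    then have "s * (z / p) \<le> \<eta> s" using False p by simp
    then show ?thesis using z by simp
  qed
  then show "ennreal (s * (z / p) - \<eta> s) \<le> ennreal z" by (rule ennreal_leI)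
qed

text \<open>This is Young's inequality at admissible levels \<open>c\<close> and \<open>d\<close>,
  averaged over \<open>Q\<close>: each side contributes at most 1, whence the factor 2.\<close>

lemma average_product_le:
  fixes g u :: "real ^ 'n \<Rightarrow> real"
  assumes \<eta>: "young_function \<eta>" "continuous_on {0..} \<eta>"
    and m: "g \<in> borel_measurable lebesgue" "u \<in> borel_measurable lebesgue" "Q \<in> sets lebesgue"
    and c: "0 < c" "average Q (\<lambda>y. ennreal (\<eta> (\<bar>g y\<bar> / c))) \<le> 1"
    and d: "0 < d" "average Q (\<lambda>y. complementary \<eta> (\<bar>u y\<bar> / d)) \<le> 1"
  shows "average Q (\<lambda>y. ennreal \<bar>g y * u y\<bar>) \<le> ennreal (2 * c) * ennreal d"
proof -
  have [measurable]: "g \<in> borel_measurable lebesgue" "u \<in> borel_measurable lebesgue" by fact+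
  define F where "F y = ennreal (\<eta> (\<bar>g y\<bar> / c))" for y
  define P where "P y = ennreal ((\<bar>g y\<bar> / c) * (\<bar>u y\<bar> / d))" for y
  have [measurable]: "F \<in> borel_measurable lebesgue"
  proof -
    have [measurable]: "(\<lambda>x. \<eta> (max 0 x)) \<in> borel_measurable borel"
      by (rule borel_measurable_truncate[OF \<eta>(2)])
    have "(\<lambda>y. ennreal (\<eta> (max 0 (\<bar>g y\<bar> / c)))) \<in> borel_measurable lebesgue" by measurable
    then show ?thesis using c by (simp add: F_def[abs_def] max_absorb2)
  qed
  have [measurable]: "P \<in> borel_measurable lebesgue" unfolding P_def by measurable
  have PF: "P y \<le> F y + (P y - F y)" for y
  proof (cases "F y \<le> P y")
    case True
    from diff_add_cancel_ennreal[OF this] show ?thesis by (metis add.commute order_refl)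
  next
    case False
    then have "P y \<le> F y" by simp
    then show ?thesis by (rule order_trans) simp
  qed
  \<comment> \<open>Additivity of the integral is used for the measurable pair \<open>F\<close> and
    \<open>P - F\<close>; the complementary function enters afterwards, by monotonicity
    alone.\<close>
  have "average Q P \<le> average Q (\<lambda>y. F y + (P y - F y))"
    by (rule average_mono) (rule PF)
  also have "\<dots> = average Q F + average Q (\<lambda>y. P y - F y)"
    by (rule average_add) (use m in measurable)
  also have "average Q (\<lambda>y. P y - F y) \<le> average Q (\<lambda>y. complementary \<eta> (\<bar>u y\<bar> / d))"
  proof (rule average_mono)
    fix y
    show "P y - F y \<le> complementary \<eta> (\<bar>u y\<bar> / d)"
      unfolding ennreal_minus_le_iff
      using young_inequality[of "\<bar>g y\<bar> / c" "\<bar>u y\<bar> / d" \<eta>] c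
      by (auto simp: P_def F_def)
  qed
  finally have "average Q P \<le> average Q F + average Q (\<lambda>y. complementary \<eta> (\<bar>u y\<bar> / d))"
    by (simp add: add_left_mono)
  also have "\<dots> \<le> 1 + 1" using c d by (intro add_mono) (simp_all add: F_def[abs_def])
  finally have P2: "average Q P \<le> 2" by simp
  have eq: "ennreal \<bar>g y * u y\<bar> = ennreal (c * d) * P y" for y
    using c d unfolding P_def by (subst ennreal_mult[symmetric]) (auto simp: abs_mult)
  have "average Q (\<lambda>y. ennreal \<bar>g y * u y\<bar>) = ennreal (c * d) * average Q P"
    unfolding eq by (rule average_cmult) (use m in measurable)
  also have "\<dots> \<le> ennreal (c * d) * ennreal 2" using P2 by (intro mult_left_mono) auto
  also have "\<dots> = ennreal (c * d * 2)" using c d by (intro ennreal_mult[symmetric]) auto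
  also have "c * d * 2 = (2 * c) * d" by simp
  also have "ennreal \<dots> = ennreal (2 * c) * ennreal d" using c d by (intro ennreal_mult) auto
  finally show ?thesis .
qed

lemma average_ae_cong:
  assumes "AE y in lebesgue. F y = G y"
  shows "average Q F = average Q G"
  unfolding average_def using assms by (subst nn_integral_cong_AE[of _ "\<lambda>y. G y * indicator Q y"]) auto

text \<open>Passing to the infimum over both levels is safe unless the product is of the form 0
  times infinity. If one Luxemburg average is 0, that function vanishes almost everywhere on the
  cube, and so does the product.\<close>

lemma generalized_hoelder:
  fixes g u :: "real ^ 'n \<Rightarrow> real"
  assumes \<eta>: "young_function \<eta>" "normalized \<eta>" "continuous_on {0..} \<eta>"
    and m: "g \<in> borel_measurable lebesgue" "u \<in> borel_measurable lebesgue" and r: "0 < r"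
  shows "average (cube x0 r) (\<lambda>y. ennreal \<bar>g y * u y\<bar>)
    \<le> 2 * (lux_average (\<lambda>t. ennreal (\<eta> t)) (cube x0 r) g * lux_average (complementary \<eta>) (cube x0 r) u)"
proof -
  define Q where "Q = cube x0 r"
  define G where "G = lux_average (\<lambda>t. ennreal (\<eta> t)) Q g"
  define U where "U = lux_average (complementary \<eta>) Q u"
  have [measurable]: "Q \<in> sets lebesgue" "g \<in> borel_measurable lebesgue" "u \<in> borel_measurable lebesgue"
    using m by (auto simp: Q_def)
  have Q1: "average Q (\<lambda>_. 1) = 1" using r by (simp add: Q_def average_const_1)
  have gG: "average Q (\<lambda>y. ennreal \<bar>g y * h y\<bar>) \<le> ennreal (2 * d) * G"
    if "h \<in> borel_measurable lebesgue" "0 < d" "average Q (\<lambda>y. complementary \<eta> (\<bar>h y\<bar> / d)) \<le> 1" for h d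
    unfolding G_def lux_average_def
  proof (rule le_mult_Inf_ennreal, use that in simp, clarify)
    fix c :: real assume c: "0 < c" "average Q (\<lambda>y. ennreal (\<eta> (\<bar>g y\<bar> / c))) \<le> 1"
    have "average Q (\<lambda>y. ennreal \<bar>g y * h y\<bar>) \<le> ennreal (2 * c) * ennreal d"
      by (rule average_product_le[OF \<eta>(1,3) m(1) that(1) _ c that(2,3)]) measurable
    also have "\<dots> = ennreal (2 * d) * ennreal c"
      using c that by (simp add: ennreal_mult mult_ac)
    finally show "average Q (\<lambda>y. ennreal \<bar>g y * h y\<bar>) \<le> ennreal (2 * d) * ennreal c" .
  qed
  have uU: "average Q (\<lambda>y. ennreal \<bar>h y * u y\<bar>) \<le> ennreal (2 * c) * U"
    if "h \<in> borel_measurable lebesgue" "0 < c" "average Q (\<lambda>y. ennreal (\<eta> (\<bar>h y\<bar> / c))) \<le> 1" for h c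
    unfolding U_def lux_average_def
  proof (rule le_mult_Inf_ennreal, use that in simp, clarify)
    fix d :: real assume d: "0 < d" "average Q (\<lambda>y. complementary \<eta> (\<bar>u y\<bar> / d)) \<le> 1"
    show "average Q (\<lambda>y. ennreal \<bar>h y * u y\<bar>) \<le> ennreal (2 * c) * ennreal d"
      by (rule average_product_le[OF \<eta>(1,3) that(1) m(2) _ that(2,3) d]) measurable
  qed
  \<comment> \<open>The constant 1 is admissible at level 1 for the complementary function and,
    below, for \<open>\<eta>\<close>, by normalisation. Pairing with it bounds ordinary averages by
    Luxemburg averages.\<close>
  have "average Q (\<lambda>y. complementary \<eta> (\<bar>1\<bar> / 1)) \<le> average Q (\<lambda>_. 1)"
    using complementary_slope_le[OF \<eta>(1), of 1 1] \<eta>(2)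
    by (intro average_mono) (simp add: normalized_def)
  then have g1: "average Q (\<lambda>y. ennreal \<bar>g y\<bar>) \<le> ennreal 2 * G"
    using gG[of "\<lambda>_. 1" 1] by (simp add: Q1)
  have "average Q (\<lambda>y. ennreal (\<eta> (\<bar>1\<bar> / 1))) \<le> 1"
    using \<eta>(2) Q1 by (simp add: normalized_def)
  then have u1: "average Q (\<lambda>y. ennreal \<bar>u y\<bar>) \<le> ennreal 2 * U"
    using uU[of "\<lambda>_. 1" 1] by simp
  have zero: "average Q (\<lambda>y. ennreal \<bar>g y * u y\<bar>) = 0"
    if "average Q (\<lambda>y. ennreal \<bar>g y\<bar>) = 0 \<or> average Q (\<lambda>y. ennreal \<bar>u y\<bar>) = 0"
    using that unfolding Q_def
    by (subst (asm) (1 2) average_eq_0_iff, use r m in simp_all, subst average_eq_0_iff)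
      (use r m in \<open>auto elim!: eventually_mono\<close>)
  have "average Q (\<lambda>y. ennreal \<bar>g y * u y\<bar>) \<le> 2 * (G * U)"
  proof (cases "G = 0 \<or> U = 0")
    case True
    then show ?thesis using zero g1 u1 by auto
  next
    case nz: False
    show ?thesis
    proof (cases "G = \<infinity> \<or> U = \<infinity>")
      case True
      then have "2 * (G * U) = \<infinity>" using nz by (auto simp: ennreal_mult_top ennreal_top_mult)
      then show ?thesis by simp
    next
      case False
      then obtain G' where G': "G = ennreal G'" "0 < G'" using nz by (cases G) auto
      have "average Q (\<lambda>y. ennreal \<bar>g y * u y\<bar>) \<le> ennreal (2 * G') * U"
        unfolding U_def lux_average_def
      proof (rule le_mult_Inf_ennreal, use G' in simp, clarify)
        fix d :: real assume d: "0 < d" "average Q (\<lambda>y. complementary \<eta> (\<bar>u y\<bar> / d)) \<le> 1"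
        have "average Q (\<lambda>y. ennreal \<bar>g y * u y\<bar>) \<le> ennreal (2 * d) * G" by (rule gG[OF m(2) d])
        also have "\<dots> = ennreal (2 * G') * ennreal d" using d G' by (simp add: ennreal_mult mult_ac)
        finally show "average Q (\<lambda>y. ennreal \<bar>g y * u y\<bar>) \<le> ennreal (2 * G') * ennreal d" .
      qed
      also have "\<dots> = 2 * (G * U)" using G' by (simp add: ennreal_mult mult_ac)
      finally show ?thesis .
    qed
  qed
  then show ?thesis by (simp add: Q_def G_def U_def)
qed

text \<open>The exponent \<open>- \<gamma>\<close> splits as \<open>- \<sigma>\<close> plus
  \<open>- (\<gamma> - \<sigma>)\<close>, so each cube distributes its penalty over the two factors.
  The factorisation is almost everywhere, since \<open>u\<close> may vanish on a null set where
  \<open>f\<close> does not.\<close>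

lemma maximal_product_le:
  fixes g u :: "real ^ 'n \<Rightarrow> real"
  assumes \<eta>: "young_function \<eta>" "normalized \<eta>" "continuous_on {0..} \<eta>"
    and m: "g \<in> borel_measurable lebesgue" "u \<in> borel_measurable lebesgue"
    and f: "AE y in lebesgue. f y = g y * u y"
  shows "maximal \<rho> \<gamma> f x \<le> 2 * (orlicz_maximal \<rho> (\<lambda>t. ennreal (\<eta> t)) \<sigma> g x * orlicz_maximal \<rho> (complementary \<eta>) (\<gamma> - \<sigma>) u x)"
  unfolding maximal_def
proof (rule SUP_least, clarify)
  fix x0 and r :: real assume r: "0 < r" "x \<in> cube x0 r"
  define s where "s = 1 + r / \<rho> x0"
  define G where "G = lux_average (\<lambda>t. ennreal (\<eta> t)) (cube x0 r) g"
  define U where "U = lux_average (complementary \<eta>) (cube x0 r) u"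
  have "average (cube x0 r) (\<lambda>y. ennreal \<bar>f y\<bar>) = average (cube x0 r) (\<lambda>y. ennreal \<bar>g y * u y\<bar>)"
    using f by (intro average_ae_cong) (auto elim!: eventually_mono)
  also have "\<dots> \<le> 2 * (G * U)"
    unfolding G_def U_def by (rule generalized_hoelder[OF \<eta> m r(1)])
  finally have av: "average (cube x0 r) (\<lambda>y. ennreal \<bar>f y\<bar>) \<le> 2 * (G * U)" .
  have "s powr (- \<gamma>) = s powr (- \<sigma>) * s powr (- (\<gamma> - \<sigma>))"
    by (simp add: powr_add[symmetric])
  then have "ennreal (s powr (- \<gamma>)) * average (cube x0 r) (\<lambda>y. ennreal \<bar>f y\<bar>)
    \<le> ennreal (s powr (- \<sigma>)) * ennreal (s powr (- (\<gamma> - \<sigma>))) * (2 * (G * U))"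
    using av by (simp only: ennreal_mult powr_ge_zero) (intro mult_left_mono, auto)
  also have "\<dots> = 2 * ((ennreal (s powr (- \<sigma>)) * G) * (ennreal (s powr (- (\<gamma> - \<sigma>))) * U))"
    by (simp only: mult_ac)
  also have "\<dots> \<le> 2 * (orlicz_maximal \<rho> (\<lambda>t. ennreal (\<eta> t)) \<sigma> g x * orlicz_maximal \<rho> (complementary \<eta>) (\<gamma> - \<sigma>) u x)"
    unfolding orlicz_maximal_def G_def U_def s_def
    using r by (intro mult_left_mono mult_mono SUP_upper2[of "(x0, r)"]) auto
  finally show "ennreal ((1 + r / \<rho> x0) powr - \<gamma>) * average (cube x0 r) (\<lambda>y. ennreal \<bar>f y\<bar>)
    \<le> 2 * (orlicz_maximal \<rho> (\<lambda>t. ennreal (\<eta> t)) \<sigma> g x * orlicz_maximal \<rho> (complementary \<eta>) (\<gamma> - \<sigma>) u x)"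
    by (simp add: s_def)
qed

text \<open>The conventions cover the extreme cases: \<open>y = 0\<close> forces
  \<open>x = 0\<close>, where \<open>0 / 0 = 0\<close>, and a quotient by \<open>\<infinity>\<close>
  is 0.\<close>

lemma divide_le_of_le_mult_ennreal:
  fixes x y z :: ennreal
  assumes "x \<le> z * y"
  shows "x / y \<le> z"
proof (cases "y = 0 \<or> y = \<infinity>")
  case True
  then show ?thesis using assms by auto
next
  case False
  then show ?thesis using assms by (intro divide_le_posI_ennreal) (auto simp: mult.commute zero_less_iff_neq_zero)
qed

text \<open>Cubes centred at \<open>x\<close> exhaust the space and each carries a positive penalty
  factor. A weight is thus either null almost everywhere or has a maximal function without zeros,
  the dichotomy used in (e).\<close>

lemma maximal_eq_0_imp:
  fixes w :: "real ^ 'n \<Rightarrow> real"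
  assumes \<rho>: "\<And>x. 0 < \<rho> x" and w: "w \<in> borel_measurable lebesgue" and 0: "maximal \<rho> \<theta> w x = 0"
  shows "AE y in lebesgue. w y = 0"
proof -
  have "AE y in lebesgue. y \<in> cube x (real (Suc N)) \<longrightarrow> w y = 0" for N
  proof -
    have "x \<in> cube x (real (Suc N))" by (simp add: mem_cube)
    then have "ennreal ((1 + real (Suc N) / \<rho> x) powr (- \<theta>)) * average (cube x (real (Suc N))) (\<lambda>y. ennreal \<bar>w y\<bar>) \<le> maximal \<rho> \<theta> w x"
      unfolding maximal_def by (intro SUP_upper2[of "(x, real (Suc N))"]) auto
    moreover have "0 < real (Suc N) / \<rho> x" using \<rho> by simp
    then have "0 < (1 + real (Suc N) / \<rho> x) powr (- \<theta>)" by (simp only: powr_gt_zero)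
    ultimately have "average (cube x (real (Suc N))) (\<lambda>y. ennreal \<bar>w y\<bar>) = 0"
      using 0 by (simp del: of_nat_Suc)
    then have "AE y in lebesgue. y \<in> cube x (real (Suc N)) \<longrightarrow> ennreal \<bar>w y\<bar> = 0"
      using w by (subst (asm) average_eq_0_iff) auto
    then show ?thesis by (auto elim!: eventually_mono)
  qed
  then have "AE y in lebesgue. \<forall>N. y \<in> cube x (real (Suc N)) \<longrightarrow> w y = 0"
    by (intro AE_all_countable[THEN iffD2] allI)
  then show ?thesis
  proof eventually_elim
    case (elim y)
    obtain N where "dist x y * sqrt CARD('n) \<le> real N" using real_arch_simple by blast
    then have "sqrt CARD('n) * dist x y \<le> real (Suc N)" by (simp add: mult.commute)
    then have "cube x (sqrt CARD('n) * dist x y) \<subseteq> cube x (real (Suc N))" by (rule cube_mono)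
    moreover have "y \<in> cube x (sqrt CARD('n) * dist x y)" using cball_subset_cube[of x "dist x y"] by auto
    ultimately show ?case using elim by blast
  qed
qed

section \<open>The quotient inequality (e) from (a)\<close>

context dini_setting
begin

text \<open>Hoelder's inequality needs \<open>f = (f / u) * u\<close>, which breaks down where
  \<open>u = 0 < f\<close>. If this happens on a set of positive measure, the right side is
  infinite, unless the weight is null almost everywhere, and then the left side is 0.\<close>

lemma dini_imp_quotient:
  fixes \<rho> :: "real ^ 'n \<Rightarrow> real"
  assumes dini: "dini_condition \<eta> a b" and \<rho>: "\<And>x. 0 < \<rho> x"
  shows "quotient_modular_inequality \<rho> \<eta> \<phi> \<psi>"
  unfolding quotient_modular_inequality_def
proof (intro allI impI)
  fix \<theta> :: real assume \<theta>: "0 \<le> \<theta>"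
  obtain C where C: "1 \<le> C" "\<forall>w\<in>nonneg_measurable. \<forall>f\<in>borel_measurable lebesgue.
    modular \<phi> (\<lambda>x. ennreal (w x)) (orlicz_maximal \<rho> (\<lambda>t. ennreal (\<eta> t)) \<theta> f)
    \<le> ennreal C * modular \<psi> (maximal \<rho> \<theta> w) (\<lambda>x. ennreal (C * \<bar>f x\<bar>))"
    using dini_imp_strong[of \<rho>, OF dini \<rho> \<theta>] by blast
  have main: "modular \<phi> (\<lambda>x. ennreal (w x))
            (\<lambda>x. maximal \<rho> \<gamma> f x / orlicz_maximal \<rho> (complementary \<eta>) (\<gamma> - \<theta>) u x)
          \<le> ennreal (2 * C) *
            modular \<psi> (maximal \<rho> \<theta> w) (\<lambda>x. ennreal (2 * C) * (ennreal (f x) / ennreal (u x)))"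
    if f: "f \<in> nonneg_measurable" and u: "u \<in> nonneg_measurable" and w: "w \<in> nonneg_measurable" for \<gamma> f u w
  proof -
    \<comment> \<open>Real division gives 0 where \<open>u\<close> vanishes, whereas the quotient in
      \<open>ennreal\<close> is infinite there if \<open>f\<close> is positive; \<open>N\<close> is
      the set where the two differ.\<close>
    define g where "g x = f x / u x" for x
    define N where "N = {x. u x = 0 \<and> 0 < f x}"
    have [measurable]: "f \<in> borel_measurable lebesgue" "u \<in> borel_measurable lebesgue" "w \<in> borel_measurable lebesgue"
      using f u w by (auto simp: nonneg_measurable_def)
    have nn: "0 \<le> f x" "0 \<le> u x" for x using f u by (auto simp: nonneg_measurable_def)
    have [measurable]: "g \<in> borel_measurable lebesgue" unfolding g_def by measurable
    have Nm [measurable]: "N \<in> sets lebesgue"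
    proof -
      have "{x\<in>space lebesgue. u x = 0 \<and> 0 < f x} \<in> sets lebesgue" by measurable
      then show ?thesis by (simp add: N_def)
    qed
    consider "emeasure lebesgue N = 0" | "AE y in lebesgue. w y = 0"
      | "emeasure lebesgue N \<noteq> 0" "\<forall>x. maximal \<rho> \<theta> w x \<noteq> 0"
      using maximal_eq_0_imp[of \<rho>, OF \<rho>, of w \<theta>] by auto
    then show ?thesis
    proof cases
      case 1
      then have "N \<in> null_sets lebesgue" by (simp add: null_setsI)
      then have "AE y in lebesgue. y \<notin> N" by (rule AE_not_in)
      then have ae: "AE y in lebesgue. f y = g y * u y"
      proof eventually_elim
        case (elim y)
        then show ?case using nn[of y] by (auto simp: N_def g_def)
      qed
      \<comment> \<open>The factor 2 of Hoelder's inequality moves into the argument of the operator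
        by homogeneity, and from there into the constant inside \<open>\<psi>\<close>.\<close>
      have "modular \<phi> (\<lambda>x. ennreal (w x)) (\<lambda>x. maximal \<rho> \<gamma> f x / orlicz_maximal \<rho> (complementary \<eta>) (\<gamma> - \<theta>) u x)
        \<le> modular \<phi> (\<lambda>x. ennreal (w x)) (orlicz_maximal \<rho> (\<lambda>t. ennreal (\<eta> t)) \<theta> (\<lambda>x. 2 * g x))"
      proof (rule modular_mono[OF phi.integrator_axioms])
        fix x
        show "maximal \<rho> \<gamma> f x / orlicz_maximal \<rho> (complementary \<eta>) (\<gamma> - \<theta>) u x \<le> orlicz_maximal \<rho> (\<lambda>t. ennreal (\<eta> t)) \<theta> (\<lambda>x. 2 * g x) x"
          using maximal_product_le[OF \<eta>(1,2) eta_cont _ _ ae, of \<rho> \<gamma> x \<theta>]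
          by (intro divide_le_of_le_mult_ennreal) (simp add: orlicz_maximal_scale mult.assoc)
      qed
      also have "\<dots> \<le> ennreal C * modular \<psi> (maximal \<rho> \<theta> w) (\<lambda>x. ennreal (C * \<bar>2 * g x\<bar>))"
        using C(2) w by simp
      also have "\<dots> \<le> ennreal (2 * C) * modular \<psi> (maximal \<rho> \<theta> w) (\<lambda>x. ennreal (2 * C) * (ennreal (f x) / ennreal (u x)))"
      proof (rule mult_mono)
        show "modular \<psi> (maximal \<rho> \<theta> w) (\<lambda>x. ennreal (C * \<bar>2 * g x\<bar>))
          \<le> modular \<psi> (maximal \<rho> \<theta> w) (\<lambda>x. ennreal (2 * C) * (ennreal (f x) / ennreal (u x)))"
        proof (rule modular_mono[OF psi.integrator_axioms])
          fix x
          show "ennreal (C * \<bar>2 * g x\<bar>) \<le> ennreal (2 * C) * (ennreal (f x) / ennreal (u x))"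
          proof (cases "u x = 0")
            case False
            then have "0 < u x" using nn[of x] by simp
            moreover have "C * \<bar>2 * g x\<bar> = 2 * C * (f x / u x)"
              using nn[of x] by (simp add: g_def)
            moreover have "ennreal (2 * C * (f x / u x)) = ennreal (2 * C) * ennreal (f x / u x)"
              using C(1) nn[of x] by (intro ennreal_mult) auto
            ultimately show ?thesis using nn[of x] by (simp only: divide_ennreal)
          qed (simp add: g_def)
        qed
      qed (use C in \<open>auto intro!: ennreal_leI\<close>)
      finally show ?thesis .
    next
      case 2
      then have "modular \<phi> (\<lambda>x. ennreal (w x)) h = 0" for h
      proof -
        have "AE x in lebesgue. young_ext \<phi> (h x) * ennreal (w x) = 0" using 2 by eventually_elim simp
        then have "modular \<phi> (\<lambda>x. ennreal (w x)) h = (\<integral>\<^sup>+x. 0 \<partial>(lebesgue :: (real ^ 'n) measure))"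
          unfolding modular_def by (rule nn_integral_cong_AE)
        then show ?thesis by simp
      qed
      then show ?thesis by simp
    next
      case 3
      have "\<infinity> = \<infinity> * emeasure lebesgue N" using 3 by (simp add: ennreal_top_mult)
      also have "\<dots> = (\<integral>\<^sup>+x. \<infinity> * indicator N x \<partial>lebesgue)" by (rule nn_integral_cmult_indicator[symmetric]) measurable
      also have "\<dots> \<le> modular \<psi> (maximal \<rho> \<theta> w) (\<lambda>x. ennreal (2 * C) * (ennreal (f x) / ennreal (u x)))"
        unfolding modular_def
      proof (rule nn_integral_mono)
        fix x
        show "\<infinity> * indicator N x \<le> young_ext \<psi> (ennreal (2 * C) * (ennreal (f x) / ennreal (u x))) * maximal \<rho> \<theta> w x"
        proof (cases "x \<in> N")
          case True
          then have "ennreal (f x) / ennreal (u x) = \<infinity>" by (simp add: N_def)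
          then have "ennreal (2 * C) * (ennreal (f x) / ennreal (u x)) = \<infinity>"
            using C by (simp add: ennreal_mult_top)
          then show ?thesis using 3(2) by (simp add: young_ext_def ennreal_top_mult)
        qed simp
      qed
      finally have "modular \<psi> (maximal \<rho> \<theta> w) (\<lambda>x. ennreal (2 * C) * (ennreal (f x) / ennreal (u x))) = \<infinity>"
        by (simp add: top_unique)
      then show ?thesis using C by (simp add: ennreal_mult_top)
    qed
  qed
  show "\<exists>C\<ge>0. \<exists>\<sigma>\<ge>0. \<forall>\<gamma>\<ge>\<sigma>.
        \<forall>f\<in>nonneg_measurable. \<forall>u\<in>nonneg_measurable. \<forall>w\<in>nonneg_measurable.
          modular \<phi> (\<lambda>x. ennreal (w x))
            (\<lambda>x. maximal \<rho> \<gamma> f x / orlicz_maximal \<rho> (complementary \<eta>) (\<gamma> - \<sigma>) u x)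
          \<le> ennreal C *
            modular \<psi> (maximal \<rho> \<theta> w) (\<lambda>x. ennreal C * (ennreal (f x) / ennreal (u x)))"
    by (rule exI[of _ "2 * C"], rule conjI, use C in simp, rule exI[of _ \<theta>], rule conjI, rule \<theta>,
        intro allI impI ballI main)
qed

end

section \<open>Test functions supported on strips\<close>

text \<open>The unit cross-section makes the measure of a strip equal to its width.\<close>

definition strip :: "'n \<Rightarrow> real \<Rightarrow> real \<Rightarrow> (real ^ 'n) set" where
  "strip i l u = cbox (\<chi> j. if j = i then l else 0) (\<chi> j. if j = i then u else 1)"

lemma mem_strip: "x \<in> strip i l u \<longleftrightarrow> l \<le> x $ i \<and> x $ i \<le> u \<and> (\<forall>j. j \<noteq> i \<longrightarrow> 0 \<le> x $ j \<and> x $ j \<le> 1)"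
  unfolding strip_def mem_box_cart by auto

lemma strip_measurable [measurable]: "strip i l u \<in> sets borel"
  unfolding strip_def by simp

lemma strip_mono: "l' \<le> l \<Longrightarrow> u \<le> u' \<Longrightarrow> strip i l u \<subseteq> strip i l' u'"
  by (auto simp: mem_strip)

lemma prod_if_eq:
  fixes i :: "'n::finite" and p q :: real
  shows "(\<Prod>j\<in>UNIV. if j = i then p else q) = p * q ^ (CARD('n) - 1)"
proof -
  have "(\<Prod>j\<in>UNIV. if j = i then p else q) = p * (\<Prod>j\<in>UNIV - {i}. if j = i then p else q)"
    by (subst prod.remove[of UNIV i]) auto
  also have "(\<Prod>j\<in>UNIV - {i}. if j = i then p else q) = (\<Prod>j\<in>UNIV - {i}. q)"
    by (rule prod.cong) auto
  finally show ?thesis by (simp add: card_Diff_singleton)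
qed

lemma emeasure_box_one_side:
  fixes i :: "'n::finite" and A B :: "real ^ 'n"
  assumes "\<And>j. B $ j - A $ j = (if j = i then p else q)" "0 \<le> p" "0 \<le> q"
  shows "emeasure lborel (cbox A B) = ennreal (p * q ^ (CARD('n) - 1))"
proof -
  have "A $ j \<le> B $ j" for j using assms(1)[of j] assms(2,3) by (auto split: if_splits)
  then show ?thesis by (simp add: emeasure_cbox_cart assms(1) prod_if_eq)
qed

lemma emeasure_strip: "l \<le> u \<Longrightarrow> emeasure lborel (strip i l u) = ennreal (u - l)"
  unfolding strip_def by (subst emeasure_box_one_side[where i = i and p = "u - l" and q = 1]) auto

lemma cube_emeasure_half_side:
  fixes x0 :: "real ^ 'n"
  assumes "0 \<le> q"
  shows "emeasure lborel (cube x0 (sqrt CARD('n) * q)) = ennreal ((2 * q) * (2 * q) ^ (CARD('n) - 1))"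
proof -
  have "(2 * q) * (2 * q) ^ (CARD('n) - 1) = (2 * q) ^ CARD('n)"
    by (metis power_Suc Suc_pred' zero_less_card_finite)
  then show ?thesis using assms by (simp add: emeasure_cube)
qed

lemma mem_cube_half_side:
  "x \<in> cube (x0 :: real ^ 'n) (sqrt CARD('n) * q) \<longleftrightarrow> (\<forall>j. \<bar>x $ j - x0 $ j\<bar> \<le> q)"
  by (simp add: mem_cube)

lemma cube_half_side_eq:
  "cube (x0 :: real ^ 'n) (sqrt CARD('n) * q) = cbox (\<chi> j. x0 $ j - q) (\<chi> j. x0 $ j + q)"
proof (rule set_eqI)
  fix x show "x \<in> cube x0 (sqrt CARD('n) * q) \<longleftrightarrow> x \<in> cbox (\<chi> j. x0 $ j - q) (\<chi> j. x0 $ j + q)"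
    unfolding mem_cube_half_side mem_box_cart by (auto simp: abs_le_iff algebra_simps)
qed

text \<open>A cube inside the unit cross-section that spans exactly \<open>[l, l + h]\<close> in the direction \<open>i\<close>: the
  problem becomes one-dimensional.\<close>

lemma cube_in_strip:
  fixes x :: "real ^ 'n"
  assumes x: "x \<in> strip i l (l + h)" and h: "0 < h" "h \<le> 1 / 2" and e: "0 \<le> e" "e \<le> h"
    and F: "\<And>y. y \<in> strip i l (l + e) \<Longrightarrow> c \<le> F y"
  obtains x0 where "x0 \<in> strip i l (l + h)" "x \<in> cube x0 (sqrt CARD('n) * (h / 2))"
    "c * ennreal (e / h) \<le> average (cube x0 (sqrt CARD('n) * (h / 2))) F"
proof -
  \<comment> \<open>In the other directions the centre is moved by \<open>h / 2\<close> from
    \<open>x\<close> towards the middle of \<open>[0, 1]\<close>; the cube stays in the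
    cross-section because \<open>h \<le> 1 / 2\<close>.\<close>
  define x0 :: "real ^ 'n" where "x0 = (\<chi> j. if j = i then l + h / 2 else if x $ j \<le> 1 / 2 then x $ j + h / 2 else x $ j - h / 2)"
  define Q where "Q = cube x0 (sqrt CARD('n) * (h / 2))"
  define R :: "(real ^ 'n) set" where "R = cbox (\<chi> j. x0 $ j - h / 2) (\<chi> j. if j = i then l + e else x0 $ j + h / 2)"
  have x0S: "x0 \<in> strip i l (l + h)" using x h by (auto simp: mem_strip x0_def)
  have xQ: "x \<in> Q" unfolding Q_def mem_cube_half_side
  proof
    fix j show "\<bar>x $ j - x0 $ j\<bar> \<le> h / 2"
    proof (cases "j = i")
      case True
      have "l \<le> x $ i" "x $ i \<le> l + h" using x by (auto simp: mem_strip)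
      then show ?thesis using True unfolding x0_def abs_le_iff by simp
    qed (use h in \<open>auto simp: x0_def\<close>)
  qed
  have xj: "x0 $ j - h / 2 \<ge> 0 \<and> x0 $ j + h / 2 \<le> 1" if "j \<noteq> i" for j
  proof -
    have "0 \<le> x $ j" "x $ j \<le> 1" using x that by (auto simp: mem_strip)
    then show ?thesis using that h by (auto simp: x0_def)
  qed
  have xi: "x0 $ i = l + h / 2" by (simp add: x0_def)
  have "R \<subseteq> Q"
  proof
    fix y assume "y \<in> R"
    then have y: "x0 $ j - h / 2 \<le> y $ j" "y $ j \<le> (if j = i then l + e else x0 $ j + h / 2)" for j
      by (auto simp: R_def mem_box_cart)
    have "y $ j \<le> x0 $ j + h / 2" for j
      using y(2)[of j] e xi by (cases "j = i") auto
    then show "y \<in> Q" unfolding Q_def cube_half_side_eq mem_box_cart using y(1) by simp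
  qed
  have RS: "R \<subseteq> strip i l (l + e)"
  proof
    fix y assume "y \<in> R"
    then have y: "x0 $ j - h / 2 \<le> y $ j" "y $ j \<le> (if j = i then l + e else x0 $ j + h / 2)" for j
      by (auto simp: R_def mem_box_cart)
    show "y \<in> strip i l (l + e)" unfolding mem_strip
    proof (intro conjI allI impI)
      show "l \<le> y $ i" using y(1)[of i] xi by simp
      show "y $ i \<le> l + e" using y(2)[of i] by simp
      fix j assume "j \<noteq> i"
      then show "0 \<le> y $ j" "y $ j \<le> 1" using y(1)[of j] y(2)[of j] xj[of j] by auto
    qed
  qed
  define H where "H = h ^ (CARD('n) - 1)"
  have H: "0 < H" using h by (simp add: H_def)
  have R: "emeasure lborel R = ennreal (e * H)"
    unfolding R_def H_def using e h xi by (intro emeasure_box_one_side[where i = i]) auto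
  have Q: "emeasure lborel Q = ennreal (h * H)"
    unfolding Q_def H_def using h by (subst cube_emeasure_half_side) auto
  have "c * ennreal (e / h) = c * (ennreal (e * H) / ennreal (h * H))"
    using e h H by (simp add: divide_ennreal)
  also have "\<dots> = (c * emeasure lebesgue R) / emeasure lebesgue Q"
    using R Q by (simp add: divide_ennreal_def mult.assoc R_def Q_def cube_half_side_eq)
  also have "c * emeasure lebesgue R = (\<integral>\<^sup>+y. c * indicator R y \<partial>lebesgue)"
    by (rule nn_integral_cmult_indicator[symmetric]) (simp add: R_def)
  also have "\<dots> / emeasure lebesgue Q \<le> average Q F"
    unfolding average_def
    by (intro divide_right_mono_ennreal nn_integral_mono)
      (use \<open>R \<subseteq> Q\<close> RS F in \<open>auto simp: indicator_def subset_eq\<close>)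
  finally show ?thesis using that[OF x0S] xQ unfolding Q_def by blast
qed

text \<open>A cube through a point at height \<open>h > e\<close> covers an interval of length
  \<open>2 * q\<close> containing \<open>h\<close>, and the share of \<open>[0, e]\<close> in such
  an interval is largest for \<open>[0, h]\<close>. For \<open>e = h\<close> the bound is 1, so the
  position of \<open>x\<close> is left free.\<close>

lemma average_indicator_strip_le:
  fixes x :: "real ^ 'n"
  assumes r: "0 < r" and x: "x \<in> cube x0 r" and e: "0 < e" "e \<le> h" and h: "e < h \<Longrightarrow> x $ i = h"
  shows "average (cube x0 r) (indicator (strip i 0 e)) \<le> ennreal (e / h)"
proof -
  define q where "q = r / sqrt CARD('n)"
  have q: "0 < q" "r = sqrt CARD('n) * q" using r by (simp_all add: q_def)
  define Q where "Q = cube x0 r"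
  define H where "H = (2 * q) ^ (CARD('n) - 1)"
  have H: "0 < H" using q by (simp add: H_def)
  have Q: "emeasure lebesgue Q = ennreal ((2 * q) * H)"
    unfolding Q_def q(2) H_def using q cube_emeasure_half_side[of q x0] by (simp add: cube_half_side_eq)
  have av: "average Q (indicator (strip i 0 e)) = emeasure lebesgue (Q \<inter> strip i 0 e) / emeasure lebesgue Q"
  proof -
    have "(\<integral>\<^sup>+y\<in>Q. indicator (strip i 0 e) y \<partial>lebesgue) = (\<integral>\<^sup>+y. indicator (Q \<inter> strip i 0 e) y \<partial>lebesgue)"
      by (intro nn_integral_cong) (auto simp: indicator_def)
    also have "\<dots> = emeasure lebesgue (Q \<inter> strip i 0 e)"
      by (intro nn_integral_indicator) (auto simp: Q_def)
    finally show ?thesis by (simp add: average_def)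
  qed
  have "emeasure lebesgue (Q \<inter> strip i 0 e) \<le> ennreal ((e / h) * (2 * q) * H)"
  proof (cases "e < h")
    case False
    then have "e = h" using e by simp
    have "emeasure lebesgue (Q \<inter> strip i 0 e) \<le> emeasure lebesgue Q"
      by (intro emeasure_mono) (auto simp: Q_def)
    then show ?thesis using Q e \<open>e = h\<close> by simp
  next
    case True
    then have xh: "x $ i = h" by (rule h)
    have xq: "\<bar>h - x0 $ i\<bar> \<le> q" using x xh q by (metis mem_cube_half_side)
    define v where "v = max (x0 $ i - q) 0"
    define B :: "(real ^ 'n) set" where "B = cbox (\<chi> j. if j = i then v else x0 $ j - q) (\<chi> j. if j = i then e else x0 $ j + q)"
    have sub: "Q \<inter> strip i 0 e \<subseteq> B"
      unfolding Q_def q(2) cube_half_side_eq B_def v_def by (auto simp: mem_box_cart mem_strip)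
    show ?thesis
    proof (cases "v \<le> e")
      case False
      have "x \<notin> B" for x
      proof
        assume "x \<in> B"
        then have "v \<le> x $ i" "x $ i \<le> e"
          unfolding B_def mem_box_cart by (auto dest: spec[of _ i])
        then show False using False by simp
      qed
      then have "B = {}" by blast
      then show ?thesis using sub by auto
    next
      case ve: True
      have "emeasure lborel B = ennreal ((e - v) * H)"
        unfolding B_def H_def using ve q by (intro emeasure_box_one_side[where i = i]) auto
      \<comment> \<open>If the cube starts at \<open>v > 0\<close>, then
        \<open>h \<le> v + 2 * q\<close>, and the correction \<open>v * (e - v - 2 * q)\<close> is
        negative because \<open>e < h\<close>.\<close>
      moreover have "(e - v) * h \<le> e * (2 * q)"
      proof (cases "x0 $ i - q \<le> 0")
        case True
        then have "v = 0" "h \<le> 2 * q" using xq by (auto simp: v_def)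
        then show ?thesis using e by simp
      next
        case F: False
        then have v: "v = x0 $ i - q" "0 < v" by (auto simp: v_def)
        then have hv: "h \<le> v + 2 * q" using xq by auto
        have "(e - v) * h \<le> (e - v) * (v + 2 * q)" using ve hv by (intro mult_left_mono) auto
        also have "\<dots> = e * (2 * q) + v * (e - v - 2 * q)" by (simp add: algebra_simps)
        also have "\<dots> \<le> e * (2 * q)" using v hv True by (simp add: mult_nonneg_nonpos)
        finally show ?thesis .
      qed
      then have "e - v \<le> (e / h) * (2 * q)" using e by (simp add: field_simps)
      then have "(e - v) * H \<le> (e / h) * (2 * q) * H" using H by (intro mult_right_mono) auto
      moreover have "emeasure lebesgue (Q \<inter> strip i 0 e) \<le> emeasure lebesgue B"
        using sub by (intro emeasure_mono) (auto simp: B_def)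
      ultimately show ?thesis by (simp add: B_def) (meson ennreal_leI order_trans)
    qed
  qed
  then have "average Q (indicator (strip i 0 e)) \<le> ennreal ((e / h) * (2 * q) * H) / ennreal ((2 * q) * H)"
    unfolding av Q by (rule divide_right_mono_ennreal)
  also have "\<dots> = ennreal (((e / h) * (2 * q) * H) / ((2 * q) * H))"
    using e q H by (intro divide_ennreal) auto
  also have "((e / h) * (2 * q) * H) / ((2 * q) * H) = e / h" using q H by simp
  finally show ?thesis by (simp add: Q_def)
qed

section \<open>Control of the penalty, and lower bounds for modulars from level sets\<close>

text \<open>The lower growth estimate from the origin decreases with the distance, so its value at
  the edge of the bounded set is a common bound.\<close>

lemma critical_radius_bounded_below:
  fixes \<rho> :: "real ^ 'n \<Rightarrow> real"
  assumes "critical_radius \<rho>" "bounded S"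
  obtains \<delta> where "0 < \<delta>" "\<And>y. y \<in> S \<Longrightarrow> \<delta> \<le> \<rho> y"
proof -
  obtain C N where C: "1 \<le> C" "1 \<le> N" and \<rho>: "\<And>x. 0 < \<rho> x"
    and le: "\<And>x y. inverse C * \<rho> x * (1 + norm (x - y) / \<rho> x) powr (- N) \<le> \<rho> y"
    using assms(1) unfolding critical_radius_def by blast
  obtain R where R: "0 < R" "\<And>y. y \<in> S \<Longrightarrow> norm y \<le> R"
    using assms(2) by (auto simp: bounded_pos)
  define \<delta> where "\<delta> = inverse C * \<rho> 0 * (1 + R / \<rho> 0) powr (- N)"
  have "0 < R / \<rho> 0" using R \<rho> by simp
  then have "0 < \<delta>" using C \<rho>[of 0] by (simp add: \<delta>_def)
  moreover have "\<delta> \<le> \<rho> y" if "y \<in> S" for y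
  proof -
    have "norm y / \<rho> 0 \<le> R / \<rho> 0" "0 \<le> norm y / \<rho> 0"
      using R(2)[OF that] \<rho>[of 0] by (auto intro!: divide_right_mono)
    then have "(1 + R / \<rho> 0) powr (- N) \<le> (1 + norm y / \<rho> 0) powr (- N)"
      using C by (intro powr_mono2') auto
    then have "\<delta> \<le> inverse C * \<rho> 0 * (1 + norm y / \<rho> 0) powr (- N)"
      unfolding \<delta>_def using C \<rho>[of 0] by (intro mult_left_mono) auto
    also have "\<dots> \<le> \<rho> y" using le[of 0 y] by simp
    finally show ?thesis .
  qed
  ultimately show ?thesis using that by blast
qed

lemma powr_critical_ge:
  fixes \<sigma> :: real
  assumes "0 < r" "r \<le> \<rho>0" "0 \<le> \<sigma>"
  shows "2 powr (- \<sigma>) \<le> (1 + r / \<rho>0) powr (- \<sigma>)"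
  using assms by (intro powr_mono2') (auto simp: add_pos_pos divide_simps)

lemma ennreal_divide_ge:
  assumes "0 \<le> x" "0 < y" "ennreal x \<le> A" "B \<le> ennreal y"
  shows "ennreal (x / y) \<le> A / B"
proof (cases "B = 0")
  case True
  show ?thesis
  proof (cases "x = 0")
    case False
    then have "A \<noteq> 0" using assms by auto
    then show ?thesis using True by simp
  qed simp
next
  case False
  have "B < \<infinity>" using assms(4) by (rule le_less_trans) simp
  then obtain b where b: "B = ennreal b" "0 < b" using False by (cases B) auto
  have "x / y \<le> x / b" using assms b by (intro divide_left_mono) auto
  then have "ennreal (x / y) \<le> ennreal x / ennreal b"
    using assms b by (subst divide_ennreal) (auto intro: ennreal_leI)
  also have "\<dots> \<le> A / B" unfolding b using assms by (intro divide_right_mono_ennreal)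
  finally show ?thesis .
qed

context integrator
begin

text \<open>Fubini is applied to the set \<open>A\<close>, so \<open>g\<close> may be arbitrary, for
  instance a quotient of maximal functions. The weak inequality in \<open>le\<close> suffices
  because only the single height \<open>s = g x\<close> is lost.\<close>

lemma modular_ge_level_sets:
  fixes g :: "real ^ 'n \<Rightarrow> ennreal"
  assumes A [measurable]: "A \<in> sets (lborel \<Otimes>\<^sub>M lborel)"
    and le: "\<And>s x. (s, x) \<in> A \<Longrightarrow> ennreal s \<le> g x"
  shows "(\<integral>\<^sup>+s. a_pos s * emeasure lborel {x. (s, x) \<in> A} \<partial>lborel) \<le> modular \<phi> (\<lambda>_. 1) g"
proof -
  have "pair_sigma_finite (lborel :: real measure) (lborel :: (real ^ 'n) measure)"
    unfolding pair_sigma_finite_def by (simp add: sigma_finite_lborel)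
  note Fubini = pair_sigma_finite.Fubini'[OF this]
  have [measurable]: "a_pos \<in> borel_measurable borel" by (rule measurable_a_pos)
  have "(\<integral>\<^sup>+s. a_pos s * emeasure lborel {x. (s, x) \<in> A} \<partial>lborel) = (\<integral>\<^sup>+s. \<integral>\<^sup>+x. a_pos s * indicator A (s, x) \<partial>lborel \<partial>lborel)"
  proof (intro nn_integral_cong)
    fix s
    have "{x. (s, x) \<in> A} = Pair s -` A" by auto
    then have m: "{x. (s, x) \<in> A} \<in> sets lborel" using sets_Pair1[OF A, of s] by simp
    have "(\<integral>\<^sup>+x. a_pos s * indicator A (s, x) \<partial>lborel) = (\<integral>\<^sup>+x. a_pos s * indicator {x. (s, x) \<in> A} x \<partial>lborel)"
      by (intro nn_integral_cong) (auto simp: indicator_def)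
    also have "\<dots> = a_pos s * emeasure lborel {x. (s, x) \<in> A}"
      by (rule nn_integral_cmult_indicator[OF m])
    finally show "a_pos s * emeasure lborel {x. (s, x) \<in> A} = (\<integral>\<^sup>+x. a_pos s * indicator A (s, x) \<partial>lborel)" ..
  qed
  also have "\<dots> = (\<integral>\<^sup>+x. \<integral>\<^sup>+s. a_pos s * indicator A (s, x) \<partial>lborel \<partial>lborel)"
    by (rule Fubini[symmetric]) measurable
  also have "\<dots> \<le> (\<integral>\<^sup>+x. young_ext \<phi> (g x) \<partial>lborel)"
  proof (rule nn_integral_mono)
    fix x
    have "AE s in lborel. s \<noteq> enn2real (g x)" by (rule AE_lborel_singleton)
    then have "AE s in lborel. a_pos s * indicator A (s, x) \<le> a_pos s * indicator {s. ennreal s < g x} s"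
    proof eventually_elim
      case (elim s)
      show ?case
      proof (cases "(s, x) \<in> A \<and> 0 < s")
        case True
        then have "ennreal s \<le> g x" by (intro le) auto
        moreover have "ennreal s \<noteq> g x"
        proof
          assume "ennreal s = g x"
          then have "enn2real (g x) = s" using True by (metis enn2real_ennreal less_imp_le)
          then show False using elim by simp
        qed
        ultimately have "ennreal s < g x" by simp
        then show ?thesis using True by simp
      next
        case False
        then show ?thesis by (auto simp: a_pos_def)
      qed
    qed
    then show "(\<integral>\<^sup>+s. a_pos s * indicator A (s, x) \<partial>lborel) \<le> young_ext \<phi> (g x)"
      unfolding layer_cake by (rule nn_integral_mono_AE)
  qed
  also have "\<dots> = modular \<phi> (\<lambda>_. 1) g" by (simp add: modular_def nn_integral_completion)
  finally show ?thesis .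
qed

end

lemma young_normalized_ge_1: "young_function \<eta> \<Longrightarrow> normalized \<eta> \<Longrightarrow> 1 \<le> p \<Longrightarrow> 1 \<le> \<eta> p"
  using young_mono[of \<eta> 1 p] by (simp add: normalized_def)

text \<open>Convexity and the value 0 at the origin give
  \<open>\<eta> p \<le> (p / q) * \<eta> q\<close>, and \<open>\<eta> q\<close> is positive. In the
  norm test this recovers a bound on arguments from a bound on values of
  \<open>\<eta>\<close>.\<close>

lemma young_strict_mono:
  assumes "young_function \<eta>" "normalized \<eta>" "1 \<le> p" "p < q"
  shows "\<eta> p < \<eta> q"
proof -
  have q: "1 \<le> \<eta> q" using assms(3,4) by (intro young_normalized_ge_1[OF assms(1,2)]) auto
  have "\<eta> ((p / q) * q) \<le> (p / q) * \<eta> q" using assms q by (intro young_scale[OF assms(1)]) auto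
  also have "\<dots> < 1 * \<eta> q" using assms q by (intro mult_strict_right_mono) auto
  finally show ?thesis using assms by simp
qed

lemma closed_cross_section: "closed {x :: real ^ 'n. \<forall>j. j \<noteq> i \<longrightarrow> 0 \<le> x $ j \<and> x $ j \<le> 1}"
proof -
  have "closed (\<Inter>j\<in>- {i}. {x :: real ^ 'n. 0 \<le> x $ j} \<inter> {x. x $ j \<le> 1})"
    by (intro closed_INT ballI closed_Int closed_Collect_le continuous_intros)
  also have "(\<Inter>j\<in>- {i}. {x :: real ^ 'n. 0 \<le> x $ j} \<inter> {x. x $ j \<le> 1}) = {x. \<forall>j. j \<noteq> i \<longrightarrow> 0 \<le> x $ j \<and> x $ j \<le> 1}"
    by auto
  finally show ?thesis .
qed

lemma disjoint_strips:
  fixes m :: nat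
  assumes "0 < d" "e < d"
  shows "disjoint_family_on (\<lambda>k. strip i (real k * d) (real k * d + e)) {..<m}"
proof -
  have *: "strip i (real k * d) (real k * d + e) \<inter> strip i (real l * d) (real l * d + e) = {}" if "k < l" for k l :: nat
  proof -
    have "real k + 1 \<le> real l" using that by linarith
    then have "(real k + 1) * d \<le> real l * d" using assms by (intro mult_right_mono) auto
    then have "real k * d + d \<le> real l * d" by (simp add: distrib_right)
    then have "real k * d + e < real l * d" using assms by linarith
    then show ?thesis by (auto simp: mem_strip)
  qed
  show ?thesis unfolding disjoint_family_on_def
  proof (intro ballI impI)
    fix k l :: nat assume "k \<noteq> l"
    then show "strip i (real k * d) (real k * d + e) \<inter> strip i (real l * d) (real l * d + e) = {}"
      using *[of k l] *[of l k] by (cases "k < l") auto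
  qed
qed

lemma emeasure_Union_strips:
  fixes m :: nat
  assumes "0 < d" "0 \<le> e" "e < d"
  shows "emeasure lborel (\<Union>k<m. strip i (real k * d) (real k * d + e)) = ennreal (real m * e)"
proof -
  have "emeasure lborel (\<Union>k<m. strip i (real k * d) (real k * d + e)) = (\<Sum>k<m. emeasure lborel (strip i (real k * d) (real k * d + e)))"
    using assms by (intro sum_emeasure[symmetric] disjoint_strips) auto
  also have "\<dots> = ennreal (real m * e)" using assms
    by (simp add: emeasure_strip ennreal_mult ennreal_of_nat_eq_real_of_nat)
  finally show ?thesis .
qed

context dini_setting
begin

text \<open>At height \<open>s\<close> the choice \<open>p = T / s\<close> puts strips of width
  \<open>e * \<eta> (T / s)\<close> into the level set. The spacing \<open>d\<close> is twice the
  largest such width, so they stay disjoint at all levels and their measures add up to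
  \<open>m * e * \<eta> (T / s)\<close>.\<close>

lemma modular_ge_strips:
  fixes g :: "real ^ 'n \<Rightarrow> ennreal" and m :: nat
  assumes T: "0 < T" and P: "1 \<le> P" and e: "0 < e" and d: "d = 2 * (e * \<eta> P)"
    and g: "\<And>k p x. k < m \<Longrightarrow> 1 \<le> p \<Longrightarrow> p \<le> P \<Longrightarrow> x \<in> strip i (real k * d) (real k * d + e * \<eta> p) \<Longrightarrow> ennreal (T / p) \<le> g x"
  shows "ennreal (real m * e) * (\<integral>\<^sup>+s\<in>{T / P..T}. ennreal (a s * \<eta> (T / s)) \<partial>lborel) \<le> modular \<phi> (\<lambda>_. 1) g"
proof -
  define W where "W = {x :: real ^ 'n. \<forall>j. j \<noteq> i \<longrightarrow> 0 \<le> x $ j \<and> x $ j \<le> 1}"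
  have [measurable]: "W \<in> sets borel" unfolding W_def by (intro borel_closed closed_cross_section)
  have [measurable]: "(\<lambda>x. \<eta> (max 0 x)) \<in> borel_measurable borel"
    by (rule borel_measurable_truncate[OF eta_cont])
  \<comment> \<open>All level strips in one subset of the product space, described by coordinates so
    that joint measurability is visible; \<open>W\<close> is the common cross-section.\<close>
  define A where "A = {z \<in> space (lborel \<Otimes>\<^sub>M lborel). T / P \<le> fst z \<and> fst z \<le> T \<and>
     (\<exists>k<m. real k * d \<le> snd z $ i \<and> snd z $ i \<le> real k * d + e * \<eta> (max 0 (T / fst z)) \<and> snd z \<in> W)}"
  have A [measurable]: "A \<in> sets (lborel \<Otimes>\<^sub>M lborel)"
  proof -
    define G where "G s = \<eta> (max 0 (T / s))" for s
    define X where "X x = x $ i" for x :: "real ^ 'n"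
    have [measurable]: "G \<in> borel_measurable borel" unfolding G_def by measurable
    have [measurable]: "X \<in> borel_measurable borel"
      unfolding X_def by (intro borel_measurable_continuous_onI continuous_intros)
    have "A = {z \<in> space (lborel \<Otimes>\<^sub>M lborel). T / P \<le> fst z \<and> fst z \<le> T \<and>
       (\<exists>k\<in>{..<m}. real k * d \<le> X (snd z) \<and> X (snd z) \<le> real k * d + e * G (fst z)) \<and> snd z \<in> W}"
      unfolding A_def G_def X_def by auto
    also have "\<dots> \<in> sets (lborel \<Otimes>\<^sub>M lborel)" by measurable
    finally show ?thesis .
  qed
  have TP: "0 < T / P" using T P by simp
  have p: "1 \<le> T / s \<and> T / s \<le> P \<and> 0 < s" if "T / P \<le> s" "s \<le> T" for s
  proof -
    have "0 < s" using TP that by linarith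
    then show ?thesis using that T P by (simp add: field_simps)
  qed
  have As: "{x. (s, x) \<in> A} = (\<Union>k<m. strip i (real k * d) (real k * d + e * \<eta> (T / s)))"
    if "T / P \<le> s" "s \<le> T" for s
    using that p[OF that] by (auto simp: A_def W_def mem_strip space_pair_measure max_absorb2)
  have "ennreal (real m * e) * (\<integral>\<^sup>+s\<in>{T / P..T}. ennreal (a s * \<eta> (T / s)) \<partial>lborel)
    = (\<integral>\<^sup>+s. ennreal (real m * e) * (ennreal (a s * \<eta> (T / s)) * indicator {T / P..T} s) \<partial>lborel)"
  proof (rule nn_integral_cmult[symmetric])
    have "{T / P..T} \<subseteq> {0<..}" using TP by auto
    then show "(\<lambda>s. ennreal (a s * \<eta> (T / s)) * indicator {T / P..T} s) \<in> borel_measurable lborel"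
      using measurable_dini_integrand[of "{T / P..T}" T] T by simp
  qed
  also have "\<dots> \<le> (\<integral>\<^sup>+s. phi.a_pos s * emeasure lborel {x. (s, x) \<in> A} \<partial>lborel)"
  proof (rule nn_integral_mono)
    fix s
    show "ennreal (real m * e) * (ennreal (a s * \<eta> (T / s)) * indicator {T / P..T} s) \<le> phi.a_pos s * emeasure lborel {x. (s, x) \<in> A}"
    proof (cases "s \<in> {T / P..T}")
      case True
      then have s: "T / P \<le> s" "s \<le> T" by auto
      note ps = p[OF s]
      have \<eta>1: "1 \<le> \<eta> (T / s)" using ps by (intro young_normalized_ge_1[OF \<eta>(1,2)]) auto
      have \<eta>P: "\<eta> (T / s) \<le> \<eta> P" using ps by (intro young_mono[of \<eta>, OF \<eta>(1)]) auto
      have "e * \<eta> (T / s) \<le> e * \<eta> P" using \<eta>P e by simp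
      moreover have pos: "0 < e * \<eta> (T / s)" using \<eta>1 e by (intro mult_pos_pos) auto
      ultimately have "e * \<eta> (T / s) < d" unfolding d by linarith
      then have "emeasure lborel {x. (s, x) \<in> A} = ennreal (real m * (e * \<eta> (T / s)))"
        unfolding As[OF s] using pos by (intro emeasure_Union_strips) auto
      moreover have "phi.a_pos s = ennreal (a s)" using ps by (simp add: phi.a_pos_def)
      moreover have "ennreal (real m * e) * ennreal (a s * \<eta> (T / s)) = ennreal (a s) * ennreal (real m * (e * \<eta> (T / s)))"
        using e \<eta>1 phi.nonneg[of s] ps by (simp add: ennreal_mult[symmetric] mult_ac)
      ultimately show ?thesis using True by simp
    qed simp
  qed
  also have "\<dots> \<le> modular \<phi> (\<lambda>_. 1) g"
  proof (rule phi.modular_ge_level_sets[OF A])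
    fix s x assume sx: "(s, x) \<in> A"
    then have s: "T / P \<le> s" "s \<le> T" by (auto simp: A_def)
    have "x \<in> {x. (s, x) \<in> A}" using sx by simp
    then obtain k where "k < m" "x \<in> strip i (real k * d) (real k * d + e * \<eta> (T / s))"
      unfolding As[OF s] by blast
    then have "ennreal (T / (T / s)) \<le> g x" using p[OF s] by (intro g) auto
    then show "ennreal s \<le> g x" using T by simp
  qed
  finally show ?thesis .
qed

text \<open>A test with finite spacing reaches only heights \<open>s \<ge> T / P\<close>. Letting
  \<open>P\<close> run through the positive integers, monotone convergence gives the full integral
  with the same constant.\<close>

lemma primitive_condition_from_tests:
  assumes C: "0 \<le> C" and le: "\<And>T P. 0 < T \<Longrightarrow> 1 \<le> P \<Longrightarrow> (\<integral>\<^sup>+s\<in>{T / P..T}. ennreal (a s * \<eta> (T / s)) \<partial>lborel) \<le> ennreal (C * \<psi> (C * T))"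
  shows "dini_primitive_condition \<eta> a \<psi>"
proof -
  have main: "(\<integral>\<^sup>+s\<in>{0<..T}. ennreal (a s * \<eta> (T / s)) \<partial>lborel) \<le> ennreal (C * \<psi> (C * T))" if T: "0 < T" for T
  proof -
    define F where "F k s = ennreal (a s * \<eta> (T / s)) * indicator {T / real (Suc k)..T} s" for k :: nat and s
    have sub: "{T / real (Suc k)..T} \<subseteq> {0<..T}" for k
    proof -
      have "0 < T / real (Suc k)" using T by simp
      then show ?thesis by (auto simp del: of_nat_Suc)
    qed
    have meas: "F k \<in> borel_measurable lborel" for k
    proof -
      have "{T / real (Suc k)..T} \<subseteq> {0<..}" using sub[of k] by auto
      then show ?thesis
        using measurable_dini_integrand[of "{T / real (Suc k)..T}" T] T unfolding F_def[abs_def] by simp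
    qed
    have inc: "incseq F"
    proof (intro incseq_SucI le_funI)
      fix k s
      have "T / real (Suc (Suc k)) \<le> T / real (Suc k)" using T by (intro divide_left_mono) auto
      then show "F k s \<le> F (Suc k) s" unfolding F_def by (auto simp: indicator_def simp del: of_nat_Suc)
    qed
    have "(\<integral>\<^sup>+s\<in>{0<..T}. ennreal (a s * \<eta> (T / s)) \<partial>lborel) \<le> (\<integral>\<^sup>+s. (SUP k. F k s) \<partial>lborel)"
    proof (rule nn_integral_mono)
      fix s
      show "ennreal (a s * \<eta> (T / s)) * indicator {0<..T} s \<le> (SUP k. F k s)"
      proof (cases "s \<in> {0<..T}")
        case True
        obtain k where "T / s \<le> real k" using real_arch_simple by blast
        then have "T \<le> real (Suc k) * s" using True by (simp add: field_simps)
        then have "T / real (Suc k) \<le> s" by (simp add: field_simps)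
        then have "ennreal (a s * \<eta> (T / s)) * indicator {0<..T} s \<le> F k s" using True by (simp add: F_def del: of_nat_Suc)
        then show ?thesis by (rule SUP_upper2[OF UNIV_I])
      qed simp
    qed
    also have "\<dots> = (SUP k. \<integral>\<^sup>+s. F k s \<partial>lborel)"
      by (rule nn_integral_monotone_convergence_SUP[OF inc meas])
    also have "\<dots> \<le> ennreal (C * \<psi> (C * T))"
    proof (rule SUP_least)
      fix k
      show "(\<integral>\<^sup>+s. F k s \<partial>lborel) \<le> ennreal (C * \<psi> (C * T))"
        unfolding F_def by (rule le) (use T in auto)
    qed
    finally show ?thesis .
  qed
  show ?thesis unfolding dini_primitive_condition_def
  proof (rule exI[of _ "C + 1"], intro conjI allI impI)
    show "0 < C + 1" using C by simp
    fix T :: real assume T: "0 < T"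
    have "\<psi> (C * T) \<le> \<psi> ((C + 1) * T)" using C T by (intro psi.Phi_mono) (auto simp: distrib_right)
    moreover have "0 \<le> \<psi> (C * T)" using C T by (intro psi.Phi_nonneg) auto
    ultimately have "C * \<psi> (C * T) \<le> (C + 1) * \<psi> ((C + 1) * T)" using C by (intro mult_mono) auto
    then have "ennreal (C * \<psi> (C * T)) \<le> ennreal ((C + 1) * \<psi> ((C + 1) * T))" by (rule ennreal_leI)
    then show "(\<integral>\<^sup>+s\<in>{0<..T}. ennreal (a s * \<eta> (T / s)) \<partial>lborel) \<le> ennreal ((C + 1) * \<psi> ((C + 1) * T))"
      using main[OF T] by (rule order_trans[rotated])
  qed
qed

end

lemma bounded_strip: "bounded (strip i l u)"
  unfolding strip_def by simp

text \<open>At the level \<open>(e / h) * p\<close> the complementary function is at most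
  \<open>h / e\<close> on the strip, by the slope bound, and the strip fills at most the fraction
  \<open>e / h\<close> of the cube.\<close>

lemma lux_average_complementary_indicator_le:
  fixes x :: "real ^ 'n"
  assumes \<eta>: "young_function \<eta>" and r: "0 < r" and x: "x \<in> cube x0 r"
    and e: "0 < e" "e \<le> h" and xh: "e < h \<Longrightarrow> x $ i = h" and p: "0 < p" "h / e \<le> \<eta> p"
  shows "lux_average (complementary \<eta>) (cube x0 r) (indicator (strip i 0 e)) \<le> ennreal ((e / h) * p)"
proof -
  define c where "c = (e / h) * p"
  have h: "0 < h" using e by simp
  have c: "0 < c" "1 / c = (h / e) / p" using e p h by (simp_all add: c_def)
  have c1: "complementary \<eta> (1 / c) \<le> ennreal (h / e)"
    unfolding c using e h p by (intro complementary_slope_le[OF \<eta>]) auto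
  have "complementary \<eta> 0 \<le> ennreal 0"
    using complementary_slope_le[OF \<eta> p(1), of 0] young_nonneg[OF \<eta>, of p] p by simp
  then have c0: "complementary \<eta> 0 = 0" by simp
  have "average (cube x0 r) (\<lambda>y. complementary \<eta> (\<bar>indicator (strip i 0 e) y\<bar> / c))
    \<le> average (cube x0 r) (\<lambda>y. ennreal (h / e) * indicator (strip i 0 e) y)"
    using c1 c0 by (intro average_mono) (auto simp: indicator_def)
  also have "\<dots> = ennreal (h / e) * average (cube x0 r) (indicator (strip i 0 e))"
    by (rule average_cmult) (auto intro!: lebesgue_measurable_borel)
  also have "\<dots> \<le> ennreal (h / e) * ennreal (e / h)"
    by (intro mult_left_mono average_indicator_strip_le[OF r x e xh]) auto
  also have "\<dots> = 1" using e h by (simp add: ennreal_mult[symmetric])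
  finally show ?thesis unfolding lux_average_def c_def[symmetric] using c by (intro Inf_lower) auto
qed

text \<open>The bound 1/2 lets cubes fit into the cross-section; the bound by
  \<open>\<delta>\<close> keeps their radii below the critical radius.\<close>

lemma small_scale:
  assumes "0 < (\<delta>::real)"
  obtains d where "0 < d" "d \<le> 1 / 2" "sqrt CARD('n::finite) * d \<le> \<delta>"
proof (rule that[of "min (1 / 2) (\<delta> / sqrt CARD('n))"])
  show "sqrt CARD('n) * min (1 / 2) (\<delta> / sqrt CARD('n)) \<le> \<delta>"
  proof -
    have "sqrt CARD('n) * min (1 / 2) (\<delta> / sqrt CARD('n)) \<le> sqrt CARD('n) * (\<delta> / sqrt CARD('n))"
      by (intro mult_left_mono) auto
    then show ?thesis by simp
  qed
  show "min (1 / 2) (\<delta> / sqrt CARD('n)) \<le> 1 / 2" by (rule min.cobounded1)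
qed (use assms in auto)

lemma maximal_ge:
  assumes "0 < r" "x \<in> cube x0 r"
  shows "ennreal ((1 + r / \<rho> x0) powr (- \<sigma>)) * average (cube x0 r) (\<lambda>y. ennreal \<bar>f y\<bar>) \<le> maximal \<rho> \<sigma> f x"
  unfolding maximal_def using assms by (intro SUP_upper2[of "(x0, r)"]) auto

lemma orlicz_maximal_ge:
  assumes "0 < r" "x \<in> cube x0 r"
  shows "ennreal ((1 + r / \<rho> x0) powr (- \<sigma>)) * lux_average A (cube x0 r) f \<le> orlicz_maximal \<rho> A \<sigma> f x"
  unfolding orlicz_maximal_def using assms by (intro SUP_upper2[of "(x0, r)"]) auto

section \<open>Necessity: the test functions for (e) and (f)\<close>

context dini_setting
begin

text \<open>One strip is enough, as both sides scale with its width \<open>e\<close>. At height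
  \<open>h \<le> e * \<eta> p\<close> the numerator is at least \<open>T * (e / h)\<close> and the
  denominator at most \<open>(e / h) * p\<close>, so the geometry cancels and the quotient is at
  least \<open>T / p\<close>.\<close>

lemma quotient_imp_primitive:
  fixes \<rho> :: "real ^ 'n \<Rightarrow> real"
  assumes q: "quotient_modular_inequality \<rho> \<eta> \<phi> \<psi>" and \<rho>: "critical_radius \<rho>"
  shows "dini_primitive_condition \<eta> a \<psi>"
proof -
  have \<rho>0: "\<And>x. 0 < \<rho> x" using \<rho> by (simp add: critical_radius_def)
  obtain C \<sigma> where C: "0 \<le> C" and \<sigma>: "0 \<le> \<sigma>" and ineq: "\<forall>\<gamma>\<ge>\<sigma>.
        \<forall>f\<in>nonneg_measurable. \<forall>u\<in>nonneg_measurable. \<forall>w\<in>nonneg_measurable.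
          modular \<phi> (\<lambda>x. ennreal (w x))
            (\<lambda>x. maximal \<rho> \<gamma> f x / orlicz_maximal \<rho> (complementary \<eta>) (\<gamma> - \<sigma>) u x)
          \<le> ennreal C *
            modular \<psi> (maximal \<rho> 0 w) (\<lambda>x. ennreal C * (ennreal (f x) / ennreal (u x)))"
    using q[unfolded quotient_modular_inequality_def, rule_format, OF order_refl] by blast
  fix i :: 'n
  obtain \<delta> where \<delta>: "0 < \<delta>" "\<And>y. y \<in> strip i 0 1 \<Longrightarrow> \<delta> \<le> \<rho> y"
    using critical_radius_bounded_below[OF \<rho> bounded_strip] by blast
  obtain d where d: "0 < d" "d \<le> 1 / 2" "sqrt CARD('n) * d \<le> \<delta>"
    using small_scale[OF \<delta>(1), where 'n = 'n] by blast
  define \<kappa> :: real where "\<kappa> = 2 powr (- \<sigma>)"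
  have \<kappa>: "0 < \<kappa>" by (simp add: \<kappa>_def)
  have test: "(\<integral>\<^sup>+s\<in>{T / P..T}. ennreal (a s * \<eta> (T / s)) \<partial>lborel) \<le> ennreal (C * \<psi> (C / \<kappa> * T))"
    if T: "0 < T" and P: "1 \<le> P" for T P
  proof -
    have \<eta>P: "1 \<le> \<eta> P" by (rule young_normalized_ge_1[OF \<eta>(1,2) P])
    \<comment> \<open>With this width even the level \<open>P\<close> reaches only up to
      \<open>d / 2\<close>, so every cube in use has side at most \<open>d / 2\<close>.\<close>
    define e where "e = d / (2 * \<eta> P)"
    have e: "0 < e" "d = 2 * (e * \<eta> P)" using d \<eta>P by (simp_all add: e_def)
    \<comment> \<open>The amplitude compensates the penalty bound \<open>\<kappa>\<close>, which
      depends on \<open>\<sigma>\<close> only.\<close>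
    define t where "t = T / \<kappa>"
    have t: "0 < t" using T \<kappa> by (simp add: t_def)
    define u :: "real ^ 'n \<Rightarrow> real" where "u = indicator (strip i 0 e)"
    define f :: "real ^ 'n \<Rightarrow> real" where "f x = t * u x" for x
    have [measurable]: "u \<in> borel_measurable borel" unfolding u_def by measurable
    have [measurable]: "f \<in> borel_measurable borel" unfolding f_def by measurable
    have u: "u \<in> nonneg_measurable" and f: "f \<in> nonneg_measurable"
      using t by (auto simp: nonneg_measurable_def intro!: lebesgue_measurable_borel) (auto simp: f_def u_def)
    have one: "(\<lambda>_ :: real ^ 'n. 1 :: real) \<in> nonneg_measurable" by (simp add: nonneg_measurable_def)
    define g where "g x = maximal \<rho> \<sigma> f x / orlicz_maximal \<rho> (complementary \<eta>) 0 u x" for x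
    have gl: "ennreal (T / p) \<le> g x"
      if p: "1 \<le> p" "p \<le> P" and x: "x \<in> strip i 0 (e * \<eta> p)" for p x
    proof -
      \<comment> \<open>Points of the strip itself count as lying at height \<open>e\<close>, where
        the ratio \<open>e / h\<close> is 1.\<close>
      define h where "h = max (x $ i) e"
      have \<eta>p: "1 \<le> \<eta> p" by (rule young_normalized_ge_1[OF \<eta>(1,2) p(1)])
      have "\<eta> p \<le> \<eta> P" using p by (intro young_mono[of \<eta>, OF \<eta>(1)]) auto
      then have ep: "e * \<eta> p \<le> d / 2" using e by simp
      have he: "h \<le> e * \<eta> p" using x e \<eta>p by (auto simp: h_def mem_strip)
      have "e \<le> h" by (simp add: h_def)
      moreover have "h \<le> 1 / 2" using he ep d by linarith
      ultimately have h: "0 < h" "h \<le> 1 / 2" "e \<le> h" using e by auto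
      have xs: "x \<in> strip i 0 (0 + h)" using x by (auto simp: mem_strip h_def)
      have F: "ennreal t \<le> ennreal \<bar>f y\<bar>" if "y \<in> strip i 0 (0 + e)" for y
        using that t by (simp add: f_def u_def)
      obtain x0 where x0: "x0 \<in> strip i 0 (0 + h)" "x \<in> cube x0 (sqrt CARD('n) * (h / 2))"
        and av: "ennreal t * ennreal (e / h) \<le> average (cube x0 (sqrt CARD('n) * (h / 2))) (\<lambda>y. ennreal \<bar>f y\<bar>)"
        by (rule cube_in_strip[where F = "\<lambda>y. ennreal \<bar>f y\<bar>" and c = "ennreal t", OF xs h(1,2) less_imp_le[OF e(1)] h(3)])
          (erule F, rule that)
      have r: "0 < sqrt CARD('n) * (h / 2)" using h by simp
      have "strip i 0 (0 + h) \<subseteq> strip i 0 1" using h by (intro strip_mono) auto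
      then have "\<delta> \<le> \<rho> x0" using x0 \<delta> by blast
      moreover have "sqrt CARD('n) * (h / 2) \<le> sqrt CARD('n) * d"
        using he ep h d by (intro mult_left_mono) auto
      ultimately have "sqrt CARD('n) * (h / 2) \<le> \<rho> x0" using d by linarith
      then have "\<kappa> \<le> (1 + sqrt CARD('n) * (h / 2) / \<rho> x0) powr (- \<sigma>)"
        unfolding \<kappa>_def by (intro powr_critical_ge r \<sigma>)
      then have "ennreal \<kappa> * (ennreal t * ennreal (e / h)) \<le>
        ennreal ((1 + sqrt CARD('n) * (h / 2) / \<rho> x0) powr (- \<sigma>)) * average (cube x0 (sqrt CARD('n) * (h / 2))) (\<lambda>y. ennreal \<bar>f y\<bar>)"
        by (intro mult_mono ennreal_leI av) auto
      also have "\<dots> \<le> maximal \<rho> \<sigma> f x" by (rule maximal_ge[OF r x0(2)])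
      also have "ennreal \<kappa> * (ennreal t * ennreal (e / h)) = ennreal (T * (e / h))"
      proof -
        have "ennreal \<kappa> * (ennreal t * ennreal (e / h)) = ennreal (\<kappa> * (t * (e / h)))"
          using \<kappa> t h e by (simp only: ennreal_mult less_imp_le zero_le_divide_iff zero_le_mult_iff simp_thms)
        also have "\<kappa> * (t * (e / h)) = T * (e / h)" using \<kappa> by (simp add: t_def)
        finally show ?thesis .
      qed
      finally have Mf: "ennreal (T * (e / h)) \<le> maximal \<rho> \<sigma> f x" .
      \<comment> \<open>The test takes \<open>\<gamma> = \<sigma>\<close>, so this operator carries
        no penalty; the upper bound holds for cubes of every size through \<open>x\<close>.\<close>
      have Mu: "orlicz_maximal \<rho> (complementary \<eta>) 0 u x \<le> ennreal ((e / h) * p)"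
        unfolding orlicz_maximal_def
      proof (rule SUP_least, clarify)
        fix x1 and r :: real assume r: "0 < r" "x \<in> cube x1 r"
        have "0 < r / \<rho> x1" using r \<rho>0 by simp
        then have "(1 + r / \<rho> x1) powr (- 0) = 1" by simp
        moreover have "lux_average (complementary \<eta>) (cube x1 r) u \<le> ennreal ((e / h) * p)"
          unfolding u_def
          by (rule lux_average_complementary_indicator_le[OF \<eta>(1) r e(1) h(3)])
            (use he p e in \<open>auto simp: h_def divide_simps mult.commute\<close>)
        ultimately show "ennreal ((1 + r / \<rho> x1) powr (- 0)) * lux_average (complementary \<eta>) (cube x1 r) u \<le> ennreal ((e / h) * p)"
          by simp
      qed
      have "ennreal ((T * (e / h)) / ((e / h) * p)) \<le> g x"
        unfolding g_def using T e h p by (intro ennreal_divide_ge Mf Mu) auto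
      moreover have "(T * (e / h)) / ((e / h) * p) = T / p" using e h by simp
      ultimately show ?thesis by simp
    qed
    have "ennreal (real 1 * e) * (\<integral>\<^sup>+s\<in>{T / P..T}. ennreal (a s * \<eta> (T / s)) \<partial>lborel) \<le> modular \<phi> (\<lambda>_. 1) g"
      by (rule modular_ge_strips[OF T P e, where i = i]) (use gl in auto)
    also have "\<dots> \<le> ennreal C * modular \<psi> (\<lambda>_. 1) (\<lambda>x. ennreal C * (ennreal (f x) / ennreal (u x)))"
      using ineq[rule_format, OF order_refl f u one] by (simp add: g_def[abs_def] maximal_one[of \<rho>, OF \<rho>0])
    \<comment> \<open>On the strip the quotient is \<open>t\<close>; off it,
      \<open>0 / 0 = 0\<close> contributes nothing.\<close>
    also have "modular \<psi> (\<lambda>_. 1) (\<lambda>x. ennreal C * (ennreal (f x) / ennreal (u x)))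
      = (\<integral>\<^sup>+x. ennreal (\<psi> (C * t)) * indicator (strip i 0 e) x \<partial>lebesgue)"
      unfolding modular_def
    proof (rule nn_integral_cong)
      fix x
      show "young_ext \<psi> (ennreal C * (ennreal (f x) / ennreal (u x))) * 1 = ennreal (\<psi> (C * t)) * indicator (strip i 0 e) x"
      proof (cases "x \<in> strip i 0 e")
        case True
        then have "ennreal C * (ennreal (f x) / ennreal (u x)) = ennreal (C * t)"
          using t C by (simp add: f_def u_def ennreal_mult divide_ennreal[of t 1, simplified])
        then show ?thesis using True C t by (simp add: young_ext_ennreal)
      next
        case False
        then have z: "ennreal C * (ennreal (f x) / ennreal (u x)) = ennreal 0" by (simp add: f_def u_def)
        have "\<psi> 0 = 0" by (simp add: psi.eq_integral)
        then show ?thesis unfolding z using False by (simp add: young_ext_def)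
      qed
    qed
    also have "\<dots> = ennreal (\<psi> (C * t)) * ennreal e"
      using e by (subst nn_integral_cmult_indicator) (auto simp: emeasure_strip)
    finally have le: "ennreal e * (\<integral>\<^sup>+s\<in>{T / P..T}. ennreal (a s * \<eta> (T / s)) \<partial>lborel) \<le> ennreal C * (ennreal (\<psi> (C * t)) * ennreal e)"
      by simp
    have "(\<integral>\<^sup>+s\<in>{T / P..T}. ennreal (a s * \<eta> (T / s)) \<partial>lborel)
      = ennreal (inverse e) * (ennreal e * (\<integral>\<^sup>+s\<in>{T / P..T}. ennreal (a s * \<eta> (T / s)) \<partial>lborel))"
      using e by (simp add: mult.assoc[symmetric] ennreal_mult[symmetric])
    also have "\<dots> \<le> ennreal (inverse e) * (ennreal C * (ennreal (\<psi> (C * t)) * ennreal e))"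
      by (intro mult_left_mono le) auto
    also have "\<dots> = ennreal (inverse e * (C * (\<psi> (C * t) * e)))"
      using e C t psi.Phi_nonneg[of "C * t"] by (simp add: ennreal_mult)
    also have "inverse e * (C * (\<psi> (C * t) * e)) = C * \<psi> (C / \<kappa> * T)"
      using e by (simp add: t_def)
    finally show ?thesis .
  qed
  define D where "D = max C (C / \<kappa>)"
  show ?thesis
  proof (rule primitive_condition_from_tests)
    show "0 \<le> D" using C by (simp add: D_def)
    fix T P :: real assume T: "0 < T" and P: "1 \<le> P"
    have "0 \<le> C / \<kappa> * T" using C \<kappa> T by simp
    moreover have "C / \<kappa> * T \<le> D * T"
      by (rule mult_right_mono) (use T in \<open>auto simp: D_def\<close>)
    ultimately have "\<psi> (C / \<kappa> * T) \<le> \<psi> (D * T)" "0 \<le> \<psi> (C / \<kappa> * T)"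
      by (auto intro: psi.Phi_mono psi.Phi_nonneg)
    then have "C * \<psi> (C / \<kappa> * T) \<le> D * \<psi> (D * T)"
      using C by (intro mult_mono) (auto simp: D_def)
    then have "ennreal (C * \<psi> (C / \<kappa> * T)) \<le> ennreal (D * \<psi> (D * T))" by (rule ennreal_leI)
    with test[OF T P] show "(\<integral>\<^sup>+s\<in>{T / P..T}. ennreal (a s * \<eta> (T / s)) \<partial>lborel) \<le> ennreal (D * \<psi> (D * T))"
      by (rule order_trans)
  qed
qed

lemma norm_imp_primitive:
  fixes \<rho> :: "real ^ 'n \<Rightarrow> real"
  assumes nrm: "norm_inequality \<rho> \<eta> \<phi> \<psi>" and \<rho>: "critical_radius \<rho>"
  shows "dini_primitive_condition \<eta> a \<psi>"
proof -
  obtain C \<sigma> where C: "0 < C" and \<sigma>: "0 \<le> \<sigma>" and ineq: "\<forall>f\<in>orlicz_space \<psi> (\<lambda>_. 1).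
        lux_norm \<phi> (\<lambda>_. 1) (orlicz_maximal \<rho> (\<lambda>t. ennreal (\<eta> t)) \<sigma> f)
        \<le> ennreal C * lux_norm \<psi> (\<lambda>_. 1) (\<lambda>x. ennreal \<bar>f x\<bar>)"
    using nrm unfolding norm_inequality_def by blast
  fix i :: 'n
  \<comment> \<open>Penalty bound and norm constant in one; \<open>2 * C\<close> instead of
    \<open>C\<close> leaves room for an infimum in \<open>lux_norm\<close> that is not
    attained.\<close>
  define \<kappa> where "\<kappa> = 2 powr (- \<sigma>) / (2 * C)"
  have \<kappa>: "0 < \<kappa>" using C by (simp add: \<kappa>_def)
  have test: "(\<integral>\<^sup>+s\<in>{T / P..T}. ennreal (a s * \<eta> (T / s)) \<partial>lborel) \<le> ennreal (\<psi> (1 / \<kappa> * T))"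
    if T: "0 < T" and P: "1 \<le> P" for T P
  proof -
    have \<eta>P: "1 \<le> \<eta> P" by (rule young_normalized_ge_1[OF \<eta>(1,2) P])
    define t where "t = T / \<kappa>"
    have t: "0 < t" using T \<kappa> by (simp add: t_def)
    have \<psi>t: "0 < \<psi> t"
    proof -
      have "0 < (t / 2) * b (t / 2)" using psi.pos[of "t / 2"] t by simp
      also have "\<dots> \<le> \<psi> (2 * (t / 2))" using t by (intro psi.ge_mult[OF b_mono]) auto
      finally show ?thesis by simp
    qed
    \<comment> \<open>This is the value of \<open>m * d\<close> for every \<open>m\<close>, so
      \<open>\<rho>\<close> can be bounded below on the whole box before the number of strips is
      chosen.\<close>
    define L where "L = 2 * \<eta> P / \<psi> t"
    have L: "0 < L" using \<eta>P \<psi>t by (simp add: L_def)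
    obtain \<delta> where \<delta>: "0 < \<delta>" "\<And>y. y \<in> strip i 0 L \<Longrightarrow> \<delta> \<le> \<rho> y"
      using critical_radius_bounded_below[OF \<rho> bounded_strip] by blast
    obtain d0 where d0: "0 < d0" "d0 \<le> 1 / 2" "sqrt CARD('n) * d0 \<le> \<delta>"
      using small_scale[OF \<delta>(1), where 'n = 'n] by blast
    \<comment> \<open>Enough strips to bring the spacing \<open>L / m\<close> below
      \<open>d0\<close>.\<close>
    obtain m :: nat where m: "L / d0 < real m" using reals_Archimedean2 by blast
    have m0: "0 < real m" using m L d0 by (smt (verit, best) divide_pos_pos)
    define d where "d = L / real m"
    have d: "0 < d" "d \<le> d0" using m m0 L d0 by (auto simp: d_def field_simps)
    \<comment> \<open>The total width \<open>m * e\<close> is \<open>1 / \<psi> t\<close>, which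
      makes the modular of \<open>f\<close> equal to 1; the ratio \<open>d / e\<close> is still
      \<open>2 * \<eta> P\<close>.\<close>
    define e where "e = 1 / (real m * \<psi> t)"
    have e: "0 < e" "d = 2 * (e * \<eta> P)" using m0 \<psi>t by (simp_all add: e_def d_def L_def)
    have me: "real m * e = 1 / \<psi> t" using m0 by (simp add: e_def)
    have ed: "e < d" using e \<eta>P by (smt (verit, best) mult_le_cancel_left1)
    define E :: "(real ^ 'n) set" where "E = (\<Union>k<m. strip i (real k * d) (real k * d + e))"
    have [measurable]: "E \<in> sets borel" unfolding E_def by auto
    define f :: "real ^ 'n \<Rightarrow> real" where "f x = t * indicator E x" for x
    have [measurable]: "f \<in> borel_measurable borel" unfolding f_def by measurable
    have Emeas: "emeasure lborel E = ennreal (1 / \<psi> t)"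
      unfolding E_def using d e ed me by (subst emeasure_Union_strips) auto
    have mod1: "modular \<psi> (\<lambda>_. 1) (\<lambda>x. ennreal \<bar>f x\<bar>) = 1"
    proof -
      have "modular \<psi> (\<lambda>_. 1) (\<lambda>x. ennreal \<bar>f x\<bar>) = (\<integral>\<^sup>+x. ennreal (\<psi> t) * indicator E x \<partial>lebesgue)"
        unfolding modular_def using t psi.eq_integral[of 0]
        by (intro nn_integral_cong) (auto simp: f_def indicator_def young_ext_ennreal young_ext_def)
      also have "\<dots> = ennreal (\<psi> t) * ennreal (1 / \<psi> t)"
        using Emeas by (subst nn_integral_cmult_indicator) auto
      also have "\<dots> = 1" using \<psi>t by (simp add: ennreal_mult[symmetric])
      finally show ?thesis .
    qed
    have fO: "f \<in> orlicz_space \<psi> (\<lambda>_. 1)"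
      unfolding orlicz_space_def using mod1 by (auto intro!: exI[of _ 1] lebesgue_measurable_borel)
    define M where "M = orlicz_maximal \<rho> (\<lambda>t. ennreal (\<eta> t)) \<sigma> f"
    have "lux_norm \<psi> (\<lambda>_. 1) (\<lambda>x. ennreal \<bar>f x\<bar>) \<le> ennreal 1"
    proof -
      have "modular \<psi> (\<lambda>_. 1) (\<lambda>x. ennreal \<bar>f x\<bar> / ennreal 1) \<le> 1"
        using mod1 by (simp add: divide_ennreal_def)
      then show ?thesis unfolding lux_norm_def by (intro Inf_lower) (auto intro!: exI[of _ 1] simp del: ennreal_1)
    qed
    then have "ennreal C * lux_norm \<psi> (\<lambda>_. 1) (\<lambda>x. ennreal \<bar>f x\<bar>) \<le> ennreal C * ennreal 1"
      by (intro mult_left_mono) auto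
    then have "lux_norm \<phi> (\<lambda>_. 1) M \<le> ennreal C"
      using ineq[rule_format, OF fO] by (simp add: M_def)
    \<comment> \<open>Strictness yields an admissible level \<open>c\<close> below
      \<open>2 * C\<close>, and monotonicity carries its bound over to \<open>2 * C\<close>.\<close>
    also have "\<dots> < ennreal (2 * C)" using C by (simp add: ennreal_less_iff)
    finally obtain c where c: "0 < c" "modular \<phi> (\<lambda>_. 1) (\<lambda>x. M x / ennreal c) \<le> 1" "ennreal c < ennreal (2 * C)"
      unfolding lux_norm_def Inf_less_iff by blast
    then have c2: "c \<le> 2 * C" by (simp add: ennreal_less_iff)
    have "modular \<phi> (\<lambda>_. 1) (\<lambda>x. M x / ennreal (2 * C)) \<le> modular \<phi> (\<lambda>_. 1) (\<lambda>x. M x / ennreal c)"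
    proof (rule modular_mono[OF phi.integrator_axioms])
      fix x
      have "inverse (ennreal (2 * C)) \<le> inverse (ennreal c)"
      proof -
        have "inverse (2 * C) \<le> inverse c" using c(1) c2 by (rule le_imp_inverse_le[rotated])
        then have "ennreal (inverse (2 * C)) \<le> ennreal (inverse c)" by (rule ennreal_leI)
        moreover have "0 < 2 * C" using C by simp
        ultimately show ?thesis using c(1) by (simp only: inverse_ennreal)
      qed
      then show "M x / ennreal (2 * C) \<le> M x / ennreal c"
        unfolding divide_ennreal_def by (intro mult_left_mono) auto
    qed
    then have mod2: "modular \<phi> (\<lambda>_. 1) (\<lambda>x. M x / ennreal (2 * C)) \<le> 1" using c(2) by (rule order_trans)
    have gl: "ennreal (T / p) \<le> M x / ennreal (2 * C)"
      if k: "k < m" and p: "1 \<le> p" "p \<le> P" and x: "x \<in> strip i (real k * d) (real k * d + e * \<eta> p)" for k p x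
    proof -
      define l where "l = real k * d"
      define h where "h = max (x $ i - l) e"
      have \<eta>p: "1 \<le> \<eta> p" by (rule young_normalized_ge_1[OF \<eta>(1,2) p(1)])
      have "\<eta> p \<le> \<eta> P" using p by (intro young_mono[of \<eta>, OF \<eta>(1)]) auto
      then have ep: "e * \<eta> p \<le> d / 2" using e by simp
      have he: "h \<le> e * \<eta> p" using x e \<eta>p by (auto simp: h_def mem_strip l_def)
      have "e \<le> h" by (simp add: h_def)
      moreover have "h \<le> 1 / 2" using he ep d d0 by linarith
      ultimately have h: "0 < h" "h \<le> 1 / 2" "e \<le> h" using e by auto
      have hd: "h \<le> d" using he ep d by linarith
      have xs: "x \<in> strip i l (l + h)" using x by (auto simp: mem_strip h_def l_def)
      have F: "ennreal (\<eta> (t / c)) \<le> ennreal (\<eta> (\<bar>f y\<bar> / c))" if "y \<in> strip i l (l + e)" for y c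
      proof -
        have "y \<in> E" using that k unfolding E_def l_def by blast
        then show ?thesis using t by (simp add: f_def)
      qed
      have lux: "\<exists>x0. x0 \<in> strip i l (l + h) \<and> x \<in> cube x0 (sqrt CARD('n) * (h / 2)) \<and>
        ennreal (t / p) \<le> lux_average (\<lambda>t. ennreal (\<eta> t)) (cube x0 (sqrt CARD('n) * (h / 2))) f"
      proof -
        have F1: "1 \<le> (indicator (strip i l (l + e)) y :: ennreal)" if "y \<in> strip i l (l + e)" for y
          using that by simp
        obtain x0 where x0: "x0 \<in> strip i l (l + h)" "x \<in> cube x0 (sqrt CARD('n) * (h / 2))"
          and av: "1 * ennreal (e / h) \<le> average (cube x0 (sqrt CARD('n) * (h / 2))) (indicator (strip i l (l + e)))"
          by (rule cube_in_strip[where F = "indicator (strip i l (l + e))" and c = 1, OF xs h(1,2) less_imp_le[OF e(1)] h(3)])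
            (erule F1, rule that)
        have "ennreal (t / p) \<le> lux_average (\<lambda>t. ennreal (\<eta> t)) (cube x0 (sqrt CARD('n) * (h / 2))) f"
          unfolding lux_average_def
        proof (rule Inf_greatest, clarify)
          fix c :: real
          assume c: "0 < c" "average (cube x0 (sqrt CARD('n) * (h / 2))) (\<lambda>y. ennreal (\<eta> (\<bar>f y\<bar> / c))) \<le> 1"
          \<comment> \<open>An admissible \<open>c\<close> satisfies
            \<open>\<eta> (t / c) \<le> h / e \<le> \<eta> p\<close>, and strict monotonicity of
            \<open>\<eta>\<close> beyond 1 turns this into \<open>t / c \<le> p\<close>.\<close>
          have "ennreal (\<eta> (t / c) * (e / h)) = ennreal (\<eta> (t / c)) * ennreal (e / h)"
            using t c e h young_nonneg[OF \<eta>(1), of "t / c"] by (intro ennreal_mult) auto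
          also have "\<dots> \<le> ennreal (\<eta> (t / c)) * average (cube x0 (sqrt CARD('n) * (h / 2))) (indicator (strip i l (l + e)))"
            using av by (intro mult_left_mono) auto
          also have "\<dots> = average (cube x0 (sqrt CARD('n) * (h / 2))) (\<lambda>y. ennreal (\<eta> (t / c)) * indicator (strip i l (l + e)) y)"
            by (rule average_cmult[symmetric]) (auto intro!: lebesgue_measurable_borel)
          also have "\<dots> \<le> average (cube x0 (sqrt CARD('n) * (h / 2))) (\<lambda>y. ennreal (\<eta> (\<bar>f y\<bar> / c)))"
            using F[of _ c] by (intro average_mono) (auto simp: indicator_def)
          also have "\<dots> \<le> ennreal 1" using c by simp
          finally have "\<eta> (t / c) * (e / h) \<le> 1" by simp
          then have "\<eta> (t / c) \<le> h / e" using e h by (simp add: field_simps)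
          also have "h / e \<le> \<eta> p" using he e by (simp add: field_simps)
          finally have "\<not> p < t / c" using young_strict_mono[OF \<eta>(1,2) p(1), of "t / c"] by auto
          then have "t / p \<le> c" using c p by (simp add: field_simps)
          then show "ennreal (t / p) \<le> ennreal c" by (rule ennreal_leI)
        qed
        then show ?thesis using x0 by blast
      qed
      then obtain x0 where x0: "x0 \<in> strip i l (l + h)" "x \<in> cube x0 (sqrt CARD('n) * (h / 2))"
        and lx: "ennreal (t / p) \<le> lux_average (\<lambda>t. ennreal (\<eta> t)) (cube x0 (sqrt CARD('n) * (h / 2))) f"
        by blast
      have r: "0 < sqrt CARD('n) * (h / 2)" using h by simp
      \<comment> \<open>The last strip together with its gap ends at \<open>L\<close>, so all
        centres stay where \<open>\<rho>\<close> is at least \<open>\<delta>\<close>.\<close>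
      have "l + d = (real k + 1) * d" by (simp add: l_def distrib_right)
      also have "\<dots> \<le> real m * d" using k d by (intro mult_right_mono) auto
      also have "\<dots> = L" using m0 by (simp add: d_def)
      finally have "l + h \<le> L" using hd by linarith
      moreover have "0 \<le> l" using d by (simp add: l_def)
      ultimately have "strip i l (l + h) \<subseteq> strip i 0 L" by (intro strip_mono) auto
      then have "\<delta> \<le> \<rho> x0" using x0 \<delta> by blast
      moreover have "sqrt CARD('n) * (h / 2) \<le> sqrt CARD('n) * d0"
        using hd h d by (intro mult_left_mono) auto
      ultimately have "sqrt CARD('n) * (h / 2) \<le> \<rho> x0" using d0 by linarith
      then have "2 powr (- \<sigma>) \<le> (1 + sqrt CARD('n) * (h / 2) / \<rho> x0) powr (- \<sigma>)"
        by (intro powr_critical_ge r \<sigma>)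
      then have "ennreal (2 powr (- \<sigma>)) * ennreal (t / p) \<le>
        ennreal ((1 + sqrt CARD('n) * (h / 2) / \<rho> x0) powr (- \<sigma>)) * lux_average (\<lambda>t. ennreal (\<eta> t)) (cube x0 (sqrt CARD('n) * (h / 2))) f"
        by (intro mult_mono ennreal_leI lx) auto
      also have "\<dots> \<le> M x" unfolding M_def by (rule orlicz_maximal_ge[OF r x0(2)])
      also have "ennreal (2 powr (- \<sigma>)) * ennreal (t / p) = ennreal (2 powr (- \<sigma>) * (t / p))"
        using t p by (intro ennreal_mult[symmetric]) auto
      finally have "ennreal ((2 powr (- \<sigma>) * (t / p)) / (2 * C)) \<le> M x / ennreal (2 * C)"
        using t p C by (intro ennreal_divide_ge) auto
      moreover have "(2 powr (- \<sigma>) * (t / p)) / (2 * C) = \<kappa> * t / p" by (simp add: \<kappa>_def)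
      moreover have "\<kappa> * t = T" using \<kappa> by (simp add: t_def)
      ultimately show ?thesis by simp
    qed
    have "ennreal (real m * e) * (\<integral>\<^sup>+s\<in>{T / P..T}. ennreal (a s * \<eta> (T / s)) \<partial>lborel) \<le> modular \<phi> (\<lambda>_. 1) (\<lambda>x. M x / ennreal (2 * C))"
      by (rule modular_ge_strips[OF T P e, where i = i]) (rule gl)
    also note mod2
    finally have le: "ennreal (1 / \<psi> t) * (\<integral>\<^sup>+s\<in>{T / P..T}. ennreal (a s * \<eta> (T / s)) \<partial>lborel) \<le> 1"
      unfolding me .
    have "(\<integral>\<^sup>+s\<in>{T / P..T}. ennreal (a s * \<eta> (T / s)) \<partial>lborel)
      = ennreal (\<psi> t) * (ennreal (1 / \<psi> t) * (\<integral>\<^sup>+s\<in>{T / P..T}. ennreal (a s * \<eta> (T / s)) \<partial>lborel))"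
      using \<psi>t by (simp add: mult.assoc[symmetric] ennreal_mult[symmetric])
    also have "\<dots> \<le> ennreal (\<psi> t) * 1"
      by (intro mult_left_mono le) auto
    finally show ?thesis by (simp add: t_def)
  qed
  define D where "D = max 1 (1 / \<kappa>)"
  show ?thesis
  proof (rule primitive_condition_from_tests)
    show "0 \<le> D" by (simp add: D_def)
    fix T P :: real assume T: "0 < T" and P: "1 \<le> P"
    have "0 \<le> 1 / \<kappa> * T" using \<kappa> T by simp
    moreover have "1 / \<kappa> * T \<le> D * T" using T by (intro mult_right_mono) (auto simp: D_def)
    ultimately have "\<psi> (1 / \<kappa> * T) \<le> \<psi> (D * T)" "0 \<le> \<psi> (1 / \<kappa> * T)"
      by (auto intro: psi.Phi_mono psi.Phi_nonneg)
    then have "1 * \<psi> (1 / \<kappa> * T) \<le> D * \<psi> (D * T)"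
      by (intro mult_mono) (auto simp: D_def)
    then have "ennreal (\<psi> (1 / \<kappa> * T)) \<le> ennreal (D * \<psi> (D * T))" by (intro ennreal_leI) simp
    with test[OF T P] show "(\<integral>\<^sup>+s\<in>{T / P..T}. ennreal (a s * \<eta> (T / s)) \<partial>lborel) \<le> ennreal (D * \<psi> (D * T))"
      by (rule order_trans)
  qed
qed

end

theorem theorem1p2:
  fixes \<rho> :: "real ^ 'n \<Rightarrow> real" and \<eta> a b \<phi> \<psi> :: "real \<Rightarrow> real"
  assumes "critical_radius \<rho>"
    and "young_function \<eta>" and "normalized \<eta>" and "\<eta> differentiable_on {0..}" and "doubling \<eta>"
    and "continuous_on {0..} a" and "a 0 = 0" and "\<And>s. 0 < s \<Longrightarrow> 0 < a s"
    and "continuous_on {0..} b" and "b 0 = 0" and "\<And>s. 0 < s \<Longrightarrow> 0 < b s"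
    and "mono_on {0..} b" and "filterlim b at_top at_top"
    and "\<And>t. 0 \<le> t \<Longrightarrow> \<phi> t = integral {0..t} a"
    and "\<And>t. 0 \<le> t \<Longrightarrow> \<psi> t = integral {0..t} b"
    and "young_function \<phi>"
  shows "(dini_condition \<eta> a b \<longleftrightarrow> weighted_modular_inequality \<rho> \<eta> \<phi> \<psi>) \<and>
         (dini_condition \<eta> a b \<longleftrightarrow> weighted_norm_inequality \<rho> \<eta> \<phi> \<psi>) \<and>
         (dini_condition \<eta> a b \<longleftrightarrow> modular_inequality \<rho> \<eta> \<phi> \<psi>) \<and>
         (dini_condition \<eta> a b \<longleftrightarrow> quotient_modular_inequality \<rho> \<eta> \<phi> \<psi>) \<and>
         (dini_condition \<eta> a b \<longleftrightarrow> norm_inequality \<rho> \<eta> \<phi> \<psi>)"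
proof -
  \<comment> \<open>The divergence of \<open>b\<close> enters here: it gives \<open>\<psi>\<close>
    the growth that \<open>integrator\<close> demands.\<close>
  have \<psi>_unbounded: "filterlim \<psi> at_top at_top"
    by (rule antiderivative.unbounded_if_derivative_unbounded[of b])
      (use assms(9-13,15) in \<open>auto simp: antiderivative_def\<close>)
  interpret dini_setting a b \<phi> \<psi> \<eta>
    by unfold_locales (use assms \<psi>_unbounded in \<open>auto simp: young_function_def\<close>)
  have \<rho>: "\<And>x. 0 < \<rho> x" using assms(1) by (simp add: critical_radius_def)
  have "norm_inequality \<rho> \<eta> \<phi> \<psi> \<Longrightarrow> dini_condition \<eta> a b"
    using norm_imp_primitive[OF _ assms(1)] primitive_imp_dini by blast
  moreover have "quotient_modular_inequality \<rho> \<eta> \<phi> \<psi> \<Longrightarrow> dini_condition \<eta> a b"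
    using quotient_imp_primitive[OF _ assms(1)] primitive_imp_dini by blast
  \<comment> \<open>The implications form the cycles (a), (b), (c), (f), (a) and (a), (e), (a), with
    (d) lying between (b) and (f).\<close>
  ultimately show ?thesis
    using dini_imp_weighted_modular[of \<rho>, OF _ \<rho>] weighted_modular_imp_weighted_norm[of \<rho>, OF _ \<rho>]
      weighted_modular_imp_modular[of \<rho>, OF _ \<rho>] weighted_norm_imp_norm[of \<rho>, OF _ \<rho>]
      modular_imp_norm_unweighted[of \<rho>, OF _ \<rho>] dini_imp_quotient[of \<rho>, OF _ \<rho>]
    by blast
qed

end
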